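(* Let $p(k)$, $q(k)$ and $r(k)$ be real polynomials in $k$ of degrees $m$, $n$ and $l$, let $\mu(k)=\frac{2k^2}{1+k^2}$, and let $$I(k)=p(k)K(k)+q(k)E(k)+r(k)\Pi(\mu(k),k),\qquad k\in(-1,1).$$ Then the number of zeros of $I(k)$ on $(-1,1)$, taking into account their multiplicities, does not exceed $$\psi(m,n,l)=\begin{cases}2\max\{m,n\}+3l+11,&\text{if } l\le\max\{m,n\}+2,\\ 5l+7,&\text{if } l>\max\{m,n\}+2.\end{cases}$$ Moreover, there exist real polynomials $p(k)$, $q(k)$ and $r(k)$, of degrees $m$, $n$ and $l$, such that $I(k)\not\equiv0$ and $I(k)$ has $m+n+l+2$ zeros on the interval $(-1,1)$.
   Context: The complete elliptic integrals of the first, second and third kinds are, for $k\in(-1,1)$, $$K(k)=\int_0^1\frac{dz}{\sqrt{(1-z^2)(1-k^2z^2)}},\quad E(k)=\int_0^1\frac{\sqrt{1-k^2z^2}}{\sqrt{1-z^2}}dz,\quad \Pi(\mu,k)=\int_0^1\frac{dz}{(1-\mu z^2)\sqrt{(1-z^2)(1-k^2z^2)}}.$$ It is assumed that $r\not\equiv0$. The number of zeros of a function always means the number of its isolated zeros, counted with multiplicity where so stated. *)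

theory Defs
  imports "HOL-Analysis.Analysis" "HOL-Computational_Algebra.Polynomial"
begin

(* The integrands are nonnegative for -1 < k < 1 and mu < 1, and the singularity at z = 1
   is integrable, so the improper integrals are ordinary integrals over [0,1]; the junk value
   of the quotient at the single point z = 1 is irrelevant. *)

definition ellipticK :: "real \<Rightarrow> real" where
  "ellipticK k = integral {0..1} (\<lambda>z. 1 / sqrt ((1 - z\<^sup>2) * (1 - k\<^sup>2 * z\<^sup>2)))"

definition ellipticE :: "real \<Rightarrow> real" where
  "ellipticE k = integral {0..1} (\<lambda>z. sqrt (1 - k\<^sup>2 * z\<^sup>2) / sqrt (1 - z\<^sup>2))"

definition ellipticPi :: "real \<Rightarrow> real \<Rightarrow> real" where
  "ellipticPi \<mu> k =
     integral {0..1} (\<lambda>z. 1 / ((1 - \<mu> * z\<^sup>2) * sqrt ((1 - z\<^sup>2) * (1 - k\<^sup>2 * z\<^sup>2))))"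

definition mu :: "real \<Rightarrow> real" where
  "mu k = 2 * k\<^sup>2 / (1 + k\<^sup>2)"

definition elliptic_comb :: "real poly \<Rightarrow> real poly \<Rightarrow> real poly \<Rightarrow> real \<Rightarrow> real" where
  "elliptic_comb p q r k =
     poly p k * ellipticK k + poly q k * ellipticE k + poly r k * ellipticPi (mu k) k"

definition isolated_zeros_on :: "(real \<Rightarrow> real) \<Rightarrow> real set \<Rightarrow> real set" where
  "isolated_zeros_on f S = {x. x isolated_in {y \<in> S. f y = 0}}"

(* Order of the first nonvanishing derivative. Only meaningful where f is smooth and some
   derivative is nonzero, as at an isolated zero of a real analytic function. *)
definition zero_multiplicity :: "(real \<Rightarrow> real) \<Rightarrow> real \<Rightarrow> nat" where
  "zero_multiplicity f x = (LEAST j. (deriv ^^ j) f x \<noteq> 0)"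

definition psi :: "nat \<Rightarrow> nat \<Rightarrow> nat \<Rightarrow> nat" where
  "psi m n l = (if l \<le> max m n + 2 then 2 * max m n + 3 * l + 11 else 5 * l + 7)"

end

(* Gauss's continued fraction for a quotient of contiguous hypergeometric functions shows that p K + q E
   is a locally uniform limit, on the unit disc, of zero-free functions times polynomials T_n. The
   denominators and numerators of the convergents have interlacing real zeros outside [-1,1], so sign changes
   force all but at most 2d+2 zeros of T_n (d bounding the degrees of p and q) to be real of modulus > 1;
   by Rouche, p K + q E has at most 2d+2 zeros in the disc.

   The function (1-k^2)/sqrt(1+k^2) * Pi(mu(k),k) has an elementary multiple of E - K as derivative.
   Hence differentiating (1-k^2)/sqrt(1+k^2) * I(k)/r(k) leaves a combination P K + Q E, with degrees at
   most d = max(max(m,n)+l+4, 2l+2). Rolle's theorem with multiplicities on the complement of the zeros of r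
   gives the bound 2d+l+3 = psi(m,n,l).

   For the lower bound, the functions k^i K, k^j E, k^s Pi are linearly independent (the indicial equation
   at k = i has no integer solution), so some combination alternates in sign at m+n+l+3 points; a small
   perturbation makes all leading coefficients nonzero. *)
theory Submission
  imports Defs "HOL-Complex_Analysis.Complex_Analysis"
begin

section \<open>Contiguous hypergeometric functions and their continued fraction\<close>

text \<open>The constant 2d + 2 is the difference of two counts that both grow with n:
  \<open>T_n\<close> has degree at most d + n, and at least n - d - 2 of its zeros are real of
  modulus greater than 1. Counting in the disc instead of on (-1, 1) is what carries multiplicities
  through the limit.

  The obstacle in the Rolle step is the zeros of r. Each may spoil two gaps between zeros of I, but
  at a zero of r of order a the numerator \<open>P K + Q E\<close> of the derivative vanishes to
  order at least a - 1, which refunds part of the loss. The net cost is at most one per zero, whence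
  the summand l in 2d + l + 3. The case that \<open>P K + Q E\<close> vanishes identically escapes
  this count; there I is a constant multiple of \<open>r * sqrt(1 + k^2) / (1 - k^2)\<close>.

  The half-integral index at k = i reflects the branch point of \<open>sqrt(1 + k^2)\<close>. For a
  vanishing combination with r nonzero it would force p and q to vanish at i to higher order than r,
  which the size of Pi on the imaginary axis forbids.\<close>

definition alph :: "nat \<Rightarrow> real" where "alph n = real (n div 2) + 1/2"
definition bet :: "nat \<Rightarrow> real" where "bet n = real ((n + 1) div 2) + 1/2"

text \<open>
  \<open>hcoef n\<close> lists the Taylor coefficients of the hypergeometric function with upper parameters
  \<open>alph n\<close>, \<open>bet n\<close> and lower parameter \<open>n + 1\<close>. Raising \<open>n\<close> raises the upper parameters alternately,
  which makes consecutive functions contiguous; \<open>kap\<close> are the resulting Gauss continued fraction coefficients.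
\<close>

definition hcoef :: "nat \<Rightarrow> nat \<Rightarrow> real" where
  "hcoef n j = pochhammer (alph n) j * pochhammer (bet n) j
                 / (pochhammer (real n + 1) j * fact j)"

definition kap :: "nat \<Rightarrow> real" where
  "kap n = (bet n)\<^sup>2 / ((real n + 1) * (real n + 2))"

lemma alph_pos: "alph n > 0" and bet_pos: "bet n > 0"
  by (auto simp: alph_def bet_def)

lemma alph_plus_bet: "alph n + bet n = real n + 1"
  by (cases "even n") (auto simp: alph_def bet_def elim!: evenE oddE)

lemma alph_Suc: "alph (Suc n) = bet n"
  by (simp add: alph_def bet_def)

lemma bet_Suc: "bet (Suc n) = alph n + 1"
  by (simp add: alph_def bet_def)

lemma kap_pos: "kap n > 0"
  using bet_pos[of n] by (auto simp: kap_def)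

lemma hcoef_pos: "hcoef n j > 0"
  unfolding hcoef_def using alph_pos bet_pos
  by (intro divide_pos_pos mult_pos_pos pochhammer_pos) auto

lemma hcoef_0 [simp]: "hcoef n 0 = 1"
  by (simp add: hcoef_def)

text \<open>Gauss's relation
  \<open>F(a,b;c) = F(a,b+1;c+1) - a(c-b)/(c(c+1)) z F(a+1,b+1;c+2)\<close>, read off at
  \<open>z^(j+1)\<close>. Reducing every Pochhammer symbol to length j leaves a polynomial identity.
  The factors stand in the order in which \<open>alph\<close> and \<open>bet\<close> exchange roles
  from one n to the next.\<close>

lemma hypergeometric_contiguous:
  fixes a b c :: real
  assumes "c > 0"
  shows "pochhammer b (Suc j) * pochhammer a (Suc j) / (pochhammer c (Suc j) * fact (Suc j)) =
    pochhammer a (Suc j) * pochhammer (b + 1) (Suc j) / (pochhammer (c + 1) (Suc j) * fact (Suc j))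
    - a * (c - b) / (c * (c + 1)) *
      (pochhammer (b + 1) j * pochhammer (a + 1) j / (pochhammer (c + 2) j * fact j))"
proof -
  define A B C where "A = pochhammer (a + 1) j" and "B = pochhammer (b + 1) j"
    and "C = pochhammer (c + 2) j"
  have C: "C > 0" unfolding C_def using assms by (intro pochhammer_pos) auto
  have 1: "pochhammer a (Suc j) = a * A" "pochhammer b (Suc j) = b * B"
    "pochhammer (b + 1) (Suc j) = B * (b + 1 + real j)"
    by (simp_all only: A_def B_def pochhammer_rec[of a] pochhammer_rec[of b] pochhammer_Suc[of "b + 1"])
  have 2: "pochhammer (c + 1) (Suc j) = (c + 1) * C"
    by (simp add: C_def pochhammer_rec add.commute add.left_commute)
  have "c * pochhammer (c + 1) (Suc j) = pochhammer c (Suc j) * (c + 1 + real j)"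
    using pochhammer_rec[of c "Suc j"] pochhammer_Suc[of c "Suc j"] by (simp add: algebra_simps)
  hence 3: "pochhammer c (Suc j) = c * (c + 1) * C / (c + 1 + real j)"
    using assms 2 by (simp add: field_simps)
  have f: "fact (Suc j) = (1 + real j) * fact j" by simp
  have j: "c + 1 + real j > 0" "1 + real j > 0" using assms by auto
  show ?thesis
    unfolding 1 2 3 f A_def[symmetric] B_def[symmetric] C_def[symmetric]
    using assms C j by (simp add: divide_simps) (simp add: algebra_simps)
qed

text \<open>Here \<open>c - b = n + 1 - alph n = bet n\<close>, which is why \<open>kap n\<close>
  has a square as numerator.\<close>

lemma hcoef_rec: "hcoef n (Suc j) = hcoef (Suc n) (Suc j) - kap n * hcoef (Suc (Suc n)) j"
proof -
  have k: "kap n = bet n * (real n + 1 - alph n) / ((real n + 1) * (real n + 1 + 1))"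
    using alph_plus_bet[of n] by (simp add: kap_def power2_eq_square add.commute eq_diff_eq[symmetric])
  show ?thesis
    unfolding k hcoef_def alph_Suc bet_Suc
    using hypergeometric_contiguous[of "real n + 1" "alph n" j "bet n"]
    by (simp add: add.commute add.left_commute)
qed

text \<open>The numbers \<open>binomial(2j, j) / 4^j\<close>: Taylor coefficients of
  \<open>(1 - v)^(-1/2)\<close> and, up to the factor \<open>pi / 2\<close>, the integrals of
  \<open>sin^(2j)\<close> over a quarter period.\<close>

definition wal :: "nat \<Rightarrow> real" where "wal j = pochhammer (1/2) j / fact j"

lemma wal_pos: "wal j > 0"
  unfolding wal_def by (intro divide_pos_pos pochhammer_pos) auto

lemma wal_Suc: "(real j + 1) * wal (Suc j) = (real j + 1/2) * wal j"
proof -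
  have "fact (Suc j) = (real j + 1) * fact j" by simp
  thus ?thesis by (simp add: wal_def pochhammer_Suc del: fact_Suc)
qed

lemma wal_0 [simp]: "wal 0 = 1" by (simp add: wal_def)

lemma wal_decreasing: "wal (Suc j) \<le> wal j"
proof -
  have "(real j + 1) * wal (Suc j) \<le> (real j + 1) * wal j"
    unfolding wal_Suc using wal_pos[of j] by (simp add: algebra_simps)
  thus ?thesis by simp
qed

lemma wal_le_1: "wal j \<le> 1"
  by (induction j) (use wal_decreasing in \<open>auto intro: order_trans\<close>)

lemma hcoef_zero: "hcoef 0 j = (wal j)\<^sup>2"
  by (simp add: hcoef_def alph_def bet_def wal_def power2_eq_square pochhammer_fact[symmetric])

lemma hcoef_one: "hcoef 1 j = 2 * wal j * wal (Suc j)"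
proof -
  have "pochhammer (2::real) j = fact (Suc j)"
    using pochhammer_fact[of "Suc j", where 'a=real] pochhammer_rec[of "1::real" j] by simp
  moreover have "pochhammer (1/2) (Suc j) = (1/2) * pochhammer (3/2::real) j"
    using pochhammer_rec[of "1/2::real" j] by simp
  ultimately show ?thesis
    by (simp add: hcoef_def alph_def bet_def wal_def del: fact_Suc)
       (simp add: divide_simps)
qed

text \<open>Only \<open>hcoef 0\<close> and \<open>hcoef 1\<close> are bounded directly. Contiguity,
  divided by \<open>kap n * x\<close>, expresses each further series by its two predecessors, so the
  induction carries pairs, and x = 0 is treated separately.\<close>

lemma summable_hcoef_real:
  assumes "0 \<le> x" "x < (1::real)"
  shows "summable (\<lambda>j. hcoef n j * x ^ j)"
proof -
  have *: "summable (\<lambda>j. hcoef n j * x ^ j) \<and> summable (\<lambda>j. hcoef (Suc n) j * x ^ j)"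
    if x: "0 < x" "x < 1" for x :: real
  proof (induction n)
    case 0
    have g: "summable (\<lambda>j. 2 * x ^ j)" using x by (intro summable_mult summable_geometric) auto
    have "hcoef 0 j \<le> 2" "hcoef 1 j \<le> 2" for j
      using wal_pos[of j] wal_le_1[of j] wal_pos[of "Suc j"] wal_le_1[of "Suc j"]
        power_le_one[of "wal j" 2] mult_le_one[of "wal j" "wal (Suc j)"]
      unfolding hcoef_zero hcoef_one by auto
    hence "norm (hcoef 0 j * x ^ j) \<le> 2 * x ^ j" "norm (hcoef (Suc 0) j * x ^ j) \<le> 2 * x ^ j" for j
      using x hcoef_pos[of 0 j] hcoef_pos[of 1 j] by (auto intro!: mult_right_mono simp: abs_mult)
    thus ?case by (intro conjI summable_comparison_test'[OF g])
  next
    case (Suc n)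
    have "hcoef (Suc (Suc n)) j * x ^ j =
       (hcoef (Suc n) (Suc j) * x ^ Suc j - hcoef n (Suc j) * x ^ Suc j) * (1 / (kap n * x))" for j
      using x kap_pos[of n] unfolding hcoef_rec[of n j] by (simp add: field_simps)
    moreover have "summable (\<lambda>j. (hcoef (Suc n) (Suc j) * x ^ Suc j - hcoef n (Suc j) * x ^ Suc j) * (1 / (kap n * x)))"
      using Suc by (intro summable_mult2 summable_diff) (simp_all only: summable_Suc_iff[of "\<lambda>j. hcoef _ j * x ^ j"])
    ultimately show ?case using Suc by simp
  qed
  show ?thesis
  proof (cases "x = 0")
    case True
    have "(\<lambda>j. hcoef n j * x ^ j) = (\<lambda>j. if j = 0 then hcoef n 0 else 0)"
      using True by (auto simp: fun_eq_iff)
    thus ?thesis by simp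
  next
    case False
    thus ?thesis using * assms by simp
  qed
qed

section \<open>The series on the unit disc\<close>

definition hF :: "nat \<Rightarrow> 'a \<Rightarrow> 'a :: {real_normed_field,banach}" where
  "hF n z = (\<Sum>j. of_real (hcoef n j) * z ^ j)"

lemma norm_hcoef: "norm (of_real (hcoef n j) * z ^ j :: 'a :: {real_normed_field}) = hcoef n j * norm z ^ j"
  using hcoef_pos[of n j] by (simp add: norm_mult norm_power)

lemma summable_hcoef:
  fixes z :: "'a :: {real_normed_field,banach}"
  assumes "norm z < 1"
  shows "summable (\<lambda>j. of_real (hcoef n j) * z ^ j)"
  by (rule summable_norm_cancel) (simp add: norm_hcoef summable_hcoef_real assms del: norm_mult)

lemma norm_hF_le:
  fixes z :: "'a :: {real_normed_field,banach}"
  assumes "norm z \<le> x" "x < 1"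
  shows "norm (hF n z) \<le> hF n x"
proof -
  have "norm (hF n z) \<le> (\<Sum>j. norm (of_real (hcoef n j) * z ^ j))"
    unfolding hF_def by (rule summable_norm) (use assms in \<open>simp add: norm_hcoef summable_hcoef_real del: norm_mult\<close>)
  also have "\<dots> = (\<Sum>j. hcoef n j * norm z ^ j)" by (simp only: norm_hcoef)
  also have "\<dots> \<le> (\<Sum>j. hcoef n j * x ^ j)"
  proof (rule suminf_le)
    show "hcoef n j * norm z ^ j \<le> hcoef n j * x ^ j" for j
      using assms hcoef_pos[of n j] by (intro mult_left_mono power_mono) auto
    have "0 \<le> x" using assms norm_ge_zero[of z] by linarith
    thus "summable (\<lambda>j. hcoef n j * norm z ^ j)" "summable (\<lambda>j. hcoef n j * x ^ j)"
      using assms by (auto intro!: summable_hcoef_real)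
  qed
  finally show ?thesis by (simp add: hF_def)
qed

lemma hF_pos:
  assumes "0 \<le> x" "x < (1::real)"
  shows "hF n x > 0"
proof -
  have "0 < (\<Sum>j<1. hcoef n j * x ^ j)" by simp
  also have "\<dots> \<le> (\<Sum>j. hcoef n j * x ^ j)"
    using assms hcoef_pos[of n] by (intro sum_le_suminf summable_hcoef_real) (auto intro!: mult_nonneg_nonneg simp: less_imp_le)
  finally show ?thesis by (simp add: hF_def)
qed

lemma hF_of_real:
  assumes "\<bar>x\<bar> < 1"
  shows "hF n (of_real x) = (of_real (hF n x) :: 'a :: {real_normed_field,banach})"
proof -
  have "(\<lambda>j. of_real (hcoef n j * x ^ j) :: 'a) sums of_real (\<Sum>j. hcoef n j * x ^ j)"
    using summable_hcoef[of x n] assms by (intro sums_of_real summable_sums) auto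
  thus ?thesis by (simp add: hF_def sums_iff)
qed

lemma hF_rec:
  fixes z :: "'a :: {real_normed_field,banach}"
  assumes "norm z < 1"
  shows "hF n z = hF (Suc n) z - of_real (kap n) * z * hF (Suc (Suc n)) z"
proof -
  have s: "hF m z = 1 + (\<Sum>j. of_real (hcoef m (Suc j)) * z ^ Suc j)" for m
    using suminf_split_initial_segment[OF summable_hcoef[OF assms, of m], of 1]
    by (simp add: hF_def)
  have "(\<Sum>j. of_real (hcoef n (Suc j)) * z ^ Suc j) =
     (\<Sum>j. of_real (hcoef (Suc n) (Suc j)) * z ^ Suc j
            - of_real (kap n) * z * (of_real (hcoef (Suc (Suc n)) j) * z ^ j))"
    by (intro suminf_cong) (simp add: hcoef_rec[of n] algebra_simps)
  also have "\<dots> = (\<Sum>j. of_real (hcoef (Suc n) (Suc j)) * z ^ Suc j)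
     - (\<Sum>j. of_real (kap n) * z * (of_real (hcoef (Suc (Suc n)) j) * z ^ j))"
    by (intro suminf_diff[symmetric] summable_mult summable_hcoef assms)
       (use summable_hcoef[OF assms, of "Suc n"] in \<open>subst summable_Suc_iff[of "\<lambda>j. of_real (hcoef (Suc n) j) * z ^ j"]\<close>)
  also have "(\<Sum>j. of_real (kap n) * z * (of_real (hcoef (Suc (Suc n)) j) * z ^ j))
     = of_real (kap n) * z * hF (Suc (Suc n)) z"
    unfolding hF_def by (intro suminf_mult summable_hcoef assms)
  finally show ?thesis using s[of n] s[of "Suc n"] by simp
qed

text \<open>
  Denominators and numerators of the convergents of \<open>hF 1 / hF 0\<close>.
\<close>

fun cfB :: "nat \<Rightarrow> 'a \<Rightarrow> 'a :: real_normed_field" where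
  "cfB 0 u = 1"
| "cfB (Suc 0) u = 1"
| "cfB (Suc (Suc n)) u = cfB (Suc n) u - of_real (kap n) * u * cfB n u"

fun cfA :: "nat \<Rightarrow> 'a \<Rightarrow> 'a :: real_normed_field" where
  "cfA 0 u = 0"
| "cfA (Suc 0) u = 1"
| "cfA (Suc (Suc n)) u = cfA (Suc n) u - of_real (kap n) * u * cfA n u"

text \<open>The functions \<open>hF n\<close> solve the recursion exactly, so the error of a
  convergent is one product without cancellation. It is used for convergence inside the disc and
  also for the order of contact at the origin.\<close>

lemma cf_remainder:
  fixes u :: "'a :: {real_normed_field,banach}"
  assumes "norm u < 1"
  shows "cfB n u * hF 1 u - cfA n u * hF 0 u = of_real (\<Prod>i<n. kap i) * u ^ n * hF (Suc n) u"
proof (induction n rule: induct_nat_012)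
  case 0 thus ?case by simp
next
  case 1 thus ?case using hF_rec[OF assms, of 0] by (simp add: algebra_simps)
next
  case (ge2 n)
  have "cfB (Suc (Suc n)) u * hF 1 u - cfA (Suc (Suc n)) u * hF 0 u =
    (cfB (Suc n) u * hF 1 u - cfA (Suc n) u * hF 0 u) -
    of_real (kap n) * u * (cfB n u * hF 1 u - cfA n u * hF 0 u)"
    by (simp add: algebra_simps)
  also have "\<dots> = of_real (\<Prod>i<Suc n. kap i) * u ^ Suc n * (hF (Suc (Suc n)) u - hF (Suc n) u)"
    unfolding ge2 by (simp add: algebra_simps)
  also have "hF (Suc (Suc n)) u - hF (Suc n) u = of_real (kap (Suc n)) * u * hF (Suc (Suc (Suc n))) u"
    using hF_rec[OF assms, of "Suc n"] by simp
  finally show ?case by (simp add: algebra_simps)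
qed

lemma cf_wronskian:
  "cfA (Suc n) u * cfB n u - cfA n u * cfB (Suc n) u = of_real (\<Prod>i<n. kap i) * u ^ n"
proof (induction n)
  case (Suc n)
  have "cfA (Suc (Suc n)) u * cfB (Suc n) u - cfA (Suc n) u * cfB (Suc (Suc n)) u =
    of_real (kap n) * u * (cfA (Suc n) u * cfB n u - cfA n u * cfB (Suc n) u)"
    by (simp add: algebra_simps)
  thus ?case unfolding Suc by (simp add: algebra_simps)
qed simp

text \<open>With \<open>r n = bet n / (n + 1)\<close> one has
  \<open>kap n = r n * (1 - r (n + 1))\<close>, a chain sequence: the bound by \<open>r n\<close> on
  the ratio of neighbours reproduces itself for all x up to 1.\<close>

lemma cfB_ratio:
  assumes "0 \<le> x" "x \<le> (1::real)"
  shows "cfB n x > 0 \<and> cfB (Suc n) x \<ge> bet n / (real n + 1) * cfB n x"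
proof (induction n)
  case 0 thus ?case by (simp add: bet_def)
next
  case (Suc n)
  have p: "cfB (Suc n) x > 0"
  proof -
    have "0 < bet n / (real n + 1) * cfB n x"
      using Suc bet_pos[of n] by (intro mult_pos_pos divide_pos_pos) auto
    thus ?thesis using Suc by linarith
  qed
  have "kap n * x * cfB n x \<le> kap n * 1 * cfB n x"
    using assms Suc kap_pos[of n] by (intro mult_right_mono mult_left_mono) auto
  also have "\<dots> = bet n / (real n + 2) * (bet n / (real n + 1) * cfB n x)"
    by (simp add: kap_def power2_eq_square mult_ac)
  also have "\<dots> \<le> bet n / (real n + 2) * cfB (Suc n) x"
    using Suc bet_pos[of n] by (intro mult_left_mono) auto
  finally have "cfB (Suc (Suc n)) x \<ge> (1 - bet n / (real n + 2)) * cfB (Suc n) x"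
    by (simp add: algebra_simps)
  also have "1 - bet n / (real n + 2) = bet (Suc n) / (real (Suc n) + 1)"
    using alph_plus_bet[of n] by (simp add: bet_Suc field_simps)
  finally show ?case using p by simp
qed

lemma cfB_pos: "0 \<le> x \<Longrightarrow> x \<le> (1::real) \<Longrightarrow> cfB n x > 0"
  using cfB_ratio by blast

text \<open>The recursion subtracts an earlier term with the factor \<open>kap n * u\<close>, and
  \<open>kap n > 0\<close>; among all u of modulus at most x the worst case is therefore u = x. What
  propagates is the comparison of ratios of neighbours, stated cross-multiplied in
  \<open>r\<close>.\<close>

lemma norm_cfB_ge:
  fixes u :: "'a :: real_normed_field"
  assumes "norm u \<le> x" "x \<le> 1"
  shows "cfB n x \<le> norm (cfB n u)"
proof -
  have x0: "0 \<le> x" using assms norm_ge_zero[of u] by linarith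
  note pos = cfB_pos[OF x0 assms(2)]
  have r: "cfB (Suc n) x * norm (cfB n u) \<le> norm (cfB (Suc n) u) * cfB n x" for n
  proof (induction n)
    case 0 thus ?case by simp
  next
    case (Suc n)
    have "norm (cfB (Suc (Suc n)) u) \<ge> norm (cfB (Suc n) u) - norm (of_real (kap n) * u * cfB n u)"
      by (simp add: norm_triangle_ineq2)
    moreover have "norm (of_real (kap n) * u * cfB n u) \<le> kap n * x * norm (cfB n u)"
      using kap_pos[of n] assms by (simp add: norm_mult mult_right_mono mult_left_mono)
    ultimately have 1: "norm (cfB (Suc (Suc n)) u) * cfB (Suc n) x \<ge>
        (norm (cfB (Suc n) u) - kap n * x * norm (cfB n u)) * cfB (Suc n) x"
      using pos[of "Suc n"] by (intro mult_right_mono) linarith+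
    have "kap n * x * (cfB (Suc n) x * norm (cfB n u)) \<le> kap n * x * (norm (cfB (Suc n) u) * cfB n x)"
      using Suc kap_pos[of n] x0 by (intro mult_left_mono) auto
    thus ?case using 1 by (simp add: algebra_simps)
  qed
  show ?thesis
  proof (induction n)
    case 0 thus ?case by simp
  next
    case (Suc n)
    have "cfB (Suc n) x * cfB n x \<le> cfB (Suc n) x * norm (cfB n u)"
      using Suc pos[of "Suc n"] by (intro mult_left_mono) auto
    also have "\<dots> \<le> norm (cfB (Suc n) u) * cfB n x" by (rule r)
    finally show ?case using pos[of n] by simp
  qed
qed

lemma cfB_nonzero:
  fixes u :: "'a :: real_normed_field"
  assumes "norm u \<le> 1"
  shows "cfB n u \<noteq> 0"
  using norm_cfB_ge[OF assms order_refl, of n] cfB_pos[of 1 n] by auto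

text \<open>By the Wronskian the convergents \<open>cfA n / cfB n\<close> do not decrease with n,
  and they start at 0.\<close>

lemma cfA_nonneg:
  assumes "0 \<le> x" "x \<le> (1::real)"
  shows "cfA n x \<ge> 0"
proof (induction n)
  case (Suc n)
  have "cfA (Suc n) x * cfB n x \<ge> cfA n x * cfB (Suc n) x"
    using cf_wronskian[of n x] assms kap_pos
    by (simp add: algebra_simps) (metis add_increasing2 mult_nonneg_nonneg order_refl prod_nonneg less_imp_le zero_le_power)
  moreover have "cfA n x * cfB (Suc n) x \<ge> 0"
    using Suc cfB_pos[OF assms, of "Suc n"] by simp
  ultimately have "cfA (Suc n) x * cfB n x \<ge> 0" by linarith
  thus ?case using cfB_pos[OF assms, of n] by (simp add: zero_le_mult_iff)
qed auto

text \<open>The product of the \<open>kap i\<close> and \<open>hF (n + 1)\<close> needs no estimate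
  of its growth: together with \<open>x ^ n\<close> it equals the remainder at the positive point x,
  which is at most \<open>cfB n x * hF 1 x\<close> because the subtracted part is nonnegative. The
  remaining power of \<open>norm u / x\<close> makes the error geometric.\<close>

lemma cf_remainder_bound:
  fixes u :: "'a :: {real_normed_field,banach}"
  assumes "norm u \<le> x" "0 < x" "x < 1"
  shows "norm ((cfB n u * hF 1 u - cfA n u * hF 0 u) / cfB n u) \<le> (norm u / x) ^ n * hF 1 x"
proof -
  have K: "(\<Prod>i<n. kap i) \<ge> 0" using kap_pos by (intro prod_nonneg) (auto intro: less_imp_le)
  have u: "norm u < 1" using assms by auto
  have "norm (cfB n u * hF 1 u - cfA n u * hF 0 u) = (\<Prod>i<n. kap i) * norm u ^ n * norm (hF (Suc n) u)"
    unfolding cf_remainder[OF u] using K by (simp add: norm_mult norm_power del: of_real_prod)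
  also have "\<dots> \<le> (\<Prod>i<n. kap i) * norm u ^ n * hF (Suc n) x"
    using K norm_hF_le[OF assms(1,3), of "Suc n"] by (intro mult_left_mono) auto
  also have "\<dots> = (norm u / x) ^ n * ((\<Prod>i<n. kap i) * x ^ n * hF (Suc n) x)"
    using assms by (simp add: power_divide)
  also have "(\<Prod>i<n. kap i) * x ^ n * hF (Suc n) x = cfB n x * hF 1 x - cfA n x * hF 0 x"
    using cf_remainder[of x n] assms by simp
  also have "\<dots> \<le> cfB n x * hF 1 x"
    using cfA_nonneg[of x n] hF_pos[of x 0] assms by simp
  finally have 1: "norm (cfB n u * hF 1 u - cfA n u * hF 0 u) \<le> (norm u / x) ^ n * (cfB n x * hF 1 x)"
    using assms by (simp add: mult_left_mono)
  have 2: "0 < cfB n x" "cfB n x \<le> norm (cfB n u)"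
    using cfB_pos[of x n] norm_cfB_ge[OF assms(1)] assms by auto
  have "norm ((cfB n u * hF 1 u - cfA n u * hF 0 u) / cfB n u) \<le>
        ((norm u / x) ^ n * (cfB n x * hF 1 x)) / norm (cfB n u)"
    unfolding norm_divide by (intro divide_right_mono 1) auto
  also have "\<dots> \<le> ((norm u / x) ^ n * (cfB n x * hF 1 x)) / cfB n x"
    using 2 hF_pos[of x 1] assms
    by (intro divide_left_mono mult_pos_pos mult_nonneg_nonneg) (auto intro: less_le_trans)
  also have "\<dots> = (norm u / x) ^ n * hF 1 x" using 2 by simp
  finally show ?thesis .
qed

text \<open>The Enestrom-Kakeya argument: the coefficients of \<open>hF 0\<close> decrease, so at a
  zero z the value 1 would be the sum of a series whose absolute values add up to
  \<open>1 - (1 - norm z) * hF 0 (norm z) < 1\<close>.\<close>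

lemma hF_zero_nonzero:
  fixes z :: "'a :: {real_normed_field,banach}"
  assumes "norm z < 1"
  shows "hF 0 z \<noteq> 0"
proof
  assume z: "hF 0 z = 0"
  have key: "(\<lambda>j. of_real (hcoef 0 j - hcoef 0 (Suc j)) * w ^ Suc j) sums (1 - (1 - w) * hF 0 w)"
    if "norm w < 1" for w :: "'b :: {real_normed_field,banach}"
  proof -
    have s: "(\<lambda>j. of_real (hcoef 0 j) * w ^ j) sums hF 0 w"
      unfolding hF_def by (intro summable_sums summable_hcoef that)
    have "(\<lambda>j. w * (of_real (hcoef 0 j) * w ^ j) - of_real (hcoef 0 (Suc j)) * w ^ Suc j)
       sums (w * hF 0 w - (hF 0 w - 1))"
      by (intro sums_diff sums_mult s, subst sums_Suc_iff[of "\<lambda>j. of_real (hcoef 0 j) * w ^ j"])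
         (use s in simp)
    thus ?thesis by (simp add: algebra_simps)
  qed
  have dec: "hcoef 0 (Suc j) \<le> hcoef 0 j" for j
    unfolding hcoef_zero using wal_decreasing[of j] wal_pos[of "Suc j"] by (intro power_mono) auto
  define f where "f = (\<lambda>j. of_real (hcoef 0 j - hcoef 0 (Suc j)) * z ^ Suc j)"
  have n: "norm (f j) = (hcoef 0 j - hcoef 0 (Suc j)) * norm z ^ Suc j" for j
    unfolding f_def norm_mult norm_power norm_of_real using dec[of j] by simp
  have r: "(\<lambda>j. norm (f j)) sums (1 - (1 - norm z) * hF 0 (norm z))"
    unfolding n using key[of "norm z"] assms by simp
  have "1 = norm (suminf f)"
    using key[OF assms] z by (simp add: f_def sums_iff)
  also have "\<dots> \<le> suminf (\<lambda>j. norm (f j))"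
    using r by (intro summable_norm) (simp add: sums_iff)
  also have "\<dots> = 1 - (1 - norm z) * hF 0 (norm z)" using r by (simp add: sums_iff)
  also have "\<dots> < 1" using assms hF_pos[of "norm z" 0] by simp
  finally show False by simp
qed

section \<open>Differentiation rules for the two basic series\<close>

lemma hF_has_derivative_series:
  fixes z :: "'a :: {real_normed_field,banach}"
  assumes "norm z < 1"
  obtains D where "(hF n has_field_derivative D) (at z)"
    and "(\<lambda>j. of_real (real (Suc j) * hcoef n (Suc j)) * z ^ j) sums D"
    and "(\<lambda>j. of_real (real j * hcoef n j) * z ^ j) sums (z * D)"
proof -
  define c :: "nat \<Rightarrow> 'a" where "c = (\<lambda>j. of_real (hcoef n j))"
  have s: "summable (\<lambda>j. c j * w ^ j)" if "norm w < 1" for w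
    unfolding c_def by (intro summable_hcoef that)
  define D where "D = (\<Sum>j. diffs c j * z ^ j)"
  have "(\<lambda>j. diffs c j * z ^ j) sums D"
    unfolding D_def by (intro summable_sums termdiff_converges_all termdiff_converges[where K = 1] assms s)
  hence D: "(\<lambda>j. of_real (real (Suc j) * hcoef n (Suc j)) * z ^ j) sums D"
    by (simp add: diffs_def c_def)
  have "(\<lambda>j. z * (of_real (real (Suc j) * hcoef n (Suc j)) * z ^ j)) sums (z * D)"
    by (intro sums_mult D)
  hence "(\<lambda>j. of_real (real (Suc j) * hcoef n (Suc j)) * z ^ Suc j) sums (z * D)"
    by (simp add: mult_ac)
  hence "(\<lambda>j. of_real (real j * hcoef n j) * z ^ j) sums (z * D)"
    by (subst (asm) sums_Suc_iff[of "\<lambda>j. of_real (real j * hcoef n j) * z ^ j"]) simp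
  moreover have "((\<lambda>w. \<Sum>j. c j * w ^ j) has_field_derivative D) (at z)"
    unfolding D_def by (rule termdiffs_strong'[where K = 1]) (use assms s in auto)
  hence "(hF n has_field_derivative D) (at z)"
    by (simp add: hF_def[abs_def] c_def)
  ultimately show ?thesis using D that by blast
qed

text \<open>The factor \<open>1 - z\<close> is cleared first because the coefficients of
  \<open>(1 - z) * D\<close> are combinations of those of \<open>hF 0\<close> and
  \<open>hF 1\<close>; this is the fact \<open>c\<close>.\<close>

lemma hF_zero_has_derivative:
  fixes z :: "'a :: {real_normed_field,banach}"
  assumes "norm z < 1"
  shows "(hF 0 has_field_derivative (hF 0 z / 2 - hF 1 z / 4) / (1 - z)) (at z)"
proof -
  obtain D where D: "(hF 0 has_field_derivative D) (at z)"
    and 1: "(\<lambda>j. of_real (real (Suc j) * hcoef 0 (Suc j)) * z ^ j) sums D"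
    and 2: "(\<lambda>j. of_real (real j * hcoef 0 j) * z ^ j) sums (z * D)"
    using hF_has_derivative_series[OF assms, of 0] by blast
  have c: "real (Suc j) * hcoef 0 (Suc j) - real j * hcoef 0 j = hcoef 0 j / 2 - hcoef 1 j / 4" for j
  proof -
    have "real (Suc j) * hcoef 0 (Suc j) = (real j + 1/2) * wal j * wal (Suc j)"
      using wal_Suc[of j] by (simp add: hcoef_zero power2_eq_square add.commute)
    moreover have "(real j + 1) * wal (Suc j) * wal j = (real j + 1/2) * wal j * wal j"
      using wal_Suc[of j] by simp
    ultimately show ?thesis
      unfolding hcoef_zero hcoef_one by (simp add: power2_eq_square algebra_simps)
  qed
  have "(\<lambda>j. of_real (real (Suc j) * hcoef 0 (Suc j)) * z ^ j - of_real (real j * hcoef 0 j) * z ^ j) sums (D - z * D)"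
    by (intro sums_diff 1 2)
  hence "(\<lambda>j. of_real (hcoef 0 j / 2 - hcoef 1 j / 4) * z ^ j) sums (D - z * D)"
    by (simp only: c[symmetric] of_real_diff left_diff_distrib)
  moreover have "(\<lambda>j. of_real (hcoef 0 j) * z ^ j / 2 - of_real (hcoef 1 j) * z ^ j / 4) sums (hF 0 z / 2 - hF 1 z / 4)"
    unfolding hF_def by (intro sums_diff sums_divide summable_sums summable_hcoef assms)
  hence "(\<lambda>j. of_real (hcoef 0 j / 2 - hcoef 1 j / 4) * z ^ j) sums (hF 0 z / 2 - hF 1 z / 4)"
    by (simp add: left_diff_distrib)
  ultimately have "D - z * D = hF 0 z / 2 - hF 1 z / 4" by (rule sums_unique2)
  moreover have "1 - z \<noteq> 0" using assms by auto
  ultimately have "D = (hF 0 z / 2 - hF 1 z / 4) / (1 - z)"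
    by (simp add: eq_divide_eq left_diff_distrib algebra_simps)
  thus ?thesis using D by simp
qed

text \<open>The derivative of \<open>hF 1\<close> alone would bring z into the denominator. With the
  factor z, the combinations of \<open>hF 0\<close> and \<open>z * hF 1\<close> are closed under
  differentiation, with \<open>1 - z\<close> as the only new denominator.\<close>

lemma id_times_hF_one_has_derivative:
  fixes z :: "'a :: {real_normed_field,banach}"
  assumes "norm z < 1"
  shows "((\<lambda>z. z * hF 1 z) has_field_derivative (hF 0 z - z * hF 1 z / 2) / (1 - z)) (at z)"
proof -
  obtain D0 where D0: "(hF 0 has_field_derivative D0) (at z)"
    and 1: "(\<lambda>j. of_real (real (Suc j) * hcoef 0 (Suc j)) * z ^ j) sums D0"
    using hF_has_derivative_series[OF assms, of 0] by blast
  obtain D where D: "(hF 1 has_field_derivative D) (at z)"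
    and 2: "(\<lambda>j. of_real (real j * hcoef 1 j) * z ^ j) sums (z * D)"
    using hF_has_derivative_series[OF assms, of 1] by blast
  have c: "real j * hcoef 1 j = 2 * (real (Suc j) * hcoef 0 (Suc j)) - hcoef 1 j / 2" for j
  proof -
    have "real (Suc j) * hcoef 0 (Suc j) = (real j + 1/2) * wal j * wal (Suc j)"
      using wal_Suc[of j] by (simp add: hcoef_zero power2_eq_square add.commute)
    thus ?thesis unfolding hcoef_one by (simp add: algebra_simps)
  qed
  have "(\<lambda>j. 2 * (of_real (real (Suc j) * hcoef 0 (Suc j)) * z ^ j) - of_real (hcoef 1 j) * z ^ j / 2)
          sums (2 * D0 - hF 1 z / 2)"
    unfolding hF_def by (intro sums_diff sums_mult 1 sums_divide summable_sums summable_hcoef assms)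
  moreover have "2 * (of_real (real (Suc j) * hcoef 0 (Suc j)) * z ^ j) - of_real (hcoef 1 j) * z ^ j / 2
      = of_real (real j * hcoef 1 j) * z ^ j" for j
    unfolding c by (simp add: left_diff_distrib)
  ultimately have "z * D = 2 * D0 - hF 1 z / 2" using sums_unique2[OF 2] by simp
  moreover have "D0 = (hF 0 z / 2 - hF 1 z / 4) / (1 - z)"
    using DERIV_unique[OF D0 hF_zero_has_derivative[OF assms]] .
  moreover have "1 - z \<noteq> 0" using assms by auto
  ultimately have "z * D = 2 * ((hF 0 z / 2 - hF 1 z / 4) / (1 - z)) - hF 1 z / 2" and z: "1 - z \<noteq> 0"
    by simp_all
  hence "z * D + hF 1 z = 2 * ((hF 0 z / 2 - hF 1 z / 4) / (1 - z)) + hF 1 z / 2"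
    using mult_2[of "hF 1 z / 2"] by (metis add.assoc diff_add_cancel mult.commute nonzero_eq_divide_eq zero_neq_numeral)
  hence "(z * D + hF 1 z) * (1 - z) = hF 0 z - hF 1 z / 2 + hF 1 z / 2 * (1 - z)"
    using z by (simp add: distrib_right)
  also have "\<dots> = hF 0 z - z * hF 1 z / 2"
    by (simp only: right_diff_distrib mult_1_right) simp
  finally have "z * D + hF 1 z = (hF 0 z - z * hF 1 z / 2) / (1 - z)"
    using z by (simp add: eq_divide_eq)
  thus ?thesis using DERIV_mult[OF DERIV_ident D] by (simp add: add.commute mult.commute)
qed

section \<open>Zeros of the convergents\<close>

abbreviation cpoly :: "real poly \<Rightarrow> complex poly" where "cpoly \<equiv> map_poly complex_of_real"

lemma cpoly_add: "cpoly (p + q) = cpoly p + cpoly q"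
  by (intro poly_eqI) (simp add: coeff_map_poly)

lemma cpoly_diff: "cpoly (p - q) = cpoly p - cpoly q"
  by (intro poly_eqI) (simp add: coeff_map_poly)

lemma cpoly_mult: "cpoly (p * q) = cpoly p * cpoly q"
  by (intro poly_eqI) (simp add: coeff_map_poly coeff_mult)

lemma cpoly_smult: "cpoly (smult c p) = smult (of_real c) (cpoly p)"
  by (intro poly_eqI) (simp add: coeff_map_poly)

lemma cpoly_pderiv: "cpoly (pderiv p) = pderiv (cpoly p)"
  by (intro poly_eqI) (simp add: coeff_map_poly coeff_pderiv)

lemma cpoly_pCons: "cpoly (pCons a p) = pCons (of_real a) (cpoly p)"
  by (simp add: map_poly_pCons)

lemmas cpoly_simps = cpoly_add cpoly_diff cpoly_mult cpoly_smult cpoly_pderiv cpoly_pCons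

lemma degree_cpoly [simp]: "degree (cpoly p) = degree p"
  by (simp add: degree_map_poly)

lemma cpoly_eq_0_iff [simp]: "cpoly p = 0 \<longleftrightarrow> p = 0"
  by (simp add: map_poly_eq_0_iff)

lemma poly_cpoly_of_real: "poly (cpoly p) (of_real x) = of_real (poly p x)"
  by (induction p) (simp_all add: cpoly_pCons)

fun Bp :: "nat \<Rightarrow> real poly" where
  "Bp 0 = 1"
| "Bp (Suc 0) = 1"
| "Bp (Suc (Suc n)) = Bp (Suc n) - smult (kap n) (monom 1 2 * Bp n)"

fun Ap :: "nat \<Rightarrow> real poly" where
  "Ap 0 = 0"
| "Ap (Suc 0) = 1"
| "Ap (Suc (Suc n)) = Ap (Suc n) - smult (kap n) (monom 1 2 * Ap n)"

lemma cpoly_monom: "cpoly (monom c n) = monom (of_real c) n"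
  by (simp add: map_poly_monom)

lemma poly_Bp: "poly (Bp n) x = cfB n (x\<^sup>2)"
  by (induction n rule: Bp.induct) (simp_all add: poly_monom)

lemma poly_Ap: "poly (Ap n) x = cfA n (x\<^sup>2)"
  by (induction n rule: Ap.induct) (simp_all add: poly_monom)

lemma poly_cpoly_Bp: "poly (cpoly (Bp n)) x = cfB n (x\<^sup>2)"
  by (induction n rule: Bp.induct) (simp_all add: poly_monom cpoly_simps cpoly_monom)

lemma poly_cpoly_Ap: "poly (cpoly (Ap n)) x = cfA n (x\<^sup>2)"
  by (induction n rule: Ap.induct) (simp_all add: poly_monom cpoly_simps cpoly_monom)

lemma degree_monom_mult_le: "degree (monom c k * p) \<le> k + degree (p :: 'a :: comm_semiring_1 poly)"
  by (rule order_trans[OF degree_mult_le]) (simp add: degree_monom_le)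

lemma degree_Bp: "degree (Bp n) \<le> n"
proof (induction n rule: Bp.induct)
  case (3 n)
  have "degree (smult (kap n) (monom 1 2 * Bp n)) \<le> 2 + degree (Bp n)"
    by (rule order_trans[OF degree_smult_le degree_monom_mult_le])
  thus ?case using 3 by (simp del: monom_Suc add: degree_diff_le)
qed auto

text \<open>After multiplication by \<open>monom 1 2\<close> the bound becomes n for even positive
  n, but n + 1 for odd n; this is one reason for working with even indices.\<close>

lemma degree_Ap: "degree (Ap n) \<le> 2 * ((n - 1) div 2)"
proof (induction n rule: Ap.induct)
  case (3 n)
  have "degree (smult (kap n) (monom 1 2 * Ap n)) \<le> 2 * ((Suc (Suc n) - 1) div 2)"
  proof (cases "n = 0")
    case False
    have "degree (smult (kap n) (monom 1 2 * Ap n)) \<le> 2 + degree (Ap n)"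
      by (rule order_trans[OF degree_smult_le degree_monom_mult_le])
    also have "\<dots> \<le> 2 * ((Suc (Suc n) - 1) div 2)" using 3 False by (cases n) auto
    finally show ?thesis .
  qed auto
  moreover have "degree (Ap (Suc n)) \<le> 2 * ((Suc (Suc n) - 1) div 2)" using 3 by simp
  ultimately show ?case by (simp add: degree_diff_le)
qed auto

text \<open>
  The convergents reversed, that is in the variable \<open>y = 1 / k\<close> where \<open>u = k\<^sup>2\<close>: the recursion becomes that of
  orthogonal polynomials, with zeros in \<open>(-1, 1)\<close> interlaced by those of \<open>assoc\<close>.
\<close>

fun orth :: "nat \<Rightarrow> real poly" where
  "orth 0 = 1"
| "orth (Suc 0) = [:0, 1:]"
| "orth (Suc (Suc n)) = [:0, 1:] * orth (Suc n) - smult (kap n) (orth n)"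

fun assoc :: "nat \<Rightarrow> real poly" where
  "assoc 0 = 0"
| "assoc (Suc 0) = 1"
| "assoc (Suc (Suc n)) = [:0, 1:] * assoc (Suc n) - smult (kap n) (assoc n)"

lemma orth_cfB: "y \<noteq> 0 \<Longrightarrow> poly (orth n) y = y ^ n * cfB n (1 / y\<^sup>2)"
  by (induction n rule: orth.induct) (simp_all add: field_simps power2_eq_square)

lemma assoc_cfA: "y \<noteq> 0 \<Longrightarrow> y * poly (assoc n) y = y ^ n * cfA n (1 / y\<^sup>2)"
proof (induction n rule: assoc.induct)
  case (3 n)
  have "y * poly (assoc (Suc (Suc n))) y = y * (y * poly (assoc (Suc n)) y) - kap n * (y * poly (assoc n) y)"
    by (simp add: algebra_simps)
  thus ?case using 3 by (simp add: field_simps power2_eq_square)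
qed auto

lemma orth_wronskian:
  "poly (assoc (Suc n)) y * poly (orth n) y - poly (assoc n) y * poly (orth (Suc n)) y = (\<Prod>i<n. kap i)"
proof (induction n)
  case (Suc n)
  have "poly (assoc (Suc (Suc n))) y * poly (orth (Suc n)) y - poly (assoc (Suc n)) y * poly (orth (Suc (Suc n))) y
    = kap n * (poly (assoc (Suc n)) y * poly (orth n) y - poly (assoc n) y * poly (orth (Suc n)) y)"
    by (simp add: algebra_simps)
  thus ?case unfolding Suc by simp
qed simp

lemma orth_monic: "degree (orth n) \<le> n \<and> coeff (orth n) n = 1"
proof (induction n rule: orth.induct)
  case (3 n)
  have "degree ([:0, 1:] * orth (Suc n)) \<le> Suc (Suc n)"
    using 3 by (intro order_trans[OF degree_mult_le]) auto
  moreover have "degree (smult (kap n) (orth n)) \<le> Suc (Suc n)"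
    using 3 degree_smult_le[of "kap n" "orth n"] by linarith
  moreover have "coeff (orth n) (Suc (Suc n)) = 0" using 3 by (intro coeff_eq_0) auto
  ultimately show ?case using 3 by (simp del: mult_pCons_left add: degree_diff_le) (simp add: coeff_pCons)
qed auto

lemma orth_at_1: "poly (orth n) 1 > 0" "(-1) ^ n * poly (orth n) (-1) > 0"
  using orth_cfB[of 1 n] orth_cfB[of "-1" n] cfB_pos[of 1 n] by (auto simp flip: power_mult_distrib)

lemma monic_eq_prod_roots:
  fixes p :: "real poly"
  assumes "degree p \<le> n" "coeff p n = 1" "inj_on y {..<n}" "\<And>i. i < n \<Longrightarrow> poly p (y i) = 0"
  shows "poly p x = (\<Prod>i<n. x - y i)"
proof -
  define q where "q = (\<Prod>i<n. [:- y i, 1:])"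
  have d: "degree q = n" unfolding q_def by (subst degree_prod_sum_eq) auto
  have "lead_coeff q = 1" unfolding q_def by (subst lead_coeff_prod) auto
  hence "coeff q n = 1" using d by simp
  hence "p = q"
    using assms d by (intro poly_eqI_degree_lead_coeff[where n = n and A = "y ` {..<n}"])
      (auto simp: card_image q_def poly_prod)
  thus ?thesis by (simp add: q_def poly_prod)
qed

text \<open>The zeros of \<open>orth (n + 1)\<close> come together with the signs of
  \<open>orth n\<close> there, because \<open>orth (n + 2)\<close> reduces at these zeros to
  \<open>- kap n * orth n\<close>. The alternating signs, completed by those at -1 and 1, force a
  zero into each of the n + 2 gaps.\<close>

lemma orth_roots:
  "\<exists>y. (\<forall>i j. i < j \<longrightarrow> j \<le> n \<longrightarrow> y i < y j) \<and>
       (\<forall>i\<le>n. -1 < y i \<and> y i < 1 \<and> poly (orth (Suc n)) (y i) = 0 \<and> (-1) ^ (n - i) * poly (orth n) (y i) > 0)"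
proof (induction n)
  case 0
  show ?case by (rule exI[of _ "\<lambda>_. 0"]) auto
next
  case (Suc n)
  then obtain y where mono: "\<And>i j. i < j \<Longrightarrow> j \<le> n \<Longrightarrow> y i < y j"
    and y: "\<And>i. i \<le> n \<Longrightarrow> -1 < y i \<and> y i < 1 \<and> poly (orth (Suc n)) (y i) = 0 \<and> (-1) ^ (n - i) * poly (orth n) (y i) > 0"
    by blast
  define x where "x = (\<lambda>j. if j = 0 then -1 else if j \<le> Suc n then y (j - 1) else 1)"
  let ?q = "orth (Suc (Suc n))"
  have xmono: "x j < x (Suc j)" if "j \<le> Suc n" for j
    using that y mono by (auto simp: x_def)
  have xmono': "x i \<le> x j" if "i \<le> j" "j \<le> Suc (Suc n)" for i j
    using that by (induction j rule: dec_induct) (use xmono in \<open>auto intro: order_trans less_imp_le\<close>)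
  have xsgn: "(-1) ^ (Suc (Suc n) - j) * poly ?q (x j) > 0" if j: "j \<le> Suc (Suc n)" for j
  proof -
    consider "j = 0" | "j = Suc (Suc n)" | "0 < j" "j \<le> Suc n" using j by (metis le_SucE neq0_conv)
    thus ?thesis
    proof cases
      case 3
      then obtain i where i: "j = Suc i" "i \<le> n" by (cases j) auto
      have "poly ?q (y i) = - kap n * poly (orth n) (y i)" using y[OF i(2)] by simp
      moreover have "(-1::real) ^ (Suc (Suc n) - j) = - ((-1) ^ (n - i))"
        using i by (simp add: Suc_diff_le)
      ultimately have "(-1) ^ (Suc (Suc n) - j) * poly ?q (x j) = kap n * ((-1) ^ (n - i) * poly (orth n) (y i))"
        using i by (simp add: x_def del: orth.simps)
      thus ?thesis using y[OF i(2)] kap_pos[of n] by simp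
    qed (use orth_at_1[of "Suc (Suc n)"] in \<open>simp_all add: x_def del: orth.simps\<close>)
  qed
  have "\<exists>z. x j < z \<and> z < x (Suc j) \<and> poly ?q z = 0" if "j \<le> Suc n" for j
  proof -
    have "((-1) ^ (Suc (Suc n) - j) * poly ?q (x j)) * ((-1) ^ (Suc (Suc n) - Suc j) * poly ?q (x (Suc j))) > 0"
      using that by (intro mult_pos_pos xsgn) auto
    moreover have "(-1::real) ^ (Suc (Suc n) - j) = - ((-1) ^ (Suc (Suc n) - Suc j))"
      using that by (simp add: Suc_diff_le)
    moreover have "((-1::real) ^ k) * (-1) ^ k = 1" for k by (simp flip: power_mult_distrib)
    ultimately have "poly ?q (x j) * poly ?q (x (Suc j)) < 0"
      by (metis (no_types, opaque_lifting) mult.left_commute mult.right_neutral mult.commute mult_minus_left neg_0_less_iff_less)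
    thus ?thesis using poly_IVT[OF xmono[OF that]] by blast
  qed
  then obtain z where z: "\<And>j. j \<le> Suc n \<Longrightarrow> x j < z j \<and> z j < x (Suc j) \<and> poly ?q (z j) = 0"
    by metis
  have zm: "z i < z j" if "i < j" "j \<le> Suc n" for i j
    using z[of i] z[of j] xmono'[of "Suc i" j] that by auto
  have prod: "poly (orth (Suc n)) t = (\<Prod>i<Suc n. t - y i)" for t
    using orth_monic[of "Suc n"] y mono
    by (intro monic_eq_prod_roots) (auto simp: inj_on_def less_Suc_eq_le, metis linorder_neqE_nat order_less_irrefl)
  \<comment> \<open>In the factorization exactly the \<open>Suc n - j\<close> zeros to the right of
    \<open>z j\<close> contribute negative factors.\<close>
  have sgn: "(-1) ^ (Suc n - j) * poly (orth (Suc n)) (z j) > 0" if "j \<le> Suc n" for j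
  proof -
    have "poly (orth (Suc n)) (z j) = (\<Prod>i<j. z j - y i) * (\<Prod>i=j..<Suc n. z j - y i)"
      unfolding prod using prod.atLeastLessThan_concat[of 0 j "Suc n" "\<lambda>i. z j - y i"] that
      by (simp only: lessThan_atLeast0)
    also have "(\<Prod>i=j..<Suc n. z j - y i) = (\<Prod>i=j..<Suc n. (-1) * (y i - z j))"
      by (rule prod.cong) auto
    also have "\<dots> = (-1) ^ (Suc n - j) * (\<Prod>i=j..<Suc n. y i - z j)"
      by (subst prod.distrib) (simp only: prod_constant card_atLeastLessThan)
    finally have "(-1) ^ (Suc n - j) * poly (orth (Suc n)) (z j) =
        ((-1) ^ (Suc n - j) * (-1) ^ (Suc n - j)) * ((\<Prod>i<j. z j - y i) * (\<Prod>i=j..<Suc n. y i - z j))"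
      by (simp only: mult_ac)
    also have "(-1::real) ^ (Suc n - j) * (-1) ^ (Suc n - j) = 1"
      by (simp flip: power_mult_distrib)
    finally have "(-1) ^ (Suc n - j) * poly (orth (Suc n)) (z j) = (\<Prod>i<j. z j - y i) * (\<Prod>i=j..<Suc n. y i - z j)"
      by (simp only: mult_1)
    moreover have "(\<Prod>i<j. z j - y i) > 0"
    proof (rule prod_pos, clarsimp)
      fix i assume "i < j"
      hence "y i = x (Suc i)" using that by (simp add: x_def)
      also have "\<dots> \<le> x j" using \<open>i < j\<close> that by (intro xmono') auto
      finally show "y i < z j" using z[OF that] by simp
    qed
    moreover have "(\<Prod>i=j..<Suc n. y i - z j) > 0"
    proof (rule prod_pos, clarsimp)
      fix i assume i: "j \<le> i" "i < Suc n"
      hence "y i = x (Suc i)" by (simp add: x_def)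
      moreover have "\<dots> \<ge> x (Suc j)" using i by (intro xmono') auto
      ultimately show "z j < y i" using z[OF that] by simp
    qed
    ultimately show ?thesis by simp
  qed
  have "-1 < z j \<and> z j < 1" if "j \<le> Suc n" for j
    using z[OF that] xmono'[of 0 j] xmono'[of "Suc j" "Suc (Suc n)"] that by (auto simp: x_def split: if_splits)
  thus ?case using zm z sgn by blast
qed

section \<open>Zeros of the approximating polynomials\<close>

lemma ivt_sign:
  fixes f :: "real \<Rightarrow> real"
  assumes "continuous_on {a..b} f" "a < b" "f a * f b < 0"
  shows "\<exists>x. a < x \<and> x < b \<and> f x = 0"
proof -
  have "\<exists>x. a \<le> x \<and> x \<le> b \<and> f x = 0"
  proof (cases "f a < 0")
    case True
    thus ?thesis using IVT'[of f a 0 b] assms by (auto simp: mult_less_0_iff)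
  next
    case False
    thus ?thesis using IVT2'[of f b 0 a] assms by (auto simp: mult_less_0_iff)
  qed
  then obtain x where "a \<le> x" "x \<le> b" "f x = 0" by blast
  thus ?thesis using assms(3) by (intro exI[of _ x]) (auto simp: order_less_le)
qed

text \<open>For odd n the polynomial vanishes at 0, which corresponds to k at infinity; even indices
  keep all zeros within reach of the substitution y = 1 / k.\<close>

lemma orth_0_even: "even n \<Longrightarrow> poly (orth n) 0 \<noteq> 0"
  by (induction n rule: orth.induct) (use kap_pos in \<open>auto simp: order_less_le\<close>)

text \<open>The numerator of \<open>U - k^2 / 2 * Q * A / B\<close> for the n-th convergent A / B at
  \<open>k^2\<close>. The function approximated is
  \<open>U - k^2 / 2 * Q * hF 1 / hF 0\<close>.\<close>

definition Tp :: "real poly \<Rightarrow> real poly \<Rightarrow> nat \<Rightarrow> real poly" where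
  "Tp U Q n = U * Bp n - smult (1/2) (monom 1 2 * Q * Ap n)"

lemma poly_Tp_inverse:
  assumes "y \<noteq> 0"
  shows "y ^ n * poly (Tp U Q n) (1 / y) = poly U (1 / y) * poly (orth n) y - poly Q (1 / y) / y * poly (assoc n) y / 2"
proof -
  have "y ^ n * poly (Tp U Q n) (1 / y) = poly U (1 / y) * (y ^ n * cfB n (1 / y\<^sup>2))
     - poly Q (1 / y) / y\<^sup>2 * (y ^ n * cfA n (1 / y\<^sup>2)) / 2"
    by (simp add: Tp_def poly_Bp poly_Ap poly_monom power_one_over algebra_simps)
  also have "\<dots> = poly U (1 / y) * poly (orth n) y - poly Q (1 / y) / y\<^sup>2 * (y * poly (assoc n) y) / 2"
    by (simp only: orth_cfB[OF assms] assoc_cfA[OF assms])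
  finally show ?thesis using assms by (simp add: power2_eq_square)
qed

lemma degree_Tp:
  assumes "degree U \<le> d" "degree Q \<le> d" "even n" "n > 0"
  shows "degree (Tp U Q n) \<le> d + n"
proof -
  have "degree (U * Bp n) \<le> d + n"
    using degree_mult_le[of U "Bp n"] degree_Bp[of n] assms by linarith
  moreover have "degree (monom 1 2 * Q * Ap n) \<le> d + n"
  proof -
    have "degree (monom 1 2 * Q * Ap n) \<le> (2 + degree Q) + degree (Ap n)"
      by (intro order_trans[OF degree_mult_le] add_mono degree_monom_mult_le) auto
    also have "\<dots> \<le> (2 + d) + 2 * ((n - 1) div 2)"
      using assms degree_Ap[of n] by (intro add_mono) auto
    also have "\<dots> = d + n" using assms(3,4) by (auto elim!: evenE)
    finally show ?thesis .
  qed
  hence "degree (smult (1/2) (monom 1 2 * Q * Ap n)) \<le> d + n"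
    using degree_smult_le order_trans by blast
  ultimately show ?thesis unfolding Tp_def by (rule degree_diff_le)
qed

text \<open>
  At the zeros of \<open>orth n\<close> only the \<open>assoc\<close> term of \<open>Tp\<close> survives, and \<open>assoc\<close> alternates there. Hence every gap
  between consecutive zeros in which \<open>poly Q (1 / y) / y\<close> keeps its sign contributes a zero outside the unit disc.
\<close>

lemma Tp_outer_zeros:
  assumes "degree Q \<le> d" "Q \<noteq> 0" "even n" "n > d + 1"
  shows "Tp U Q n \<noteq> 0"
    and "\<exists>W. finite W \<and> card W + d + 2 \<ge> n \<and> (\<forall>k\<in>W. \<bar>k\<bar> > 1 \<and> poly (Tp U Q n) k = 0)"
proof -
  obtain m where n: "n = Suc m" using assms(4) by (cases n) auto
  obtain y where mono: "\<And>i j. i < j \<Longrightarrow> j \<le> m \<Longrightarrow> y i < y j"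
    and y: "\<And>i. i \<le> m \<Longrightarrow> -1 < y i \<and> y i < 1 \<and> poly (orth n) (y i) = 0 \<and> (-1) ^ (m - i) * poly (orth m) (y i) > 0"
    using orth_roots[of m] unfolding n by blast
  have ynz: "y i \<noteq> 0" if "i \<le> m" for i
    using y[OF that] orth_0_even[OF assms(3)] by auto
  have sgn: "(-1) ^ (m - i) * poly (assoc n) (y i) > 0" if i: "i \<le> m" for i
  proof -
    have "poly (assoc n) (y i) * poly (orth m) (y i) > 0"
      using orth_wronskian[of m "y i"] y[OF i] kap_pos unfolding n by (simp add: prod_pos)
    hence "((-1) ^ (m - i) * poly (assoc n) (y i)) * ((-1) ^ (m - i) * poly (orth m) (y i)) > 0"
      by (simp add: mult_ac power_mult_distrib[symmetric] flip: mult.assoc power_add)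
    thus ?thesis using y[OF i] by (simp add: zero_less_mult_iff)
  qed
  define \<phi> where "\<phi> = (\<lambda>t. t ^ n * poly (Tp U Q n) (1 / t))"
  have phi_y: "\<phi> (y i) = - (poly Q (1 / y i) / y i * poly (assoc n) (y i) / 2)" if "i \<le> m" for i
    unfolding \<phi>_def poly_Tp_inverse[OF ynz[OF that]] using y[OF that] by simp
  \<comment> \<open>The points where \<open>poly Q (1 / y) / y\<close> may vanish or blow up: at
    most d of them come from Q, and 0 is added.\<close>
  define Z where "Z = insert 0 (inverse ` {x. poly Q x = 0})"
  have fin: "finite Z" using poly_roots_finite[OF assms(2)] by (simp add: Z_def)
  have cardZ: "card Z \<le> d + 1"
  proof -
    have "card Z \<le> Suc (card (inverse ` {x. poly Q x = 0}))" unfolding Z_def by (rule card_insert_le_m1) auto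
    also have "card (inverse ` {x. poly Q x = 0}) \<le> card {x. poly Q x = 0}"
      by (intro card_image_le poly_roots_finite assms)
    also have "\<dots> \<le> degree Q" by (rule card_poly_roots_bound[OF assms(2)])
    finally show ?thesis using assms by simp
  qed
  have Z: "t \<in> Z \<longleftrightarrow> t = 0 \<or> poly Q (1 / t) = 0" for t
    by (auto simp: Z_def image_iff inverse_eq_divide)
  have inj: "inj_on y {..m}"
    by (rule linorder_inj_onI') (use mono in \<open>auto simp: order_less_le\<close>)
  have "card (y ` {..m}) = n" using card_image[OF inj] n by simp
  hence "\<not> y ` {..m} \<subseteq> Z" using cardZ card_mono[OF fin, of "y ` {..m}"] assms(4) by auto
  then obtain i0 where i0: "i0 \<le> m" "y i0 \<notin> Z" by auto
  have "\<phi> (y i0) \<noteq> 0" using phi_y[OF i0(1)] i0 sgn[OF i0(1)] by (auto simp: Z)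
  thus nz: "Tp U Q n \<noteq> 0" unfolding \<phi>_def by auto
  \<comment> \<open>Half-open intervals, so that a point of \<open>Z\<close> spoils at most one
    gap.\<close>
  define Bd where "Bd = {i. i < m \<and> {y i..<y (Suc i)} \<inter> Z \<noteq> {}}"
  have "card Bd \<le> card Z"
  proof -
    have "\<forall>i\<in>Bd. \<exists>z. z \<in> Z \<and> y i \<le> z \<and> z < y (Suc i)" by (auto simp: Bd_def)
    then obtain b where b: "\<And>i. i \<in> Bd \<Longrightarrow> b i \<in> Z \<and> y i \<le> b i \<and> b i < y (Suc i)" by metis
    have "b i < b j" if "i < j" "i \<in> Bd" "j \<in> Bd" for i j
    proof -
      have "y (Suc i) \<le> y j" using that mono[of "Suc i" j] by (cases "Suc i = j") (auto simp: Bd_def)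
      thus ?thesis using b[OF that(2)] b[OF that(3)] by linarith
    qed
    hence "inj_on b Bd" by (intro linorder_inj_onI') (auto simp: order_less_le)
    thus ?thesis using card_inj_on_le[OF _ _ fin, of b Bd] b by auto
  qed
  define Gd where "Gd = {..<m} - Bd"
  have "card Gd \<ge> m - card Bd" unfolding Gd_def
    using diff_card_le_card_Diff[of Bd "{..<m}"] by (simp add: Bd_def)
  hence cG: "card Gd + d + 2 \<ge> n" using \<open>card Bd \<le> card Z\<close> cardZ n by linarith
  have "\<exists>t. y i < t \<and> t \<le> y (Suc i) \<and> t \<noteq> 0 \<and> poly (Tp U Q n) (1 / t) = 0" if "i \<in> Gd" for i
  proof -
    have i: "i < m" and free: "\<And>t. y i \<le> t \<Longrightarrow> t < y (Suc i) \<Longrightarrow> t \<notin> Z"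
      using that by (auto simp: Gd_def Bd_def)
    have lt: "y i < y (Suc i)" using mono i by simp
    show ?thesis
    \<comment> \<open>A right end point in \<open>Z\<close> is itself a zero, since both
      \<open>orth n\<close> and the factor from Q vanish there. Left end points are never chosen, so
      different gaps still give different zeros.\<close>
    proof (cases "y (Suc i) \<in> Z")
      case True
      hence "poly Q (1 / y (Suc i)) = 0" using ynz[of "Suc i"] i by (auto simp: Z)
      hence "\<phi> (y (Suc i)) = 0" using phi_y[of "Suc i"] i by simp
      thus ?thesis using ynz[of "Suc i"] i lt by (intro exI[of _ "y (Suc i)"]) (auto simp: \<phi>_def)
    next
      case False
      hence free': "t \<notin> Z" if "y i \<le> t" "t \<le> y (Suc i)" for t
        using free[of t] that by (cases "t = y (Suc i)") auto
      define \<psi> where "\<psi> = (\<lambda>t. poly Q (1 / t) / t)"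
      have nzt: "\<forall>t\<in>{y i..y (Suc i)}. t \<noteq> 0" using free' unfolding Z by auto
      have cont: "continuous_on {y i..y (Suc i)} \<psi>" "continuous_on {y i..y (Suc i)} \<phi>"
        unfolding \<psi>_def \<phi>_def using nzt by (auto intro!: continuous_intros)
      have "\<not> \<psi> (y i) * \<psi> (y (Suc i)) < 0"
      proof
        assume "\<psi> (y i) * \<psi> (y (Suc i)) < 0"
        then obtain t where "y i < t" "t < y (Suc i)" "\<psi> t = 0" using ivt_sign[OF cont(1) lt] by blast
        thus False using free'[of t] by (auto simp: Z \<psi>_def)
      qed
      moreover have "\<psi> (y i) \<noteq> 0" "\<psi> (y (Suc i)) \<noteq> 0"
        using free'[of "y i"] free'[of "y (Suc i)"] lt by (auto simp: \<psi>_def Z)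
      ultimately have pp: "\<psi> (y i) * \<psi> (y (Suc i)) > 0" by (metis linorder_neqE_linordered_idom mult_eq_0_iff)
      have "((-1) ^ (m - i) * poly (assoc n) (y i)) * ((-1) ^ (m - Suc i) * poly (assoc n) (y (Suc i))) > 0"
        using i by (intro mult_pos_pos sgn) auto
      moreover have "(-1::real) ^ (m - i) = - ((-1) ^ (m - Suc i))" by (simp only: Suc_diff_Suc[OF i, symmetric] power_Suc)
      moreover have "(- s * a) * (s * b) = - ((s * s) * (a * b))" for s a b :: real by simp
      moreover have "((-1::real) ^ k) * (-1) ^ k = 1" for k by (simp flip: power_mult_distrib)
      ultimately have aa: "poly (assoc n) (y i) * poly (assoc n) (y (Suc i)) < 0"
        by (metis mult_1 neg_0_less_iff_less)
      have "\<phi> (y i) * \<phi> (y (Suc i)) = (\<psi> (y i) * \<psi> (y (Suc i))) * (poly (assoc n) (y i) * poly (assoc n) (y (Suc i))) / 4"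
        using phi_y[of i] phi_y[of "Suc i"] i by (simp add: \<psi>_def mult_ac)
      also have "\<dots> < 0" using mult_pos_neg[OF pp aa] by simp
      finally obtain t where t: "y i < t" "t < y (Suc i)" "\<phi> t = 0" using ivt_sign[OF cont(2) lt] by blast
      moreover have "t \<noteq> 0" using free'[of t] t by (auto simp: Z)
      ultimately show ?thesis by (intro exI[of _ t]) (auto simp: \<phi>_def)
    qed
  qed
  then obtain t where t: "\<And>i. i \<in> Gd \<Longrightarrow> y i < t i \<and> t i \<le> y (Suc i) \<and> t i \<noteq> 0 \<and> poly (Tp U Q n) (1 / t i) = 0"
    by metis
  have "t i < t j" if "i < j" "i \<in> Gd" "j \<in> Gd" for i j
  proof -
    have "y (Suc i) \<le> y j" using that mono[of "Suc i" j] by (cases "Suc i = j") (auto simp: Gd_def)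
    thus ?thesis using t[OF that(2)] t[OF that(3)] by linarith
  qed
  hence "inj_on t Gd" by (intro linorder_inj_onI') (auto simp: order_less_le)
  hence inj': "inj_on (\<lambda>i. 1 / t i) Gd" using t by (auto simp: inj_on_def)
  have "finite Gd" by (simp add: Gd_def)
  show "\<exists>W. finite W \<and> card W + d + 2 \<ge> n \<and> (\<forall>k\<in>W. \<bar>k\<bar> > 1 \<and> poly (Tp U Q n) k = 0)"
  proof (intro exI[of _ "(\<lambda>i. 1 / t i) ` Gd"] conjI ballI)
    show "finite ((\<lambda>i. 1 / t i) ` Gd)" using \<open>finite Gd\<close> by simp
    show "n \<le> card ((\<lambda>i. 1 / t i) ` Gd) + d + 2" using cG card_image[OF inj'] by simp
  next
    fix k assume "k \<in> (\<lambda>i. 1 / t i) ` Gd"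
    then obtain i where i: "i \<in> Gd" "k = 1 / t i" by auto
    have "i < m" using i by (simp add: Gd_def)
    hence "-1 < t i" "t i < 1 \<or> t i = y (Suc i)" using t[OF i(1)] y[of i] y[of "Suc i"] by auto
    hence "\<bar>t i\<bar> < 1" using y[of "Suc i"] \<open>i < m\<close> t[OF i(1)] by auto
    thus "\<bar>k\<bar> > 1" using t[OF i(1)] i by (simp add: abs_divide)
    show "poly (Tp U Q n) k = 0" using t[OF i(1)] i by simp
  qed
qed

lemma Tp_disc_zeros:
  assumes "degree U \<le> d" "degree Q \<le> d" "Q \<noteq> 0" "even n" "n > d + 1"
  shows "(\<Sum>z | norm z < 1 \<and> poly (cpoly (Tp U Q n)) z = 0. order z (cpoly (Tp U Q n))) \<le> 2 * d + 2"
proof -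
  define T where "T = cpoly (Tp U Q n)"
  have nz: "T \<noteq> 0" using Tp_outer_zeros(1)[OF assms(2-5)] by (simp add: T_def)
  obtain W where W: "finite W" "card W + d + 2 \<ge> n" "\<And>k. k \<in> W \<Longrightarrow> \<bar>k\<bar> > 1 \<and> poly (Tp U Q n) k = 0"
    using Tp_outer_zeros(2)[OF assms(2-5), of U] by blast
  define W' where "W' = complex_of_real ` W"
  have W': "finite W'" "card W' = card W" "\<And>k. k \<in> W' \<Longrightarrow> norm k > 1 \<and> poly T k = 0"
    using W by (auto simp: W'_def T_def poly_cpoly_of_real card_image inj_on_def)
  let ?D = "{z. norm z < 1 \<and> poly T z = 0}"
  have fin: "finite {z. poly T z = 0}" by (rule poly_roots_finite[OF nz])
  have disj: "?D \<inter> W' = {}" using W'(3) by force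
  have "(\<Sum>z\<in>?D. order z T) + card W' \<le> (\<Sum>z\<in>?D. order z T) + (\<Sum>z\<in>W'. order z T)"
    unfolding card_eq_sum using W' nz order_root[of T] by (intro add_left_mono sum_mono) (auto simp: Suc_le_eq)
  also have "\<dots> = (\<Sum>z\<in>?D \<union> W'. order z T)"
    using W'(1) finite_subset[OF _ fin, of ?D] disj by (intro sum.union_disjoint[symmetric]) auto
  also have "\<dots> \<le> (\<Sum>z | poly T z = 0. order z T)"
    using W' by (intro sum_mono2 fin) auto
  also have "\<dots> \<le> degree T" by (rule sum_order_le_degree[OF nz])
  also have "\<dots> \<le> d + n" unfolding T_def using degree_Tp[of U d Q n] assms by simp
  finally show ?thesis using W(2) W'(2) unfolding T_def by linarith
qed

section \<open>Zero counting by the argument principle\<close>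

definition ord_ge :: "(complex \<Rightarrow> complex) \<Rightarrow> complex \<Rightarrow> nat \<Rightarrow> bool" where
  "ord_ge f z n \<longleftrightarrow> (\<exists>h r. 0 < r \<and> h holomorphic_on ball z r \<and> (\<forall>w\<in>ball z r. f w = (w - z) ^ n * h w))"

text \<open>
  Quantifying over arbitrary lower bounds \<open>v\<close> of the orders avoids computing exact orders in the Rolle
  argument.
\<close>

definition real_zeros_le :: "(complex \<Rightarrow> complex) \<Rightarrow> nat \<Rightarrow> bool" where
  "real_zeros_le f M \<longleftrightarrow> (\<forall>Y v. finite Y \<and> Y \<subseteq> {-1<..<1} \<and> (\<forall>y\<in>Y. ord_ge f (complex_of_real y) (v y))
     \<longrightarrow> sum v Y \<le> M)"

lemma ord_geI:
  assumes "0 < r" "h holomorphic_on ball z r" "\<And>w. w \<in> ball z r \<Longrightarrow> f w = (w - z) ^ n * h w"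
  shows "ord_ge f z n"
  using assms unfolding ord_ge_def by blast

lemma ord_ge_zero: "0 < n \<Longrightarrow> ord_ge f z n \<Longrightarrow> f z = 0"
  unfolding ord_ge_def by (metis centre_in_ball diff_self mult_zero_left power_0_left less_numeral_extra(3))

text \<open>The cofactor h may vanish at z again, so its own leading factor is split off; the
  identity theorem excludes that h vanishes identically.\<close>

lemma ord_ge_zorder:
  assumes "ord_ge f z n" "f holomorphic_on S" "open S" "connected S" "z \<in> S" "\<exists>w\<in>S. f w \<noteq> 0"
  shows "zorder f z \<ge> int n"
proof -
  obtain h r where r: "0 < r" "h holomorphic_on ball z r" and h: "\<And>w. w \<in> ball z r \<Longrightarrow> f w = (w - z) ^ n * h w"
    using assms(1) unfolding ord_ge_def by blast
  have "\<exists>w\<in>ball z r. h w \<noteq> 0"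
  proof (rule ccontr)
    assume "\<not> ?thesis"
    hence z: "\<And>w. w \<in> ball z r \<Longrightarrow> f w = 0" using h by simp
    have "f w = 0" if "w \<in> S" for w
    proof (rule analytic_continuation[OF assms(2-4) _ assms(5) _ _ that, of "ball z r \<inter> S"])
      show "z islimpt (ball z r \<inter> S)"
        using assms r by (intro interior_limit_point interiorI[of "ball z r \<inter> S"]) auto
    qed (use z in auto)
    thus False using assms(6) by blast
  qed
  have "z \<in> ball z r" using r(1) by simp
  from zorder_exist_zero[OF r(2) open_ball connected_ball this \<open>\<exists>w\<in>ball z r. h w \<noteq> 0\<close>]
  obtain g s where s: "s > 0" "cball z s \<subseteq> ball z r" "g holomorphic_on cball z s"
    and g: "\<And>w. w \<in> cball z s \<Longrightarrow> h w = g w * (w - z) ^ nat (zorder h z) \<and> g w \<noteq> 0"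
    using r(1) by (auto simp: Ball_def)
  have "zorder f z = int (n + nat (zorder h z))"
  proof (rule zorder_eqI)
    show "g holomorphic_on ball z s" using s(3) by (rule holomorphic_on_subset) auto
    fix w assume "w \<in> ball z s"
    hence w: "w \<in> cball z s" by auto
    hence "f w = (w - z) ^ n * (g w * (w - z) ^ nat (zorder h z))" using h g s(2) by auto
    thus "f w = g w * (w - z) powi int (n + nat (zorder h z))"
      unfolding power_int_of_nat power_add by (simp only: mult_ac)
  qed (use s g in auto)
  thus ?thesis by simp
qed

lemma ord_ge_if_derivs_vanish:
  assumes "f holomorphic_on S" "open S" "connected S" "z \<in> S" "\<And>k. k < n \<Longrightarrow> (deriv ^^ k) f z = 0"
  shows "ord_ge f z n"
proof (cases "\<exists>w\<in>S. f w \<noteq> 0")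
  case False
  obtain r where "r > 0" "ball z r \<subseteq> S" using assms(2,4) openE by blast
  thus ?thesis using False by (intro ord_geI[where h = "\<lambda>_. 0"]) auto
next
  case True
  then obtain w where w: "w \<in> S" "f w \<noteq> 0" by blast
  have an: "f analytic_on {z}" using assms analytic_at by blast
  have le: "int n \<le> zorder f z" by (rule zorder_geI[OF an assms(1-4) w assms(5)])
  from zorder_exist_zero[OF assms(1-4) True]
  obtain g s where s: "s > 0" "cball z s \<subseteq> S" "g holomorphic_on cball z s"
    and g: "\<And>w. w \<in> cball z s \<Longrightarrow> f w = g w * (w - z) ^ nat (zorder f z)"
    by (auto simp: Ball_def)
  show ?thesis
  proof (rule ord_geI[OF s(1)])
    show "(\<lambda>w. (w - z) ^ (nat (zorder f z) - n) * g w) holomorphic_on ball z s"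
      by (intro holomorphic_intros holomorphic_on_subset[OF s(3)]) auto
    fix w assume "w \<in> ball z s"
    hence "f w = g w * (w - z) ^ nat (zorder f z)" using g by auto
    also have "nat (zorder f z) = n + (nat (zorder f z) - n)" using le by auto
    finally show "f w = (w - z) ^ n * ((w - z) ^ (nat (zorder f z) - n) * g w)"
      by (simp only: power_add mult_ac)
  qed
qed

lemma ord_ge_mult:
  assumes "ord_ge f z n" "0 < s" "g holomorphic_on ball z s" "\<And>w. w \<in> ball z s \<Longrightarrow> F w = g w * f w"
  shows "ord_ge F z n"
proof -
  obtain h r where r: "0 < r" "h holomorphic_on ball z r" and h: "\<And>w. w \<in> ball z r \<Longrightarrow> f w = (w - z) ^ n * h w"
    using assms(1) unfolding ord_ge_def by blast
  show ?thesis
  proof (rule ord_geI[where r = "min r s"])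
    show "(\<lambda>w. g w * h w) holomorphic_on ball z (min r s)"
      by (intro holomorphic_intros holomorphic_on_subset[OF assms(3)] holomorphic_on_subset[OF r(2)]) auto
    fix w assume "w \<in> ball z (min r s)"
    hence "w \<in> ball z r" "w \<in> ball z s" by auto
    thus "F w = (w - z) ^ n * (g w * h w)" using h[of w] assms(4)[of w] by simp
  qed (use r assms in auto)
qed

lemma ball_in_disc:
  assumes "z \<in> ball (0::complex) 1"
  obtains s where "s > 0" "ball z s \<subseteq> ball 0 1"
  using openE[OF open_ball assms] by blast

lemma ord_ge_mult_disc:
  assumes "ord_ge f z n" "z \<in> ball 0 1" "g holomorphic_on ball 0 1" "\<And>w. w \<in> ball 0 1 \<Longrightarrow> F w = g w * f w"
  shows "ord_ge F z n"
proof -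
  obtain s where s: "s > 0" "ball z s \<subseteq> ball 0 1" using ball_in_disc[OF assms(2)] .
  show ?thesis
    by (rule ord_ge_mult[OF assms(1) s(1)]) (use s assms in \<open>auto intro: holomorphic_on_subset\<close>)
qed

text \<open>Hurwitz's argument in counting form: on a circle that encloses Y and misses the zeros of
  f, the perturbation \<open>g n\<close> is eventually smaller than f, and the zeros of
  \<open>f + g n\<close> inside are those of the polynomial \<open>T n\<close>.\<close>

lemma rouche_zero_count:
  assumes f: "f holomorphic_on ball 0 1" "\<exists>w\<in>ball 0 1. f w \<noteq> 0"
    and g: "\<And>n. g n holomorphic_on ball 0 1"
    and lim: "\<And>r. 0 < r \<Longrightarrow> r < 1 \<Longrightarrow> uniform_limit (sphere 0 r) g (\<lambda>_. 0) sequentially"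
    and fg: "\<And>n w. w \<in> ball 0 1 \<Longrightarrow> f w + g n w = H n w * poly (T n) w"
    and H: "\<And>n. H n holomorphic_on ball 0 1" "\<And>n w. w \<in> ball 0 1 \<Longrightarrow> H n w \<noteq> 0"
    and T: "\<And>n. T n \<noteq> 0" "\<And>n. (\<Sum>z | norm z < 1 \<and> poly (T n) z = 0. order z (T n)) \<le> M"
  shows "real_zeros_le f M"
  unfolding real_zeros_le_def
proof (intro allI impI, elim conjE)
  fix Y :: "real set" and v
  assume Y: "finite Y" "Y \<subseteq> {-1<..<1}" "\<forall>y\<in>Y. ord_ge f (complex_of_real y) (v y)"
  define a where "a = Max (insert 0 (abs ` Y))"
  have a: "0 \<le> a" "a < 1" "\<And>y. y \<in> Y \<Longrightarrow> \<bar>y\<bar> \<le> a"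
    unfolding a_def using Y by (auto intro!: Max_ge simp: abs_less_iff dest!: subsetD)
  define R where "R = (a + 1) / 2"
  have R: "a < R" "R < 1" using a by (auto simp: R_def)
  \<comment> \<open>For constant f the finiteness theorem for zeros does not apply, but then f has
    no zeros in the disc at all.\<close>
  have nc: "\<not> f constant_on ball 0 1 \<or> (\<forall>w\<in>ball 0 1. f w \<noteq> 0)"
    using f(2) unfolding constant_on_def by metis
  have fin0: "finite {z \<in> cball 0 r. f z = 0}" if "r < 1" for r
  proof (cases "f constant_on ball 0 1")
    case True
    hence "\<forall>w\<in>ball 0 1. f w \<noteq> 0" using nc by blast
    hence "{z \<in> cball 0 r. f z = 0} = {}" using that by auto
    thus ?thesis by (metis finite.emptyI)
  next
    case False
    thus ?thesis using that f(1) by (intro holomorphic_compact_finite_zeros[of f "ball 0 1"]) auto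
  qed
  \<comment> \<open>Only finitely many radii between a and R carry a zero of f, so a free one
    remains.\<close>
  have "infinite ({a<..<R} - norm ` {z \<in> cball 0 R. f z = 0})"
    using R fin0[of R] by (intro Diff_infinite_finite) auto
  from infinite_imp_nonempty[OF this]
  obtain \<rho> where "\<rho> \<in> {a<..<R} - norm ` {z \<in> cball 0 R. f z = 0}" by blast
  hence rho: "a < \<rho>" "\<rho> < R" "\<rho> \<notin> norm ` {z \<in> cball 0 R. f z = 0}" by simp_all
  have nz: "f z \<noteq> 0" if "z \<in> sphere 0 \<rho>" for z
    using that rho by (auto simp: image_iff)
  have rho0: "0 < \<rho>" "\<rho> < 1" using rho a R by auto
  have contf: "continuous_on (sphere 0 \<rho>) (\<lambda>z. norm (f z))"
    using rho0 by (intro continuous_intros holomorphic_on_imp_continuous_on holomorphic_on_subset[OF f(1)]) auto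
  have "sphere (0::complex) \<rho> \<noteq> {}" using rho0 by auto
  then obtain z0 where z0: "z0 \<in> sphere 0 \<rho>" "\<And>z. z \<in> sphere 0 \<rho> \<Longrightarrow> norm (f z0) \<le> norm (f z)"
    using continuous_attains_inf[OF compact_sphere _ contf] by blast
  have "\<forall>\<^sub>F n in sequentially. \<forall>z\<in>sphere 0 \<rho>. dist (g n z) 0 < norm (f z0)"
    using lim[OF rho0] nz[OF z0(1)] by (intro uniform_limitD) auto
  then obtain n where n: "\<And>z. z \<in> sphere 0 \<rho> \<Longrightarrow> norm (g n z) < norm (f z0)"
    unfolding eventually_sequentially dist_0_norm dist_commute[of _ 0] by blast
  define s where "s = ball (0::complex) R"
  have s1: "s \<subseteq> ball 0 1" using R by (auto simp: s_def)
  let ?fg = "\<lambda>p. f p + g n p"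
  have finfg: "finite {p \<in> s. ?fg p = 0}"
    using s1 H(2) fg by (intro finite_subset[OF _ poly_roots_finite[OF T(1)[of n]]]) auto
  have finf: "finite {p \<in> s. f p = 0}"
    by (rule finite_subset[OF _ fin0[OF R(2)]]) (auto simp: s_def)
  have w1: "winding_number (circlepath 0 \<rho>) z = 1" if "norm z < \<rho>" for z
    using that by (intro winding_number_circlepath) auto
  have w0: "winding_number (circlepath 0 \<rho>) z = 0" if "norm z > \<rho>" for z
    using that rho0 by (intro winding_number_zero_outside[of _ "cball 0 \<rho>"]) auto
  have eq: "(\<Sum>p\<in>{p \<in> s. ?fg p = 0}. winding_number (circlepath 0 \<rho>) p * of_int (zorder ?fg p)) =
            (\<Sum>p\<in>{p \<in> s. f p = 0}. winding_number (circlepath 0 \<rho>) p * of_int (zorder f p))"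
  proof (rule Rouche_theorem[OF _ _ finfg finf])
    show "f holomorphic_on s" "g n holomorphic_on s"
      using f g s1 holomorphic_on_subset by blast+
    show "path_image (circlepath 0 \<rho>) \<subseteq> s" using rho rho0 by (auto simp: s_def)
    show "\<forall>z\<in>path_image (circlepath 0 \<rho>). cmod (g n z) < cmod (f z)"
    proof
      fix z assume "z \<in> path_image (circlepath 0 \<rho>)"
      hence "z \<in> sphere 0 \<rho>" using rho0 by simp
      thus "cmod (g n z) < cmod (f z)" using n z0(2) by (metis less_le_trans)
    qed
    show "\<forall>z. z \<notin> s \<longrightarrow> winding_number (circlepath 0 \<rho>) z = 0"
      using rho w0 by (auto simp: s_def)
  qed (auto simp: s_def)
  have red: "(\<Sum>p\<in>{p \<in> s. F p = 0}. winding_number (circlepath 0 \<rho>) p * of_int (zorder F p)) =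
      of_int (\<Sum>p | norm p < \<rho> \<and> F p = 0. zorder F p)"
    if "finite {p \<in> s. F p = 0}" "\<And>p. p \<in> sphere 0 \<rho> \<Longrightarrow> F p \<noteq> 0" for F
  proof -
    have "(\<Sum>p\<in>{p \<in> s. F p = 0}. winding_number (circlepath 0 \<rho>) p * of_int (zorder F p)) =
      (\<Sum>p | norm p < \<rho> \<and> F p = 0. winding_number (circlepath 0 \<rho>) p * of_int (zorder F p))"
    proof (intro sum.mono_neutral_right that ballI)
      show "{p. norm p < \<rho> \<and> F p = 0} \<subseteq> {p \<in> s. F p = 0}" using rho by (auto simp: s_def)
      fix p assume p: "p \<in> {p \<in> s. F p = 0} - {p. cmod p < \<rho> \<and> F p = 0}"
      hence "norm p \<noteq> \<rho>" using that(2)[of p] by auto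
      hence "norm p > \<rho>" using p by auto
      thus "winding_number (circlepath 0 \<rho>) p * of_int (zorder F p) = 0" using w0 by simp
    qed
    also have "\<dots> = of_int (\<Sum>p | norm p < \<rho> \<and> F p = 0. zorder F p)"
      unfolding of_int_sum by (rule sum.cong) (auto simp: w1)
    finally show ?thesis .
  qed
  have nzfg: "?fg p \<noteq> 0" if "p \<in> sphere 0 \<rho>" for p
  proof
    assume "?fg p = 0"
    hence "norm (f p) = norm (g n p)" by (metis add_eq_0_iff norm_minus_cancel)
    thus False using n[OF that] z0(2)[OF that] by linarith
  qed
  have eq2: "(\<Sum>p | norm p < \<rho> \<and> ?fg p = 0. zorder ?fg p) = (\<Sum>p | norm p < \<rho> \<and> f p = 0. zorder f p)"
    using trans[OF trans[OF red[OF finfg nzfg, symmetric] eq] red[OF finf nz]]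
    by (simp only: of_int_eq_iff)
  have zfg: "zorder ?fg p = int (order p (T n))" if p: "norm p < \<rho>" for p
  proof -
    from order_decomp[OF T(1)] obtain q where q: "T n = [:- p, 1:] ^ order p (T n) * q" "\<not> [:- p, 1:] dvd q"
      by blast
    have p1: "p \<in> ball 0 1" using p rho0 by auto
    show ?thesis
    proof (rule zorder_eqI[of "ball 0 1"])
      show "(\<lambda>w. H n w * poly q w) holomorphic_on ball 0 1"
        by (intro holomorphic_intros H)
      show "H n p * poly q p \<noteq> 0" using H(2)[OF p1] q(2) by (simp add: poly_eq_0_iff_dvd)
      fix w :: complex assume "w \<in> ball 0 1"
      hence "?fg w = H n w * poly ([:- p, 1:] ^ order p (T n) * q) w" using fg q(1) by simp
      thus "?fg w = H n w * poly q w * (w - p) powi int (order p (T n))"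
        by (simp add: poly_power mult_ac)
    qed (use p1 in auto)
  qed
  have "(\<Sum>p | norm p < \<rho> \<and> ?fg p = 0. zorder ?fg p) = (\<Sum>p | norm p < \<rho> \<and> poly (T n) p = 0. int (order p (T n)))"
  proof (rule sum.cong)
    show "{p. cmod p < \<rho> \<and> f p + g n p = 0} = {p. cmod p < \<rho> \<and> poly (T n) p = 0}"
      using fg H(2) rho0 by auto
  qed (use zfg in auto)
  also have "\<dots> \<le> (\<Sum>z | norm z < 1 \<and> poly (T n) z = 0. int (order z (T n)))"
    using rho0 by (intro sum_mono2 finite_subset[OF _ poly_roots_finite[OF T(1)[of n]]]) auto
  also have "\<dots> \<le> int M" using T(2)[of n] by (simp flip: of_nat_sum)
  finally have A: "(\<Sum>p | norm p < \<rho> \<and> f p = 0. zorder f p) \<le> int M" using eq2 by simp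
  have finr: "finite {p. norm p < \<rho> \<and> f p = 0}"
    by (rule finite_subset[OF _ finf]) (use rho in \<open>auto simp: s_def\<close>)
  have Yin: "complex_of_real y \<in> ball 0 1" if "y \<in> Y" for y
    using a(2) a(3)[OF that] by simp
  \<comment> \<open>Points of weight 0 need not be zeros of f, and they contribute nothing.\<close>
  define Y' where "Y' = {y \<in> Y. v y > 0}"
  have "sum v Y = sum v Y'" unfolding Y'_def using Y by (intro sum.mono_neutral_right) auto
  hence "int (sum v Y) = (\<Sum>y\<in>Y'. int (v y))" by simp
  also have "\<dots> \<le> (\<Sum>y\<in>Y'. zorder f (of_real y))"
    using Y f Yin by (intro sum_mono ord_ge_zorder[of _ _ _ "ball 0 1"]) (auto simp: Y'_def)
  also have "\<dots> = (\<Sum>p\<in>complex_of_real ` Y'. zorder f p)"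
    by (subst sum.reindex) (auto simp: inj_on_def)
  also have "\<dots> \<le> (\<Sum>p | norm p < \<rho> \<and> f p = 0. zorder f p)"
  proof (rule sum_mono2[OF finr])
    show "complex_of_real ` Y' \<subseteq> {p. norm p < \<rho> \<and> f p = 0}"
      using a(3) rho Y(3) ord_ge_zero by (force simp: Y'_def)
    fix p assume "p \<in> {p. cmod p < \<rho> \<and> f p = 0} - complex_of_real ` Y'"
    hence "p \<in> ball 0 1" using rho0 by auto
    thus "0 \<le> zorder f p"
      using zorder_exist_zero[OF f(1) open_ball connected_ball _ f(2), of p] by (auto split: if_splits)
  qed
  finally show "sum v Y \<le> M" using A by linarith
qed

section \<open>Combinations of the two series: approximation and zero count\<close>

lemma hF_holomorphic: "hF n holomorphic_on ball 0 1"
proof (rule holomorphic_onI)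
  fix z :: complex assume "z \<in> ball 0 1"
  hence "norm z < 1" by simp
  from hF_has_derivative_series[OF this, of n] show "hF n field_differentiable at z within ball 0 1"
    by (metis field_differentiable_at_within field_differentiable_def)
qed

lemma norm_power2_less_1: "norm (z :: 'a :: real_normed_div_algebra) < 1 \<Longrightarrow> norm (z\<^sup>2) < 1"
  by (simp add: norm_power power_less_one_iff)

lemma hF_sq_holomorphic: "(\<lambda>z. hF n (z\<^sup>2)) holomorphic_on ball 0 1"
  by (rule holomorphic_on_compose_gen[OF _ hF_holomorphic, unfolded o_def])
     (auto intro!: holomorphic_intros simp: norm_power2_less_1 simp del: norm_power)

lemma cf_sq_holomorphic: "(\<lambda>z. cfA n (z\<^sup>2)) holomorphic_on ball (0::complex) 1"
  "(\<lambda>z. cfB n (z\<^sup>2)) holomorphic_on ball (0::complex) 1"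
  unfolding poly_cpoly_Bp[symmetric] poly_cpoly_Ap[symmetric] by (intro holomorphic_intros)+

text \<open>
  \<open>p K + q E\<close> equals \<open>pi / 2\<close> times \<open>Gc (p + q) q\<close>; \<open>errc\<close> is the error made by replacing \<open>hF 1 / hF 0\<close> by its
  \<open>n\<close>-th convergent.
\<close>

definition Gc :: "real poly \<Rightarrow> real poly \<Rightarrow> complex \<Rightarrow> complex" where
  "Gc U Q z = poly (cpoly U) z * hF 0 (z\<^sup>2) - z\<^sup>2 / 2 * poly (cpoly Q) z * hF 1 (z\<^sup>2)"

lemma Gc_holomorphic: "Gc U Q holomorphic_on ball 0 1"
  unfolding Gc_def[abs_def] by (intro holomorphic_intros hF_sq_holomorphic) auto

definition errc :: "real poly \<Rightarrow> nat \<Rightarrow> complex \<Rightarrow> complex" where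
  "errc Q n z = z\<^sup>2 / 2 * poly (cpoly Q) z *
     ((cfB n (z\<^sup>2) * hF 1 (z\<^sup>2) - cfA n (z\<^sup>2) * hF 0 (z\<^sup>2)) / cfB n (z\<^sup>2))"

lemma Gc_plus_errc:
  assumes "norm z < 1"
  shows "Gc U Q z + errc Q n z = hF 0 (z\<^sup>2) / cfB n (z\<^sup>2) * poly (cpoly (Tp U Q n)) z"
proof -
  have nz: "cfB n (z\<^sup>2) \<noteq> 0"
    using norm_power2_less_1[OF assms] by (intro cfB_nonzero) auto
  have T: "poly (cpoly (Tp U Q n)) z = poly (cpoly U) z * cfB n (z\<^sup>2) - z\<^sup>2 * poly (cpoly Q) z * cfA n (z\<^sup>2) / 2"
    by (simp add: Tp_def cpoly_simps cpoly_monom poly_monom poly_cpoly_Ap poly_cpoly_Bp)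
  show ?thesis
    unfolding Gc_def errc_def T using nz by (simp add: field_simps)
qed

lemma errc_holomorphic: "errc Q n holomorphic_on ball 0 1"
  unfolding errc_def[abs_def]
  by (intro holomorphic_intros hF_sq_holomorphic cf_sq_holomorphic)
     (auto intro!: cfB_nonzero less_imp_le[OF norm_power2_less_1] simp del: norm_power)

lemma errc_uniform_limit:
  assumes "0 < r" "r < 1" and k: "filterlim k at_top sequentially"
  shows "uniform_limit (sphere 0 r) (\<lambda>n. errc Q (k n)) (\<lambda>_. 0) sequentially"
proof -
  have "bounded (poly (cpoly Q) ` sphere 0 r)"
    by (intro compact_imp_bounded compact_continuous_image continuous_intros compact_sphere)
  then obtain C where C: "\<And>z. z \<in> sphere 0 r \<Longrightarrow> norm (poly (cpoly Q) z) \<le> C"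
    unfolding bounded_iff by blast
  have "complex_of_real r \<in> sphere 0 r" using assms(1) by simp
  hence C0: "C \<ge> 0" using C norm_ge_zero order_trans by blast
  have bd: "norm (errc Q n z) \<le> C * (r ^ n * hF 1 r)" if z: "z \<in> sphere 0 r" for n z
  proof -
    have nz: "norm z = r" using z by simp
    \<comment> \<open>The remainder bound is used with x = r: the modulus of \<open>z^2\<close> is
      \<open>r^2\<close>, so the geometric ratio is \<open>r^2 / r = r\<close>.\<close>
    have u: "norm (z\<^sup>2) \<le> r" using assms nz by (simp add: norm_mult power2_eq_square mult_left_le)
    have "norm (z\<^sup>2) / r = r" using assms nz by (simp add: norm_mult power2_eq_square)
    hence 1: "norm ((cfB n (z\<^sup>2) * hF 1 (z\<^sup>2) - cfA n (z\<^sup>2) * hF 0 (z\<^sup>2)) / cfB n (z\<^sup>2)) \<le> r ^ n * hF 1 r"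
      using cf_remainder_bound[OF u assms(1,2), of n] by simp
    have "norm (z\<^sup>2 / 2) \<le> 1" using u assms by (simp add: norm_divide)
    hence "norm (z\<^sup>2 / 2 * poly (cpoly Q) z) \<le> 1 * C"
      unfolding norm_mult using C[OF z] by (intro mult_mono) auto
    thus ?thesis unfolding errc_def norm_mult[of "z\<^sup>2 / 2 * poly (cpoly Q) z"]
      using 1 C0 by (intro mult_mono) auto
  qed
  have "(\<lambda>n. C * (r ^ n * hF 1 r)) \<longlonglongrightarrow> C * (0 * hF 1 r)"
    using assms by (intro tendsto_intros LIMSEQ_realpow_zero) auto
  hence "(\<lambda>n. C * (r ^ k n * hF 1 r)) \<longlonglongrightarrow> 0"
    using filterlim_compose[OF _ k] by simp
  hence ev: "\<forall>\<^sub>F n in sequentially. C * (r ^ k n * hF 1 r) < e" if "e > 0" for e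
    using that by (rule order_tendstoD)
  have "\<forall>\<^sub>F n in sequentially. \<forall>z\<in>sphere 0 r. dist (errc Q (k n) z) 0 < e" if "e > 0" for e
    by (rule eventually_mono[OF ev[OF that]]) (auto intro: le_less_trans[OF bd])
  thus ?thesis by (intro uniform_limitI)
qed

lemma sum_order_disc_le_degree:
  assumes "T \<noteq> 0"
  shows "(\<Sum>z | norm z < 1 \<and> poly T z = 0. order z T) \<le> degree (T :: complex poly)"
  by (rule order_trans[OF sum_mono2 sum_order_le_degree]) (use assms poly_roots_finite in auto)

lemma Gc_zeros:
  assumes "degree U \<le> d" "degree Q \<le> d" "\<exists>w\<in>ball 0 1. Gc U Q w \<noteq> 0"
  shows "real_zeros_le (Gc U Q) (2 * d + 2)"
proof (cases "Q = 0")
  case True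
  have "U \<noteq> 0" using assms(3) True by (auto simp: Gc_def)
  show ?thesis
  proof (rule rouche_zero_count[where g = "\<lambda>_ _. 0" and H = "\<lambda>_ z. hF 0 (z\<^sup>2)" and T = "\<lambda>_. cpoly U"])
    show "(\<Sum>z | norm z < 1 \<and> poly (cpoly U) z = 0. order z (cpoly U)) \<le> 2 * d + 2"
      using sum_order_disc_le_degree[of "cpoly U"] \<open>U \<noteq> 0\<close> assms(1) by simp
    show "uniform_limit (sphere 0 r) (\<lambda>n x. 0) (\<lambda>_. 0) sequentially" for r :: real
      by (rule uniform_limit_const)
    show "hF 0 (w\<^sup>2) \<noteq> 0" if "w \<in> ball 0 1" for w :: complex
      using that norm_power2_less_1[of w] by (intro hF_zero_nonzero) simp
  qed (use assms(3) True Gc_holomorphic hF_sq_holomorphic \<open>U \<noteq> 0\<close>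
        in \<open>auto simp: Gc_def mult.commute simp del: norm_power\<close>)
next
  case False
  \<comment> \<open>Even and beyond d + 1, as the count of outer zeros requires.\<close>
  define k where "k = (\<lambda>i. 2 * (d + i + 2))"
  have k: "even (k i)" "k i > d + 1" for i by (auto simp: k_def)
  have kl: "filterlim k at_top sequentially"
    by (rule filterlim_at_top_mono[OF filterlim_ident]) (auto simp: k_def)
  show ?thesis
  proof (rule rouche_zero_count[where g = "\<lambda>i. errc Q (k i)" and H = "\<lambda>i z. hF 0 (z\<^sup>2) / cfB (k i) (z\<^sup>2)"
      and T = "\<lambda>i. cpoly (Tp U Q (k i))"])
    show "uniform_limit (sphere 0 r) (\<lambda>n. errc Q (k n)) (\<lambda>_. 0) sequentially" if "0 < r" "r < 1" for r
      by (rule errc_uniform_limit[OF that kl])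
    have nz: "cfB n (z\<^sup>2) \<noteq> 0" "hF 0 (z\<^sup>2) \<noteq> 0" if "z \<in> ball 0 1" for z :: complex and n
      using that norm_power2_less_1[of z] by (auto intro!: cfB_nonzero hF_zero_nonzero simp del: norm_power)
    show "(\<lambda>z. hF 0 (z\<^sup>2) / cfB (k n) (z\<^sup>2)) holomorphic_on ball 0 1" for n
      using nz by (intro holomorphic_intros hF_sq_holomorphic cf_sq_holomorphic)
    show "hF 0 (w\<^sup>2) / cfB (k n) (w\<^sup>2) \<noteq> 0" if "w \<in> ball 0 1" for w :: complex and n
      using nz[OF that] by simp
    show "cpoly (Tp U Q (k n)) \<noteq> 0" for n
      using Tp_outer_zeros(1)[OF assms(2) False k] by simp
    show "(\<Sum>z | norm z < 1 \<and> poly (cpoly (Tp U Q (k n))) z = 0. order z (cpoly (Tp U Q (k n)))) \<le> 2 * d + 2" for n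
      by (rule Tp_disc_zeros[OF assms(1,2) False k])
  qed (use assms Gc_holomorphic errc_holomorphic Gc_plus_errc in auto)
qed

text \<open>If the combination vanished with Q nonzero, \<open>Tp U Q n\<close> would be the
  approximation error up to a zero-free factor. It would then vanish at 0 to order 2n + 2, against
  the bound 2d + 2 for its zeros in the disc.\<close>

lemma Gc_eq_0_imp:
  assumes "\<And>w. w \<in> ball 0 1 \<Longrightarrow> Gc U Q w = 0"
  shows "U = 0 \<and> Q = 0"
proof -
  define d where "d = max (degree U) (degree Q)"
  define n where "n = 2 * (d + 2)"
  have n: "even n" "n > d + 1" by (auto simp: n_def)
  have d: "degree U \<le> d" "degree Q \<le> d" by (auto simp: d_def)
  have Q: "Q = 0"
  proof (rule ccontr)
    assume Q: "Q \<noteq> 0"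
    define T where "T = cpoly (Tp U Q n)"
    have T: "T \<noteq> 0" using Tp_outer_zeros(1)[OF d(2) Q n] by (simp add: T_def)
    have "\<exists>w\<in>ball 0 1. poly T w \<noteq> 0"
    proof (rule ccontr)
      assume "\<not> ?thesis"
      hence "ball 0 1 \<subseteq> {w. poly T w = 0}" by auto
      hence "finite (ball (0::complex) 1)" using poly_roots_finite[OF T] finite_subset by blast
      thus False using uncountable_ball[of 1 "0::complex"] countable_finite by auto
    qed
    hence zl: "real_zeros_le (poly T) (2 * d + 2)"
      by (intro rouche_zero_count[where g = "\<lambda>_ _. 0" and H = "\<lambda>_ _. 1" and T = "\<lambda>_. T"])
         (use Tp_disc_zeros[OF d Q n, of ] T in \<open>auto simp: T_def intro!: holomorphic_intros uniform_limit_const\<close>)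
    define h where "h = (\<lambda>z. poly (cpoly Q) z / 2 * of_real (\<Prod>i<n. kap i) * hF (Suc n) (z\<^sup>2) / hF 0 (z\<^sup>2))"
    have nz: "cfB n (z\<^sup>2) \<noteq> 0" "hF 0 (z\<^sup>2) \<noteq> 0" if "z \<in> ball 0 1" for z :: complex
      using that norm_power2_less_1[of z] by (auto intro!: cfB_nonzero hF_zero_nonzero simp del: norm_power)
    have "ord_ge (poly T) (complex_of_real 0) (2 * n + 2)"
    proof (rule ord_geI)
      show "h holomorphic_on ball (complex_of_real 0) 1"
        unfolding h_def using nz by (auto intro!: holomorphic_intros hF_sq_holomorphic)
      fix z :: complex assume "z \<in> ball (complex_of_real 0) 1"
      hence z: "z \<in> ball 0 1" by simp
      have "errc Q n z = hF 0 (z\<^sup>2) / cfB n (z\<^sup>2) * poly T z"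
        using Gc_plus_errc[of z U Q n] assms[OF z] z by (simp add: T_def)
      hence "poly T z = errc Q n z * cfB n (z\<^sup>2) / hF 0 (z\<^sup>2)" using nz[OF z] by simp
      also have "errc Q n z * cfB n (z\<^sup>2) = z\<^sup>2 / 2 * poly (cpoly Q) z *
          (cfB n (z\<^sup>2) * hF 1 (z\<^sup>2) - cfA n (z\<^sup>2) * hF 0 (z\<^sup>2))"
        using nz[OF z] by (simp add: errc_def)
      also have "\<dots> = z\<^sup>2 / 2 * poly (cpoly Q) z * (of_real (\<Prod>i<n. kap i) * (z\<^sup>2) ^ n * hF (Suc n) (z\<^sup>2))"
        using norm_power2_less_1[of z] z by (subst cf_remainder) (auto simp del: norm_power)
      finally show "poly T z = (z - complex_of_real 0) ^ (2 * n + 2) * h z"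
        by (simp add: h_def power_mult power_add power2_eq_square power_mult_distrib mult_ac del: of_real_prod)
    qed auto
    hence "sum (\<lambda>_. 2 * n + 2) {0::real} \<le> 2 * d + 2"
      using zl unfolding real_zeros_le_def by (elim allE[of _ "{0}"]) auto
    thus False using n by simp
  qed
  have "U = 0"
  proof (rule ccontr)
    assume U: "U \<noteq> 0"
    have "poly (cpoly U) w = 0" if "w \<in> ball 0 1" for w
      using assms[OF that] hF_zero_nonzero[OF norm_power2_less_1, of w] that Q by (simp add: Gc_def)
    hence "ball 0 1 \<subseteq> {w. poly (cpoly U) w = 0}" by auto
    hence "finite (ball (0::complex) 1)" using poly_roots_finite[of "cpoly U"] U finite_subset by fastforce
    thus False using uncountable_ball[of 1 "0::complex"] countable_finite by auto
  qed
  with Q show ?thesis by simp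
qed

section \<open>Series for the first two elliptic integrals\<close>

text \<open>The singularity lies at the end point z = 1, where the fundamental theorem asks only for
  continuity of \<open>H (arcsin z)\<close>; the improper integral therefore needs no limit.\<close>

lemma has_integral_arcsin_subst:
  fixes F :: "real \<Rightarrow> real"
  assumes "continuous_on {0..pi/2} F"
  shows "((\<lambda>z. F (arcsin z) / sqrt (1 - z\<^sup>2)) has_integral integral {0..pi/2} F) {0..1}"
proof -
  define H where "H = (\<lambda>t. integral {0..t} F)"
  have H': "(H has_real_derivative F t) (at t within {0..pi/2})" if "t \<in> {0..pi/2}" for t
    unfolding H_def by (rule integral_has_real_derivative[OF assms that])
  have arc: "arcsin z \<in> {0..pi/2}" if "z \<in> {0..1}" for z
  proof -
    have "arcsin 0 \<le> arcsin z" using that by (intro arcsin_le_arcsin) auto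
    moreover have "arcsin z \<le> pi / 2" using that by (intro arcsin_ubound) auto
    ultimately show ?thesis by simp
  qed
  have "((\<lambda>z. F (arcsin z) / sqrt (1 - z\<^sup>2)) has_integral H (arcsin 1) - H (arcsin 0)) {0..1}"
  proof (rule fundamental_theorem_of_calculus_interior)
    have "continuous_on {0..pi/2} H"
      using H' by (rule DERIV_continuous_on)
    moreover have "continuous_on {0..1} arcsin"
      by (intro continuous_on_arcsin continuous_on_id) auto
    ultimately show "continuous_on {0..1} (\<lambda>z. H (arcsin z))"
      by (rule continuous_on_compose2[of "{0..pi/2}" H]) (use arc in blast)
    fix z :: real assume z: "z \<in> {0<..<1}"
    have "arcsin 0 < arcsin z" "arcsin z < arcsin 1"
      using z by (intro arcsin_less_arcsin; simp)+
    hence "arcsin z \<in> {0<..<pi/2}" by simp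
    hence "at (arcsin z) within {0..pi/2} = at (arcsin z)"
      by (intro at_within_interior) (auto simp: interior_atLeastAtMost_real)
    hence "(H has_real_derivative F (arcsin z)) (at (arcsin z))"
      using H'[of "arcsin z"] arc[of z] z by auto
    moreover have "(arcsin has_real_derivative inverse (sqrt (1 - z\<^sup>2))) (at z)"
      using z by (intro DERIV_arcsin) auto
    ultimately have "((\<lambda>z. H (arcsin z)) has_real_derivative F (arcsin z) * inverse (sqrt (1 - z\<^sup>2))) (at z)"
      by (rule DERIV_chain2)
    thus "((\<lambda>z. H (arcsin z)) has_vector_derivative F (arcsin z) / sqrt (1 - z\<^sup>2)) (at z)"
      by (simp add: has_real_derivative_iff_has_vector_derivative divide_inverse)
  qed auto
  thus ?thesis by (simp add: H_def)
qed

section \<open>Trigonometric forms of the three integrals\<close>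

lemma sin2_bounds: "0 \<le> (sin t)\<^sup>2" "(sin (t::real))\<^sup>2 \<le> 1"
  using abs_sin_le_one[of t] by (auto simp: abs_square_le_1)

lemma Delta_pos:
  assumes "u < 1"
  shows "0 < 1 - u * (sin (t::real))\<^sup>2"
proof (cases "u \<le> 0")
  case True
  thus ?thesis using sin2_bounds[of t] mult_nonpos_nonneg[of u "(sin t)\<^sup>2"] by linarith
next
  case False
  hence "u * (sin t)\<^sup>2 \<le> u * 1" using sin2_bounds[of t] by (intro mult_left_mono) auto
  thus ?thesis using assms by linarith
qed

lemma Delta_nonzero:
  assumes "u < 1"
  shows "1 - u * (sin (t::real))\<^sup>2 \<noteq> 0"
  using Delta_pos[OF assms, of t] by linarith

lemma ksq_less_1: "\<bar>k\<bar> < 1 \<Longrightarrow> k\<^sup>2 < (1::real)"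
  by (simp add: abs_square_less_1)

lemma sin_arcsin_01: "z \<in> {0..1} \<Longrightarrow> sin (arcsin z) = z"
  by (intro sin_arcsin) auto

lemma ellipticK_trig:
  assumes "\<bar>k\<bar> < 1"
  shows "ellipticK k = integral {0..pi/2} (\<lambda>t. 1 / sqrt (1 - k\<^sup>2 * (sin t)\<^sup>2))"
proof -
  let ?F = "\<lambda>t. 1 / sqrt (1 - k\<^sup>2 * (sin t)\<^sup>2)"
  have "continuous_on {0..pi/2} ?F"
    by (intro continuous_intros ballI)
       (simp only: real_sqrt_eq_0_iff Delta_nonzero[OF ksq_less_1[OF assms]] simp_thms)
  note * = has_integral_arcsin_subst[OF this]
  have "ellipticK k = integral {0..1} (\<lambda>z. ?F (arcsin z) / sqrt (1 - z\<^sup>2))"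
    unfolding ellipticK_def
    by (rule integral_cong) (simp only: sin_arcsin_01 real_sqrt_mult divide_divide_eq_left mult.commute)
  thus ?thesis using integral_unique[OF *] by simp
qed

lemma ellipticE_trig:
  assumes "\<bar>k\<bar> < 1"
  shows "ellipticE k = integral {0..pi/2} (\<lambda>t. sqrt (1 - k\<^sup>2 * (sin t)\<^sup>2))"
proof -
  let ?F = "\<lambda>t. sqrt (1 - k\<^sup>2 * (sin t)\<^sup>2)"
  have "continuous_on {0..pi/2} ?F"
    by (intro continuous_intros)
  note * = has_integral_arcsin_subst[OF this]
  have "ellipticE k = integral {0..1} (\<lambda>z. ?F (arcsin z) / sqrt (1 - z\<^sup>2))"
    unfolding ellipticE_def by (rule integral_cong) (simp only: sin_arcsin_01)
  thus ?thesis using integral_unique[OF *] by simp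
qed

lemma ellipticPi_trig:
  assumes "\<bar>k\<bar> < 1" "m < 1"
  shows "ellipticPi m k = integral {0..pi/2} (\<lambda>t. 1 / ((1 - m * (sin t)\<^sup>2) * sqrt (1 - k\<^sup>2 * (sin t)\<^sup>2)))"
proof -
  let ?F = "\<lambda>t. 1 / ((1 - m * (sin t)\<^sup>2) * sqrt (1 - k\<^sup>2 * (sin t)\<^sup>2))"
  have "continuous_on {0..pi/2} ?F"
    by (intro continuous_intros ballI)
       (simp only: mult_eq_0_iff real_sqrt_eq_0_iff Delta_nonzero[OF assms(2)]
          Delta_nonzero[OF ksq_less_1[OF assms(1)]] simp_thms)
  note * = has_integral_arcsin_subst[OF this]
  have "ellipticPi m k = integral {0..1} (\<lambda>z. ?F (arcsin z) / sqrt (1 - z\<^sup>2))"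
    unfolding ellipticPi_def
    by (rule integral_cong)
       (simp only: sin_arcsin_01 real_sqrt_mult divide_divide_eq_left mult.commute mult.left_commute)
  thus ?thesis using integral_unique[OF *] by simp
qed

section \<open>Expansion in powers of the squared modulus\<close>

lemma wallis_integral: "((\<lambda>t. sin t ^ (2 * j)) has_integral pi / 2 * wal j) {0..pi/2}"
proof (induction j)
  case 0
  show ?case using has_integral_const_real[of "1::real" 0 "pi/2"] by simp
next
  case (Suc j)
  \<comment> \<open>Integration by parts: the integrand is the derivative of
    \<open>- cos t * sin t ^ (2 * j + 1)\<close>, which vanishes at both ends.\<close>
  have "((\<lambda>t. (real (2 * j) + 2) * sin t ^ (2 * j + 2) - (real (2 * j) + 1) * sin t ^ (2 * j)) has_integral
      (- cos (pi/2) * sin (pi/2) ^ (2 * j + 1)) - (- cos 0 * sin 0 ^ (2 * j + 1))) {0..pi/2}"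
  proof (rule fundamental_theorem_of_calculus)
    fix t :: real
    have c: "cos t * cos t = 1 - sin t * sin t" using sin_cos_squared_add[of t] by (simp add: power2_eq_square)
    have "((\<lambda>t. - cos t * sin t ^ (2 * j + 1)) has_real_derivative
       sin t * sin t ^ (2 * j + 1) - cos t * ((real (2 * j) + 1) * sin t ^ (2 * j) * cos t)) (at t within {0..pi/2})"
    proof -
      have "((\<lambda>t. sin t ^ (2 * j + 1)) has_real_derivative (real (2 * j) + 1) * sin t ^ (2 * j) * cos t) (at t)"
        using DERIV_power[OF DERIV_sin[of t], of "2 * j + 1"] by (simp add: algebra_simps)
      from DERIV_mult[OF DERIV_minus[OF DERIV_cos[of t]] this]
      have "((\<lambda>t. - cos t * sin t ^ (2 * j + 1)) has_real_derivative
        sin t * sin t ^ (2 * j + 1) - cos t * ((real (2 * j) + 1) * sin t ^ (2 * j) * cos t)) (at t)"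
        by (simp add: algebra_simps)
      thus ?thesis by (rule has_field_derivative_at_within)
    qed
    also have "sin t * sin t ^ (2 * j + 1) - cos t * ((real (2 * j) + 1) * sin t ^ (2 * j) * cos t)
      = sin t * sin t * sin t ^ (2 * j) - (real (2 * j) + 1) * sin t ^ (2 * j) * (cos t * cos t)"
      by simp
    also have "\<dots> = (real (2 * j) + 2) * sin t ^ (2 * j + 2) - (real (2 * j) + 1) * sin t ^ (2 * j)"
      unfolding c by (simp add: algebra_simps)
    finally show "((\<lambda>t. - cos t * sin t ^ (2 * j + 1)) has_vector_derivative
      (real (2 * j) + 2) * sin t ^ (2 * j + 2) - (real (2 * j) + 1) * sin t ^ (2 * j)) (at t within {0..pi/2})"
      by (simp add: has_real_derivative_iff_has_vector_derivative)
  qed auto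
  hence "((\<lambda>t. (real (2 * j) + 2) * sin t ^ (2 * j + 2) - (real (2 * j) + 1) * sin t ^ (2 * j)) has_integral 0) {0..pi/2}"
    by simp
  from has_integral_add[OF this has_integral_mult_right[OF Suc, of "real (2 * j) + 1"]]
  have "((\<lambda>t. (real (2 * j) + 2) * sin t ^ (2 * j + 2)) has_integral ((real (2 * j) + 1) * (pi / 2 * wal j))) {0..pi/2}"
    by simp
  from has_integral_mult_right[OF this, of "1 / (real (2 * j) + 2)"]
  have "((\<lambda>t. sin t ^ (2 * Suc j)) has_integral ((real (2 * j) + 1) * (pi / 2 * wal j) / (real (2 * j) + 2))) {0..pi/2}"
    by simp
  moreover have "(real (2 * j) + 1) * (pi / 2 * wal j) / (real (2 * j) + 2) = pi / 2 * wal (Suc j)"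
  proof -
    have "(real (2 * j) + 1) * wal j = (real (2 * j) + 2) * wal (Suc j)"
      using wal_Suc[of j] by (simp add: algebra_simps)
    hence "(real (2 * j) + 1) * wal j / (real (2 * j) + 2) = wal (Suc j)"
      by (simp add: divide_eq_eq add_nonneg_eq_0_iff)
    thus ?thesis by (metis mult.left_commute times_divide_eq_right)
  qed
  ultimately show ?case by (simp only:)
qed

lemma inverse_sqrt_series:
  assumes "\<bar>v\<bar> < 1"
  shows "(\<lambda>j. wal j * v ^ j) sums (1 / sqrt (1 - v))"
proof -
  have "(\<lambda>j. ((-1/2) gchoose j) * (- v) ^ j) sums (1 + (- v)) powr (-1/2)"
    using assms by (intro gen_binomial_real) auto
  moreover have "((-1/2) gchoose j) * (- v) ^ j = wal j * v ^ j" for j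
    by (simp add: gbinomial_pochhammer wal_def power_minus[of v] mult_ac)
  moreover have "(1 + (- v)) powr (-1/2) = 1 / sqrt (1 - v)"
  proof -
    have "(1 + (- v)) powr (-1/2) = (1 - v) powr (- (1/2))" by (simp only: minus_divide_left add_uminus_conv_diff)
    also have "\<dots> = inverse ((1 - v) powr (1/2))" by (rule powr_minus)
    also have "\<dots> = inverse (sqrt (1 - v))" using assms by (subst powr_half_sqrt) auto
    finally show ?thesis by (simp only: inverse_eq_divide)
  qed
  ultimately show ?thesis by simp
qed

text \<open>The powers of \<open>\<bar>u\<bar>\<close> dominate the terms uniformly in t, so
  integration is termwise. The case i = 0 yields \<open>hF 0\<close>, the case i = 1 yields
  \<open>hF 1\<close>.\<close>

lemma trig_series_integral:
  assumes "\<bar>u\<bar> < 1" and I: "\<And>j. ((\<lambda>t. sin t ^ (2 * i) * sin t ^ (2 * j)) has_integral I j) {0..pi/2}"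
  shows "(\<lambda>j. wal j * u ^ j * I j) sums integral {0..pi/2} (\<lambda>t. sin t ^ (2 * i) / sqrt (1 - u * (sin t)\<^sup>2))"
proof -
  define f where "f = (\<lambda>j t. sin t ^ (2 * i) * (wal j * (u * (sin t)\<^sup>2) ^ j) :: real)"
  have v: "\<bar>u * (sin t)\<^sup>2\<bar> \<le> \<bar>u\<bar>" for t :: real
    using sin2_bounds[of t] by (simp add: abs_mult mult_left_le)
  have fs: "(\<lambda>j. f j t) sums (sin t ^ (2 * i) / sqrt (1 - u * (sin t)\<^sup>2))" for t
    unfolding f_def using sums_mult[OF inverse_sqrt_series[of "u * (sin t)\<^sup>2"], of "sin t ^ (2 * i)"] v[of t] assms(1)
    by (simp add: le_less_trans)
  have bd: "norm (f j t) \<le> \<bar>u\<bar> ^ j" for j t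
  proof -
    have "\<bar>sin t ^ (2 * i)\<bar> \<le> 1" using abs_sin_le_one[of t] by (simp add: power_abs power_le_one)
    moreover have "\<bar>wal j * (u * (sin t)\<^sup>2) ^ j\<bar> \<le> 1 * \<bar>u\<bar> ^ j"
      unfolding abs_mult[of "wal j"] power_abs using wal_pos[of j] wal_le_1[of j] v[of t]
      by (intro mult_mono power_mono) auto
    ultimately have "\<bar>sin t ^ (2 * i)\<bar> * \<bar>wal j * (u * (sin t)\<^sup>2) ^ j\<bar> \<le> 1 * (1 * \<bar>u\<bar> ^ j)"
      by (intro mult_mono) auto
    thus ?thesis by (simp add: f_def abs_mult)
  qed
  have "uniform_limit {0..pi/2} (\<lambda>n t. \<Sum>j<n. f j t) (\<lambda>t. suminf (\<lambda>j. f j t)) sequentially"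
    using assms(1) bd by (intro Weierstrass_m_test[of _ _ "\<lambda>j. \<bar>u\<bar> ^ j"] summable_geometric) auto
  also have "(\<lambda>t. suminf (\<lambda>j. f j t)) = (\<lambda>t. sin t ^ (2 * i) / sqrt (1 - u * (sin t)\<^sup>2))"
    using fs by (simp add: sums_iff)
  finally have ul: "uniform_limit {0..pi/2} (\<lambda>n t. \<Sum>j<n. f j t) (\<lambda>t. sin t ^ (2 * i) / sqrt (1 - u * (sin t)\<^sup>2)) sequentially" .
  obtain A B where A: "\<And>n. ((\<lambda>t. \<Sum>j<n. f j t) has_integral A n) {0..pi/2}"
    and B: "((\<lambda>t. sin t ^ (2 * i) / sqrt (1 - u * (sin t)\<^sup>2)) has_integral B) {0..pi/2}"
    and AB: "A \<longlonglongrightarrow> B"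
    by (rule uniform_limit_integral[OF ul]) (auto intro!: continuous_intros simp: f_def)
  have "((\<lambda>t. \<Sum>j<n. f j t) has_integral (\<Sum>j<n. wal j * u ^ j * I j)) {0..pi/2}" for n
  proof (intro has_integral_sum finite_lessThan)
    fix j
    have "f j = (\<lambda>t. wal j * u ^ j * (sin t ^ (2 * i) * sin t ^ (2 * j)))"
      by (auto simp: f_def power_mult_distrib power_mult)
    thus "(f j has_integral wal j * u ^ j * I j) {0..pi/2}"
      using has_integral_mult_right[OF I[of j], of "wal j * u ^ j"] by simp
  qed
  hence "A = (\<lambda>n. \<Sum>j<n. wal j * u ^ j * I j)"
    using A has_integral_unique by blast
  thus ?thesis using AB B by (simp add: sums_def integral_unique)
qed

lemma integral_K_series:
  assumes "\<bar>u\<bar> < 1"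
  shows "integral {0..pi/2} (\<lambda>t. 1 / sqrt (1 - u * (sin t)\<^sup>2)) = pi / 2 * hF 0 u"
proof -
  have "(\<lambda>j. wal j * u ^ j * (pi / 2 * wal j)) sums integral {0..pi/2} (\<lambda>t. sin t ^ (2 * 0) / sqrt (1 - u * (sin t)\<^sup>2))"
    by (rule trig_series_integral[OF assms]) (use wallis_integral in simp)
  moreover have "(\<lambda>j. pi / 2 * (hcoef 0 j * u ^ j)) sums (pi / 2 * hF 0 u)"
    unfolding hF_def using summable_hcoef[of u 0] assms by (intro sums_mult) (simp add: summable_sums)
  hence "(\<lambda>j. wal j * u ^ j * (pi / 2 * wal j)) sums (pi / 2 * hF 0 u)"
    by (simp add: hcoef_zero power2_eq_square mult_ac)
  ultimately show ?thesis using sums_unique2 by fastforce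
qed

text \<open>For nonzero k this says that \<open>hF 1 (k^2)\<close> is
  \<open>4 / pi * (K - E) / k^2\<close>; the series removes the singularity at k = 0.\<close>

lemma integral_sin2_series:
  assumes "\<bar>u\<bar> < 1"
  shows "integral {0..pi/2} (\<lambda>t. (sin t)\<^sup>2 / sqrt (1 - u * (sin t)\<^sup>2)) = pi / 4 * hF 1 u"
proof -
  have "(\<lambda>j. wal j * u ^ j * (pi / 2 * wal (Suc j))) sums integral {0..pi/2} (\<lambda>t. sin t ^ (2 * 1) / sqrt (1 - u * (sin t)\<^sup>2))"
    by (rule trig_series_integral[OF assms]) (use wallis_integral[of "Suc _"] in \<open>simp flip: power_add\<close>)
  moreover have "(\<lambda>j. pi / 4 * (hcoef 1 j * u ^ j)) sums (pi / 4 * hF 1 u)"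
    unfolding hF_def using summable_hcoef[of u 1] assms by (intro sums_mult) (simp add: summable_sums)
  hence "(\<lambda>j. wal j * u ^ j * (pi / 2 * wal (Suc j))) sums (pi / 4 * hF 1 u)"
    by (simp add: hcoef_one[simplified] mult_ac)
  ultimately show ?thesis using sums_unique2 by fastforce
qed

lemma ellipticK_series:
  assumes "\<bar>k\<bar> < 1"
  shows "ellipticK k = pi / 2 * hF 0 (k\<^sup>2)"
  using integral_K_series[of "k\<^sup>2"] ksq_less_1[OF assms] by (simp add: ellipticK_trig[OF assms])

lemma ellipticE_series:
  assumes "\<bar>k\<bar> < 1"
  shows "ellipticE k = pi / 2 * (hF 0 (k\<^sup>2) - k\<^sup>2 / 2 * hF 1 (k\<^sup>2))"
proof -
  note D = Delta_pos[OF ksq_less_1[OF assms]]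
  have c: "continuous_on {0..pi/2} (\<lambda>t. 1 / sqrt (1 - k\<^sup>2 * (sin t)\<^sup>2))"
    by (intro continuous_intros ballI)
       (simp only: real_sqrt_eq_0_iff Delta_nonzero[OF ksq_less_1[OF assms]] simp_thms)
  have c': "continuous_on {0..pi/2} (\<lambda>t. k\<^sup>2 * ((sin t)\<^sup>2 / sqrt (1 - k\<^sup>2 * (sin t)\<^sup>2)))"
    by (intro continuous_intros ballI)
       (simp only: real_sqrt_eq_0_iff Delta_nonzero[OF ksq_less_1[OF assms]] simp_thms)
  have "ellipticE k = integral {0..pi/2} (\<lambda>t. 1 / sqrt (1 - k\<^sup>2 * (sin t)\<^sup>2) - k\<^sup>2 * ((sin t)\<^sup>2 / sqrt (1 - k\<^sup>2 * (sin t)\<^sup>2)))"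
    unfolding ellipticE_trig[OF assms]
  proof (rule integral_cong)
    fix t :: real
    have "(1 - k\<^sup>2 * (sin t)\<^sup>2) / sqrt (1 - k\<^sup>2 * (sin t)\<^sup>2) = sqrt (1 - k\<^sup>2 * (sin t)\<^sup>2)"
      using D[of t] by (intro real_div_sqrt) simp
    moreover have "1 / R - a * (b / R) = (1 - a * b) / R" for R a b :: real
      by (simp add: diff_divide_distrib)
    ultimately show "sqrt (1 - k\<^sup>2 * (sin t)\<^sup>2) = 1 / sqrt (1 - k\<^sup>2 * (sin t)\<^sup>2) - k\<^sup>2 * ((sin t)\<^sup>2 / sqrt (1 - k\<^sup>2 * (sin t)\<^sup>2))"
      by (simp only:)
  qed
  also have "\<dots> = integral {0..pi/2} (\<lambda>t. 1 / sqrt (1 - k\<^sup>2 * (sin t)\<^sup>2))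
      - integral {0..pi/2} (\<lambda>t. k\<^sup>2 * ((sin t)\<^sup>2 / sqrt (1 - k\<^sup>2 * (sin t)\<^sup>2)))"
    by (intro integral_diff integrable_continuous_real c c')
  also have "\<dots> = pi / 2 * hF 0 (k\<^sup>2) - k\<^sup>2 * (pi / 4 * hF 1 (k\<^sup>2))"
  proof -
    have "\<bar>k\<^sup>2\<bar> < 1" using ksq_less_1[OF assms] by simp
    thus ?thesis unfolding integral_mult_right by (simp only: integral_K_series integral_sin2_series)
  qed
  finally show ?thesis by (simp add: algebra_simps)
qed

section \<open>The third elliptic integral\<close>

definition W_integrand :: "real \<Rightarrow> real \<Rightarrow> real" where
  "W_integrand u t = (1 - u) * sqrt (1 + u) / ((1 + u - 2 * u * (sin t)\<^sup>2) * sqrt (1 - u * (sin t)\<^sup>2))"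

text \<open>
  \<open>Wfun (k\<^sup>2) = (1 - k\<^sup>2) / sqrt (1 + k\<^sup>2) * Pi(mu(k), k)\<close>. This weight is chosen so that the \<open>Pi\<close> term disappears
  from the derivative: modulo the \<open>t\<close>-derivative of \<open>W_primitive\<close>, the integrand \<open>W_integrand'\<close> is one for \<open>K\<close> and \<open>E\<close>.
\<close>

definition Wfun :: "real \<Rightarrow> real" where
  "Wfun u = integral {0..pi/2} (W_integrand u)"

definition W_integrand' :: "real \<Rightarrow> real \<Rightarrow> real" where
  "W_integrand' u t =
     ((- 1 - 3 * u) / (2 * (1 + u - 2 * u * (sin t)\<^sup>2) * sqrt (1 - u * (sin t)\<^sup>2))
      - (1 - u\<^sup>2) * (1 - 2 * (sin t)\<^sup>2) / ((1 + u - 2 * u * (sin t)\<^sup>2)\<^sup>2 * sqrt (1 - u * (sin t)\<^sup>2))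
      + (1 - u\<^sup>2) * (sin t)\<^sup>2 / (2 * (1 + u - 2 * u * (sin t)\<^sup>2) * sqrt (1 - u * (sin t)\<^sup>2) ^ 3)) / sqrt (1 + u)"

definition W_primitive :: "real \<Rightarrow> real \<Rightarrow> real" where
  "W_primitive u t = sin t * cos t * (- (3 + u) / 2 + u * (sin t)\<^sup>2)
     / (sqrt (1 - u * (sin t)\<^sup>2) * (1 + u - 2 * u * (sin t)\<^sup>2)) / sqrt (1 + u)"

section \<open>Derivatives of the integrand and of its primitive\<close>

lemma W_denominator_pos:
  assumes "\<bar>u\<bar> < 1"
  shows "0 < 1 + u - 2 * u * (sin (t::real))\<^sup>2"
proof -
  have "\<bar>1 - 2 * (sin t)\<^sup>2\<bar> \<le> 1" using sin2_bounds[of t] by (simp add: abs_le_iff)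
  hence "\<bar>u * (1 - 2 * (sin t)\<^sup>2)\<bar> \<le> \<bar>u\<bar>" by (simp add: abs_mult mult_left_le)
  hence "- 1 < u * (1 - 2 * (sin t)\<^sup>2)" using assms by linarith
  thus ?thesis by (simp add: right_diff_distrib)
qed

lemma W_integrand_form:
  fixes A B y D R S x :: real
  assumes "D > 0" "R > 0" "S > 0"
  shows "(A / (2 * S) * (D * R) - B / S * (y * R + D * (- x / (2 * R)))) / (D * R)\<^sup>2
     = (A / (2 * D * R) - B * y / (D\<^sup>2 * R) + B * x / (2 * D * R ^ 3)) / S"
proof -
  have 1: "A / (2 * S) * (D * R) / (D * R)\<^sup>2 = A / (2 * D * R) / S"
    using assms by (simp add: power2_eq_square)
  have 2: "B / S * (y * R) / (D * R)\<^sup>2 = B * y / (D\<^sup>2 * R) / S"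
    using assms by (simp add: power2_eq_square)
  have 3: "B / S * (D * (x / (2 * R))) / (D * R)\<^sup>2 = B * x / (2 * D * R ^ 3) / S"
    using assms by (simp add: power2_eq_square power3_eq_cube)
  define a b c e where "a = A / (2 * S) * (D * R)" and "b = B / S" and "c = y * R" and "e = x / (2 * R)"
  have "- x / (2 * R) = - e" by (simp add: e_def)
  hence "(a - b * (c + D * (- x / (2 * R)))) / (D * R)\<^sup>2 = a / (D * R)\<^sup>2 - b * c / (D * R)\<^sup>2 + b * (D * e) / (D * R)\<^sup>2"
    by (simp add: algebra_simps diff_divide_distrib add_divide_distrib)
  note * = this[unfolded a_def b_def c_def e_def]
  show ?thesis unfolding * 1 2 3 by (simp add: diff_divide_distrib add_divide_distrib)
qed

text \<open>Atoms for the square root and the denominator reduce the claim to the polynomial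
  equation \<open>key\<close>, in which R enters only through its square. Here y is the derivative
  of \<open>sin t * cos t\<close> and q is the square of that product.\<close>

lemma W_primitive_form:
  fixes A B y D R v g q x E :: real
  assumes "D > 0" "R > 0"
    and key: "2 * ((y * g + 2 * v * q) * R\<^sup>2 * D + v * g * q * D + 4 * v * g * q * R\<^sup>2)
      = A * D * R\<^sup>2 - 2 * B * y * R\<^sup>2 + B * x * D + x * D\<^sup>2 * R\<^sup>2"
  shows "((y * g + 2 * v * q) * (R * D) + g * (v * q / R * D + R * (4 * v * q))) / (R * D)\<^sup>2
     = A / (2 * D * R) - B * y / (D\<^sup>2 * R) + B * x / (2 * D * R ^ 3) + x / (2 * R)"
proof -
  define Z where "Z = 2 * (R ^ 3 * D\<^sup>2)"
  have Z: "Z \<noteq> 0" using assms by (simp add: Z_def)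
  have "((y * g + 2 * v * q) * (R * D) + g * (v * q / R * D + R * (4 * v * q))) / (R * D)\<^sup>2
    = (2 * ((y * g + 2 * v * q) * R\<^sup>2 * D + v * g * q * D + 4 * v * g * q * R\<^sup>2)) / Z"
    using assms(1,2) unfolding Z_def by (simp add: divide_simps) (simp add: algebra_simps power2_eq_square power3_eq_cube)
  also have "\<dots> = A * D * R\<^sup>2 / Z - 2 * B * y * R\<^sup>2 / Z + B * x * D / Z + x * D\<^sup>2 * R\<^sup>2 / Z"
    unfolding key by (simp add: diff_divide_distrib add_divide_distrib)
  also have "A * D * R\<^sup>2 / Z = A / (2 * D * R)"
    using assms(1,2) by (simp add: Z_def power2_eq_square power3_eq_cube)
  also have "2 * B * y * R\<^sup>2 / Z = B * y / (D\<^sup>2 * R)"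
    using assms(1,2) by (simp add: Z_def power2_eq_square power3_eq_cube)
  also have "B * x * D / Z = B * x / (2 * D * R ^ 3)"
    using assms(1,2) by (simp add: Z_def power2_eq_square)
  also have "x * D\<^sup>2 * R\<^sup>2 / Z = x / (2 * R)"
    using assms(1,2) by (simp add: Z_def power2_eq_square power3_eq_cube)
  finally show ?thesis .
qed

text \<open>With x in the role of \<open>sin^2 t\<close> this is an identity of polynomials in u and
  x, and it accounts for the numerator of \<open>W_primitive\<close>. Doubling g first clears its
  fraction.\<close>

lemma W_derivative_identity:
  fixes u x :: real
  defines "D \<equiv> 1 + u - 2 * u * x" and "R2 \<equiv> 1 - u * x" and "g \<equiv> - (3 + u) / 2 + u * x"
    and "q \<equiv> x * (1 - x)" and "y \<equiv> 1 - 2 * x"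
  shows "2 * ((y * g + 2 * u * q) * R2 * D + u * g * q * D + 4 * u * g * q * R2)
      = (- 1 - 3 * u) * D * R2 - 2 * (1 - u\<^sup>2) * y * R2 + (1 - u\<^sup>2) * x * D + x * D\<^sup>2 * R2"
proof -
  define G where "G = - (3 + u) + 2 * u * x"
  have g: "2 * g = G" by (simp add: g_def G_def)
  have "2 * ((y * g + 2 * u * q) * R2 * D + u * g * q * D + 4 * u * g * q * R2)
     = (y * (2 * g) + 4 * u * q) * R2 * D + u * (2 * g) * q * D + 4 * u * (2 * g) * q * R2"
    by algebra
  also have "\<dots> = (- 1 - 3 * u) * D * R2 - 2 * (1 - u\<^sup>2) * y * R2 + (1 - u\<^sup>2) * x * D + x * D\<^sup>2 * R2"
    unfolding g D_def R2_def G_def q_def y_def by algebra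
  finally show ?thesis .
qed

lemma W_integrand_deriv:
  assumes u: "\<bar>u\<bar> < 1"
  shows "((\<lambda>u. W_integrand u t) has_real_derivative W_integrand' u t) (at u)"
proof -
  define x where "x = (sin t)\<^sup>2"
  define D where "D = 1 + u - 2 * u * x"
  define R where "R = sqrt (1 - u * x)"
  define S where "S = sqrt (1 + u)"
  have D: "D > 0" using W_denominator_pos[OF u, of t] by (simp add: D_def x_def)
  have R: "R > 0" using Delta_pos[of u t] u by (simp add: R_def x_def)
  have S: "S > 0" using u by (simp add: S_def)
  have S2: "S\<^sup>2 = 1 + u" unfolding S_def using u by simp
  have dS: "((\<lambda>u. sqrt (1 + u)) has_real_derivative 1 / (2 * S)) (at u)"
  proof -
    have "((\<lambda>u. 1 + u) has_real_derivative 1) (at u)" by (auto intro!: derivative_eq_intros)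
    moreover have "(sqrt has_real_derivative inverse S / 2) (at (1 + u))"
      unfolding S_def by (rule DERIV_real_sqrt) (use u in auto)
    moreover have "inverse S / 2 * 1 = 1 / (2 * S)" by (simp add: inverse_eq_divide)
    ultimately show ?thesis
      using DERIV_chain2[of sqrt "inverse S / 2" "\<lambda>u. 1 + u" u 1] by (simp only:)
  qed
  have dR: "((\<lambda>u. sqrt (1 - u * x)) has_real_derivative - x / (2 * R)) (at u)"
  proof -
    have "((\<lambda>u. 1 - u * x) has_real_derivative - x) (at u)" by (auto intro!: derivative_eq_intros)
    moreover have "(sqrt has_real_derivative inverse R / 2) (at (1 - u * x))"
      unfolding R_def by (rule DERIV_real_sqrt) (use Delta_pos[of u t] u in \<open>auto simp: x_def\<close>)
    moreover have "inverse R / 2 * - x = - x / (2 * R)" by (simp add: inverse_eq_divide)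
    ultimately show ?thesis
      using DERIV_chain2[of sqrt "inverse R / 2" "\<lambda>u. 1 - u * x" u "- x"] by (simp only:)
  qed
  have d1: "((\<lambda>u. 1 - u) has_real_derivative - 1) (at u)" by (auto intro!: derivative_eq_intros)
  have dD: "((\<lambda>u. 1 + u - 2 * u * x) has_real_derivative 1 - 2 * x) (at u)" by (auto intro!: derivative_eq_intros)
  have nz: "(1 + u - 2 * u * x) * sqrt (1 - u * x) \<noteq> 0" using D R by (simp add: D_def R_def)
  from DERIV_divide[OF DERIV_mult[OF d1 dS] DERIV_mult[OF dD dR] nz]
  have "((\<lambda>u. (1 - u) * sqrt (1 + u) / ((1 + u - 2 * u * x) * sqrt (1 - u * x))) has_real_derivative
     ((- 1 * S + 1 / (2 * S) * (1 - u)) * (D * R) - (1 - u) * S * ((1 - 2 * x) * R + - x / (2 * R) * D)) / ((D * R) * (D * R))) (at u)"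
    by (simp only: D_def R_def S_def)
  also have "((- 1 * S + 1 / (2 * S) * (1 - u)) * (D * R) - (1 - u) * S * ((1 - 2 * x) * R + - x / (2 * R) * D)) / ((D * R) * (D * R))
     = ((- 1 - 3 * u) / (2 * D * R) - (1 - u\<^sup>2) * (1 - 2 * x) / (D\<^sup>2 * R) + (1 - u\<^sup>2) * x / (2 * D * R ^ 3)) / S"
  proof -
    have a: "- 1 * S + 1 / (2 * S) * (1 - u) = (- 1 - 3 * u) / (2 * S)"
      using S S2 by (simp add: field_simps power2_eq_square)
    have b: "(1 - u) * S = (1 - u\<^sup>2) / S"
    proof -
      have "(1 - u) * S * S = (1 - u) * S\<^sup>2" by (simp only: power2_eq_square mult.assoc)
      also have "\<dots> = 1 - u\<^sup>2" unfolding S2 by (simp add: power2_eq_square algebra_simps)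
      finally have "(1 - u) * S * S = 1 - u\<^sup>2" .
      thus ?thesis using S by (simp add: eq_divide_eq)
    qed
    show ?thesis
      unfolding a b using W_integrand_form[OF D R S, of "- 1 - 3 * u" "1 - u\<^sup>2" "1 - 2 * x" x]
      by (simp only: mult.commute[of "- x / (2 * R)" D] power2_eq_square)
  qed
  finally show ?thesis
    by (simp add: W_integrand_def[abs_def] W_integrand'_def x_def D_def R_def S_def)
qed

lemma W_primitive_deriv:
  assumes u: "\<bar>u\<bar> < 1"
  shows "(W_primitive u has_real_derivative
           W_integrand' u t + 1 / (2 * sqrt (1 + u)) * ((sin t)\<^sup>2 / sqrt (1 - u * (sin t)\<^sup>2))) (at t)"
proof -
  define x where "x = (sin t)\<^sup>2"
  define D where "D = 1 + u - 2 * u * x"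
  define R where "R = sqrt (1 - u * x)"
  define S where "S = sqrt (1 + u)"
  define g where "g = - (3 + u) / 2 + u * x"
  define p where "p = sin t * cos t"
  have D: "D > 0" using W_denominator_pos[OF u, of t] by (simp add: D_def x_def)
  have R: "R > 0" using Delta_pos[of u t] u by (simp add: R_def x_def)
  have S: "S > 0" using u by (simp add: S_def)
  have R2: "R\<^sup>2 = 1 - u * x"
    unfolding R_def by (rule real_sqrt_pow2) (use Delta_pos[of u t] u in \<open>auto simp: x_def intro: less_imp_le\<close>)
  have c2: "cos t * cos t = 1 - x" using cos_squared_eq[of t] by (simp add: x_def power2_eq_square)
  have s2: "sin t * sin t = x" by (simp add: x_def power2_eq_square)
  have p2: "p * p = x * (1 - x)" 
  proof -
    have "p * p = (sin t * sin t) * (cos t * cos t)" by (simp only: p_def mult_ac)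
    thus ?thesis by (simp only: s2 c2)
  qed
  have dx: "((\<lambda>t. (sin t)\<^sup>2) has_real_derivative 2 * p) (at t)"
    using DERIV_power[OF DERIV_sin[of t], of 2] by (simp add: p_def mult.commute)
  have dp: "((\<lambda>t. sin t * cos t) has_real_derivative 1 - 2 * x) (at t)"
    using DERIV_mult[OF DERIV_sin[of t] DERIV_cos[of t]] c2 s2 by simp
  have du: "((\<lambda>t. c + a * (sin t)\<^sup>2) has_real_derivative a * (2 * p)) (at t)" for a c
    using DERIV_add[OF DERIV_const DERIV_cmult[OF dx, of a]] by simp
  have dR: "((\<lambda>t. sqrt (1 - u * (sin t)\<^sup>2)) has_real_derivative - (u * p / R)) (at t)"
  proof -
    have "((\<lambda>t. 1 - u * (sin t)\<^sup>2) has_real_derivative - (u * (2 * p))) (at t)"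
      using du[of 1 "- u"] by simp
    moreover have "(sqrt has_real_derivative inverse R / 2) (at (1 - u * (sin t)\<^sup>2))"
      unfolding R_def x_def by (rule DERIV_real_sqrt) (use Delta_pos[of u t] u in auto)
    moreover have "inverse R / 2 * - (u * (2 * p)) = - (u * p / R)" by (simp add: inverse_eq_divide)
    ultimately show ?thesis
      using DERIV_chain2[of sqrt "inverse R / 2" "\<lambda>t. 1 - u * (sin t)\<^sup>2" t "- (u * (2 * p))"] by (simp only:)
  qed
  have dg: "((\<lambda>t. - (3 + u) / 2 + u * (sin t)\<^sup>2) has_real_derivative u * (2 * p)) (at t)" by (rule du)
  have dD: "((\<lambda>t. 1 + u - 2 * u * (sin t)\<^sup>2) has_real_derivative - (4 * u * p)) (at t)"
    using du[of "1 + u" "- (2 * u)"] by (simp add: mult.assoc)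
  have nz: "sqrt (1 - u * (sin t)\<^sup>2) * (1 + u - 2 * u * (sin t)\<^sup>2) \<noteq> 0"
    using D R by (simp add: D_def R_def x_def)
  from DERIV_cdivide[OF DERIV_divide[OF DERIV_mult[OF dp dg] DERIV_mult[OF dR dD] nz], of S]
  have "(W_primitive u has_real_derivative
     (((1 - 2 * x) * g + u * (2 * p) * p) * (R * D) - p * g * (- (u * p / R) * D + - (4 * u * p) * R)) / (R * D * (R * D)) / S) (at t)"
    unfolding W_primitive_def[abs_def] by (simp only: D_def R_def g_def x_def p_def S_def)
  also have "(((1 - 2 * x) * g + u * (2 * p) * p) * (R * D) - p * g * (- (u * p / R) * D + - (4 * u * p) * R)) / (R * D * (R * D))
     = (((1 - 2 * x) * g + 2 * u * (p * p)) * (R * D) + g * (u * (p * p) / R * D + R * (4 * u * (p * p)))) / (R * D)\<^sup>2"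
    by (simp add: power2_eq_square algebra_simps)
  also have "\<dots> = (- 1 - 3 * u) / (2 * D * R) - (1 - u\<^sup>2) * (1 - 2 * x) / (D\<^sup>2 * R) + (1 - u\<^sup>2) * x / (2 * D * R ^ 3)
     + x / (2 * R)"
    by (rule W_primitive_form[OF D R]) (unfold p2 R2 D_def g_def, rule W_derivative_identity)
  also have "(T + x / (2 * R)) / S = T / S + 1 / (2 * S) * (x / R)" for T
    by (simp add: add_divide_distrib mult.commute)
  finally show ?thesis
    unfolding W_integrand'_def by (simp only: x_def D_def R_def S_def)
qed

lemma W_nonzero:
  fixes u t :: real
  assumes "\<bar>u\<bar> < 1"
  shows "1 + u - 2 * u * (sin t)\<^sup>2 \<noteq> 0" "sqrt (1 - u * (sin t)\<^sup>2) \<noteq> 0" "sqrt (1 + u) \<noteq> 0"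
proof -
  show "1 + u - 2 * u * (sin t)\<^sup>2 \<noteq> 0" using W_denominator_pos[OF assms, of t] by linarith
  have "u < 1" using assms by linarith
  from Delta_nonzero[OF this] show "sqrt (1 - u * (sin t)\<^sup>2) \<noteq> 0"
    by (simp only: real_sqrt_eq_0_iff simp_thms)
  show "sqrt (1 + u) \<noteq> 0" using assms by auto
qed

lemma W_integrand_continuous:
  assumes "\<bar>u\<bar> < 1"
  shows "continuous_on A (W_integrand u)"
  unfolding W_integrand_def[abs_def]
  by (intro continuous_intros ballI) (simp only: mult_eq_0_iff W_nonzero[OF assms] simp_thms)

lemma W_integrand'_continuous:
  "continuous_on ({-1<..<1} \<times> A) (\<lambda>(x, t). W_integrand' x t)"
proof -
  have two: "(2::real) \<noteq> 0" by simp
  have nzp: "1 + fst p - 2 * fst p * (sin (snd p))\<^sup>2 \<noteq> 0" "sqrt (1 - fst p * (sin (snd p))\<^sup>2) \<noteq> 0" "sqrt (1 + fst p) \<noteq> 0"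
    if "p \<in> {-1<..<1} \<times> A" for p
  proof -
    have "\<bar>fst p\<bar> < 1" using that by (cases p) auto
    from W_nonzero[OF this] show "1 + fst p - 2 * fst p * (sin (snd p))\<^sup>2 \<noteq> 0"
      "sqrt (1 - fst p * (sin (snd p))\<^sup>2) \<noteq> 0" "sqrt (1 + fst p) \<noteq> 0" .
  qed
  show ?thesis
    unfolding W_integrand'_def case_prod_unfold
    by (intro continuous_intros ballI)
       (simp_all only: mult_eq_0_iff power_eq_0_iff nzp two simp_thms)
qed

lemma Wfun_leibniz:
  assumes u: "\<bar>u\<bar> < 1"
  shows "(Wfun has_real_derivative integral {0..pi/2} (W_integrand' u)) (at u)"
proof -
  have "((\<lambda>u. integral (cbox 0 (pi/2)) (W_integrand u)) has_field_derivative
          integral (cbox 0 (pi/2)) (W_integrand' u)) (at u within {-1<..<1})"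
  proof (rule leibniz_rule_field_derivative)
    fix x t :: real assume "x \<in> {-1<..<1}"
    hence x: "\<bar>x\<bar> < 1" by auto
    show "((\<lambda>x. W_integrand x t) has_field_derivative W_integrand' x t) (at x within {-1<..<1})"
      by (rule has_field_derivative_at_within[OF W_integrand_deriv[OF x]])
  next
    fix x :: real assume "x \<in> {-1<..<1}"
    hence x: "\<bar>x\<bar> < 1" by auto
    show "W_integrand x integrable_on cbox 0 (pi/2)"
      by (rule integrable_continuous[OF W_integrand_continuous[OF x]])
  next
    show "continuous_on ({-1<..<1} \<times> cbox 0 (pi/2)) (\<lambda>(x, t). W_integrand' x t)"
      by (rule W_integrand'_continuous)
    show "u \<in> {-1<..<1}" using u by auto
    show "convex {-1<..<1::real}" by simp
  qed
  moreover have "at u within {-1<..<1} = at u" using u by (intro at_within_open) auto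
  ultimately show ?thesis
    unfolding Wfun_def[abs_def] by (simp only: cbox_interval)
qed

lemma Wfun_has_derivative:
  assumes u: "\<bar>u\<bar> < 1"
  shows "(Wfun has_real_derivative - (pi / 8) * hF 1 u / sqrt (1 + u)) (at u)"
proof -
  note Wfun_leibniz[OF u]
  also have "integral {0..pi/2} (W_integrand' u) = - (pi / 8) * hF 1 u / sqrt (1 + u)"
  proof -
    have "((\<lambda>t. W_integrand' u t + 1 / (2 * sqrt (1 + u)) * ((sin t)\<^sup>2 / sqrt (1 - u * (sin t)\<^sup>2))) has_integral
      W_primitive u (pi/2) - W_primitive u 0) {0..pi/2}"
      by (rule fundamental_theorem_of_calculus)
         (simp_all only: has_real_derivative_iff_has_vector_derivative[symmetric]
            has_field_derivative_at_within[OF W_primitive_deriv[OF u]] pi_half_ge_zero)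
    \<comment> \<open>\<open>W_primitive\<close> contains the factor \<open>sin t * cos t\<close>
      and so vanishes at both ends.\<close>
    hence 1: "((\<lambda>t. W_integrand' u t + 1 / (2 * sqrt (1 + u)) * ((sin t)\<^sup>2 / sqrt (1 - u * (sin t)\<^sup>2))) has_integral 0) {0..pi/2}"
      by (simp add: W_primitive_def)
    have "continuous_on {0..pi/2} (\<lambda>t. (sin t)\<^sup>2 / sqrt (1 - u * (sin t)\<^sup>2))"
      by (intro continuous_intros ballI W_nonzero[OF u])
    hence "((\<lambda>t. (sin t)\<^sup>2 / sqrt (1 - u * (sin t)\<^sup>2)) has_integral pi / 4 * hF 1 u) {0..pi/2}"
      using integral_sin2_series[OF u] integrable_integral[OF integrable_continuous_real] by metis
    from has_integral_diff[OF 1 has_integral_mult_right[OF this, of "1 / (2 * sqrt (1 + u))"]]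
    have "(W_integrand' u has_integral 0 - 1 / (2 * sqrt (1 + u)) * (pi / 4 * hF 1 u)) {0..pi/2}"
      by simp
    thus ?thesis by (simp add: integral_unique)
  qed
  finally show ?thesis .
qed

lemma Wfun_0: "Wfun 0 = pi / 2"
  by (simp add: Wfun_def W_integrand_def[abs_def])

lemma ellipticPi_mu:
  assumes "\<bar>k\<bar> < 1"
  shows "ellipticPi (mu k) k = sqrt (1 + k\<^sup>2) / (1 - k\<^sup>2) * Wfun (k\<^sup>2)"
proof -
  have k: "k\<^sup>2 < 1" by (rule ksq_less_1[OF assms])
  have p: "1 + k\<^sup>2 > 0" by (simp add: add_pos_nonneg)
  have m: "mu k < 1" using k p by (simp add: mu_def)
  have S: "sqrt (1 + k\<^sup>2) * sqrt (1 + k\<^sup>2) = 1 + k\<^sup>2" using p by simp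
  have "ellipticPi (mu k) k = integral {0..pi/2} (\<lambda>t. sqrt (1 + k\<^sup>2) / (1 - k\<^sup>2) * W_integrand (k\<^sup>2) t)"
    unfolding ellipticPi_trig[OF assms m]
  proof (rule integral_cong)
    fix t :: real
    define x where "x = (sin t)\<^sup>2"
    have "1 - mu k * x = (1 + k\<^sup>2 - 2 * k\<^sup>2 * x) / (1 + k\<^sup>2)"
      using p by (simp add: mu_def field_simps)
    moreover have "sqrt (1 + k\<^sup>2) / (1 - k\<^sup>2) * ((1 - k\<^sup>2) * sqrt (1 + k\<^sup>2)) = 1 + k\<^sup>2"
      using k S by simp
    ultimately show "1 / ((1 - mu k * (sin t)\<^sup>2) * sqrt (1 - k\<^sup>2 * (sin t)\<^sup>2)) =
         sqrt (1 + k\<^sup>2) / (1 - k\<^sup>2) * W_integrand (k\<^sup>2) t"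
      unfolding W_integrand_def x_def[symmetric] by (simp only: times_divide_eq_right) simp
  qed
  also have "\<dots> = sqrt (1 + k\<^sup>2) / (1 - k\<^sup>2) * Wfun (k\<^sup>2)"
    unfolding Wfun_def by (rule integral_mult_right)
  finally show ?thesis .
qed

section \<open>Complex extensions and the elimination identity\<close>

text \<open>The imaginary part of G is constantly zero on the axis, so the complex derivative is
  real there. This carries derivatives from the holomorphic extensions to the real
  functions.\<close>

lemma real_axis_deriv:
  assumes G: "(G has_field_derivative D) (at (complex_of_real x))"
    and e: "0 < e" "\<And>t. \<bar>t - x\<bar> < e \<Longrightarrow> G (of_real t) = of_real (h t)"
  shows "(h has_real_derivative Re D) (at x)" "D = of_real (Re D)"
proof -
  have v: "((\<lambda>t. G (of_real t)) has_vector_derivative D) (at x)"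
    by (rule has_vector_derivative_real_field[OF G])
  have ev: "t \<in> ball x e \<Longrightarrow> \<bar>t - x\<bar> < e" for t by (simp add: dist_real_def abs_minus_commute)
  have "((\<lambda>t. Re (G (of_real t))) has_real_derivative Re D) (at x)"
    using bounded_linear.has_vector_derivative[OF bounded_linear_Re v]
    by (simp add: has_real_derivative_iff_has_vector_derivative)
  thus "(h has_real_derivative Re D) (at x)"
    by (rule has_field_derivative_transform_within_open[of _ _ _ "ball x e"]) (use e ev in auto)
  have "((\<lambda>t. Im (G (of_real t))) has_real_derivative Im D) (at x)"
    using bounded_linear.has_vector_derivative[OF bounded_linear_Im v]
    by (simp add: has_real_derivative_iff_has_vector_derivative)
  hence "((\<lambda>t. 0) has_real_derivative Im D) (at x)"
    by (rule has_field_derivative_transform_within_open[of _ _ _ "ball x e"]) (use e ev in auto)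
  hence "Im D = 0" using DERIV_const[of 0 "at x"] DERIV_unique by blast
  thus "D = of_real (Re D)" by (simp add: complex_eq_iff)
qed

lemma one_plus_notin_nonpos: "norm (z::complex) < 1 \<Longrightarrow> 1 + z \<notin> \<real>\<^sub>\<le>\<^sub>0"
proof
  assume z: "norm z < 1" "1 + z \<in> \<real>\<^sub>\<le>\<^sub>0"
  hence "Re (1 + z) \<le> 0" by (simp add: complex_nonpos_Reals_iff)
  thus False using z(1) complex_Re_le_cmod[of "-z"] by simp
qed

lemma one_plus_nonzero: "norm (z::complex) < 1 \<Longrightarrow> 1 + z \<noteq> 0"
  using one_plus_notin_nonpos[of z] by auto

lemma one_minus_nonzero: "norm (z::complex) < 1 \<Longrightarrow> 1 - z \<noteq> 0"
  by auto

text \<open>The extension of \<open>Wfun\<close> is chosen as a primitive of its known derivative,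
  normalized at 0, instead of a parameter integral over complex u; agreement on the real axis then
  follows by comparing derivatives.\<close>

definition Wc :: "complex \<Rightarrow> complex" where
  "Wc = (SOME g. g 0 = of_real (pi / 2) \<and>
     (\<forall>z\<in>ball 0 1. (g has_field_derivative - (of_real pi / 8) * hF 1 z / csqrt (1 + z)) (at z)))"

lemma Wc: "Wc 0 = of_real (pi / 2)"
  "norm z < 1 \<Longrightarrow> (Wc has_field_derivative - (of_real pi / 8) * hF 1 z / csqrt (1 + z)) (at z)"
proof -
  have "(\<lambda>z. - (of_real pi / 8) * hF 1 z / csqrt (1 + z)) holomorphic_on ball 0 1"
    by (intro holomorphic_intros hF_holomorphic) (auto dest: one_plus_notin_nonpos one_plus_nonzero)
  then obtain g where g: "\<And>z. z \<in> ball 0 1 \<Longrightarrow>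
      (g has_field_derivative - (of_real pi / 8) * hF 1 z / csqrt (1 + z)) (at z within ball 0 1)"
    using holomorphic_convex_primitive'[OF convex_ball open_ball] by blast
  have "\<exists>g. g 0 = of_real (pi / 2) \<and>
     (\<forall>z\<in>ball 0 1. (g has_field_derivative - (of_real pi / 8) * hF 1 z / csqrt (1 + z)) (at z))"
  proof (intro exI[of _ "\<lambda>z. g z - g 0 + of_real (pi / 2)"] conjI ballI)
    fix z :: complex assume z: "z \<in> ball 0 1"
    have "(g has_field_derivative - (of_real pi / 8) * hF 1 z / csqrt (1 + z)) (at z)"
      using g[OF z] at_within_open[OF z open_ball] by simp
    from DERIV_add[OF DERIV_diff[OF this DERIV_const] DERIV_const]
    show "((\<lambda>z. g z - g 0 + of_real (pi / 2)) has_field_derivative - (of_real pi / 8) * hF 1 z / csqrt (1 + z)) (at z)"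
      by simp
  qed simp
  from someI_ex[OF this] show "Wc 0 = of_real (pi / 2)"
    "norm z < 1 \<Longrightarrow> (Wc has_field_derivative - (of_real pi / 8) * hF 1 z / csqrt (1 + z)) (at z)"
    unfolding Wc_def by auto
qed

lemma holomorphic_on_ball_derivI:
  assumes "\<And>z. norm z < 1 \<Longrightarrow> (f has_field_derivative f' z) (at z)"
  shows "f holomorphic_on ball 0 1"
proof (rule holomorphic_onI)
  fix z :: complex assume "z \<in> ball 0 1"
  hence "(f has_field_derivative f' z) (at z)" using assms by simp
  thus "f field_differentiable at z within ball 0 1"
    unfolding field_differentiable_def by (blast intro: has_field_derivative_at_within)
qed

lemma csqrt_one_plus_of_real: "-1 < u \<Longrightarrow> csqrt (1 + of_real u) = of_real (sqrt (1 + u))"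
  using csqrt_of_real[of "1 + u"] by simp

lemma Wc_of_real:
  assumes "\<bar>u\<bar> < 1"
  shows "Wc (of_real u) = of_real (Wfun u)"
proof -
  have "((\<lambda>t. Wc (of_real t) - of_real (Wfun t)) has_vector_derivative 0) (at t within {-1<..<1})"
    if t: "t \<in> {-1<..<1}" for t
  proof -
    have t1: "\<bar>t\<bar> < 1" using t by auto
    define D where "D = - (pi / 8) * hF 1 t / sqrt (1 + t)"
    have "- (of_real pi / 8) * hF 1 (complex_of_real t) / csqrt (1 + of_real t) = of_real D"
      using t csqrt_one_plus_of_real[of t] hF_of_real[OF t1, of 1, where 'a = complex] by (simp add: D_def)
    hence "(Wc has_field_derivative of_real D) (at (of_real t))" using Wc(2)[of "of_real t"] t1 by simp
    hence 1: "((\<lambda>t. Wc (of_real t)) has_vector_derivative of_real D) (at t within {-1<..<1})"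
      by (rule has_vector_derivative_real_field)
    have "(Wfun has_vector_derivative D) (at t within {-1<..<1})"
      using has_field_derivative_at_within[OF Wfun_has_derivative[OF t1]] unfolding D_def
      by (simp only: has_real_derivative_iff_has_vector_derivative)
    from bounded_linear.has_vector_derivative[OF bounded_linear_of_real this]
    have "((\<lambda>t. complex_of_real (Wfun t)) has_vector_derivative of_real D) (at t within {-1<..<1})" .
    from has_vector_derivative_diff[OF 1 this] show ?thesis by simp
  qed
  then obtain c where c: "\<And>t. t \<in> {-1<..<1} \<Longrightarrow> Wc (of_real t) - of_real (Wfun t) = c"
    using has_vector_derivative_zero_constant[of "{-1<..<1::real}" "\<lambda>t. Wc (of_real t) - of_real (Wfun t)"] by auto
  have "c = 0" using c[of 0] Wc(1) Wfun_0 by simp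
  thus ?thesis using c[of u] assms by (auto simp: abs_less_iff)
qed

section \<open>Extensions of the three integrals and their derivatives\<close>

definition wc :: "complex \<Rightarrow> complex" where "wc z = (1 - z\<^sup>2) / csqrt (1 + z\<^sup>2)"

definition Pic :: "complex \<Rightarrow> complex" where "Pic z = Wc (z\<^sup>2) / wc z"

definition Kc :: "complex \<Rightarrow> complex" where "Kc z = of_real (pi / 2) * hF 0 (z\<^sup>2)"

definition Ec :: "complex \<Rightarrow> complex" where
  "Ec z = of_real (pi / 2) * (hF 0 (z\<^sup>2) - z\<^sup>2 / 2 * hF 1 (z\<^sup>2))"

definition Ic :: "real poly \<Rightarrow> real poly \<Rightarrow> real poly \<Rightarrow> complex \<Rightarrow> complex" where
  "Ic p q r z = poly (cpoly p) z * Kc z + poly (cpoly q) z * Ec z + poly (cpoly r) z * Pic z"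

lemma wc_nonzero: "norm z < 1 \<Longrightarrow> wc z \<noteq> 0"
  using norm_power2_less_1[of z] one_plus_nonzero[of "z\<^sup>2"] one_minus_nonzero[of "z\<^sup>2"] by (simp add: wc_def)

lemma wc_has_derivative:
  assumes "norm z < 1"
  shows "(wc has_field_derivative - (z * (3 + z\<^sup>2) / (1 - z ^ 4) * wc z)) (at z)"
proof -
  note z2 = norm_power2_less_1[OF assms]
  define S where "S = csqrt (1 + z\<^sup>2)"
  have S2: "S * S = 1 + z\<^sup>2" using power2_csqrt[of "1 + z\<^sup>2"] by (simp add: S_def power2_eq_square)
  have S: "S \<noteq> 0" using one_plus_nonzero[OF z2] by (simp add: S_def)
  have d2: "((\<lambda>z. z\<^sup>2) has_field_derivative 2 * z) (at z)"
    using DERIV_power[OF DERIV_ident, of 2] by simp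
  have dS: "((\<lambda>z. csqrt (1 + z\<^sup>2)) has_field_derivative z / S) (at z)"
  proof -
    have "((\<lambda>z. 1 + z\<^sup>2) has_field_derivative 2 * z) (at z)" using DERIV_add[OF DERIV_const d2] by simp
    from has_field_derivative_csqrt'[OF this one_plus_notin_nonpos[OF z2]] show ?thesis by (simp add: S_def)
  qed
  have dn: "((\<lambda>z. 1 - z\<^sup>2) has_field_derivative - (2 * z)) (at z)" using DERIV_diff[OF DERIV_const d2] by simp
  have "csqrt (1 + z\<^sup>2) \<noteq> 0" using S by (simp add: S_def)
  from DERIV_divide[OF dn dS this]
  have "(wc has_field_derivative (- (2 * z) * S - (1 - z\<^sup>2) * (z / S)) / (S * S)) (at z)"
    unfolding wc_def[abs_def] S_def .
  also have "(- (2 * z) * S - (1 - z\<^sup>2) * (z / S)) / (S * S) = - (z * (3 + z\<^sup>2)) / (S * (1 + z\<^sup>2))"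
  proof -
    have "(- (2 * z) * S - (1 - z\<^sup>2) * (z / S)) * S = - (2 * z) * (S * S) - (1 - z\<^sup>2) * z"
      using S by (simp add: algebra_simps)
    also have "\<dots> = - (z * (3 + z\<^sup>2))" unfolding S2 by (simp add: algebra_simps)
    finally have "- (2 * z) * S - (1 - z\<^sup>2) * (z / S) = - (z * (3 + z\<^sup>2)) / S"
      by (rule iffD2[OF nonzero_eq_divide_eq[OF S]])
    thus ?thesis unfolding S2 by (simp add: mult.commute)
  qed
  also have "\<dots> = - (z * (3 + z\<^sup>2) / (1 - z ^ 4) * wc z)"
  proof -
    have "1 - z ^ 4 = (1 - z\<^sup>2) * (1 + z\<^sup>2)" by (simp add: algebra_simps power2_eq_square eval_nat_numeral)
    thus ?thesis unfolding wc_def S_def[symmetric] using one_minus_nonzero[OF z2] by simp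
  qed
  finally show ?thesis .
qed

lemma hF_sq_derivs:
  fixes z :: complex
  assumes "norm z < 1"
  shows "((\<lambda>z. hF 0 (z\<^sup>2)) has_field_derivative 2 * z * ((hF 0 (z\<^sup>2) / 2 - hF 1 (z\<^sup>2) / 4) / (1 - z\<^sup>2))) (at z)"
    and "((\<lambda>z. z\<^sup>2 * hF 1 (z\<^sup>2)) has_field_derivative 2 * z * ((hF 0 (z\<^sup>2) - z\<^sup>2 * hF 1 (z\<^sup>2) / 2) / (1 - z\<^sup>2))) (at z)"
    and "((\<lambda>z. Wc (z\<^sup>2)) has_field_derivative 2 * z * (- (of_real pi / 8) * hF 1 (z\<^sup>2) / csqrt (1 + z\<^sup>2))) (at z)"
proof -
  note z2 = norm_power2_less_1[OF assms]
  have d2: "((\<lambda>z. z\<^sup>2) has_field_derivative 2 * z) (at z)"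
    using DERIV_power[OF DERIV_ident, of 2] by simp
  from DERIV_chain2[OF hF_zero_has_derivative[OF z2] d2]
  show "((\<lambda>z. hF 0 (z\<^sup>2)) has_field_derivative 2 * z * ((hF 0 (z\<^sup>2) / 2 - hF 1 (z\<^sup>2) / 4) / (1 - z\<^sup>2))) (at z)"
    by (simp only: mult.commute)
  from DERIV_chain2[OF id_times_hF_one_has_derivative[OF z2] d2]
  show "((\<lambda>z. z\<^sup>2 * hF 1 (z\<^sup>2)) has_field_derivative 2 * z * ((hF 0 (z\<^sup>2) - z\<^sup>2 * hF 1 (z\<^sup>2) / 2) / (1 - z\<^sup>2))) (at z)"
    by (simp only: mult.commute)
  from DERIV_chain2[OF Wc(2)[OF z2] d2]
  show "((\<lambda>z. Wc (z\<^sup>2)) has_field_derivative 2 * z * (- (of_real pi / 8) * hF 1 (z\<^sup>2) / csqrt (1 + z\<^sup>2))) (at z)"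
    by (simp only: mult.commute)
qed

lemma Kc_has_derivative:
  assumes "norm z < 1"
  shows "(Kc has_field_derivative of_real (pi / 2) * (z * (hF 0 (z\<^sup>2) - hF 1 (z\<^sup>2) / 2) / (1 - z\<^sup>2))) (at z)"
proof -
  have eq: "2 * z * ((a / 2 - b / 4) / s) = z * (a - b / 2) / s" for a b s :: complex
    by (simp add: algebra_simps)
  show ?thesis
    using DERIV_cmult[OF hF_sq_derivs(1)[OF assms], of "of_real (pi / 2)"] unfolding Kc_def[abs_def] eq .
qed

lemma Ec_has_derivative:
  assumes "norm z < 1"
  shows "(Ec has_field_derivative of_real (pi / 2) * (- (z * hF 1 (z\<^sup>2) / 2))) (at z)"
proof -
  define a b u where "a = hF 0 (z\<^sup>2)" and "b = hF 1 (z\<^sup>2)" and "u = z\<^sup>2"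
  have u: "1 - u \<noteq> 0" unfolding u_def by (rule one_minus_nonzero[OF norm_power2_less_1[OF assms]])
  have "Ec = (\<lambda>z. of_real (pi / 2) * (hF 0 (z\<^sup>2) - z\<^sup>2 * hF 1 (z\<^sup>2) / 2))"
    by (auto simp: Ec_def fun_eq_iff)
  moreover have "2 * z * ((a / 2 - b / 4) / (1 - u)) - 2 * z * ((a - u * b / 2) / (1 - u)) / 2 = - (z * b / 2)"
  proof -
    have "2 * z * (A / d) - 2 * z * (B / d) / 2 = (2 * z * A - z * B) / d" for A B d
      by (simp add: diff_divide_distrib)
    hence "2 * z * ((a / 2 - b / 4) / (1 - u)) - 2 * z * ((a - u * b / 2) / (1 - u)) / 2
       = (2 * z * (a / 2 - b / 4) - z * (a - u * b / 2)) / (1 - u)" .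
    also have "2 * z * (a / 2 - b / 4) - z * (a - u * b / 2) = - (z * b / 2) * (1 - u)"
      by (simp add: field_simps)
    also have "- (z * b / 2) * (1 - u) / (1 - u) = - (z * b / 2)"
      by (rule nonzero_mult_div_cancel_right[OF u])
    finally show ?thesis .
  qed
  ultimately show ?thesis
    using DERIV_cmult[OF DERIV_diff[OF hF_sq_derivs(1)[OF assms] DERIV_cdivide[OF hF_sq_derivs(2)[OF assms], of 2]], of "of_real (pi / 2)"]
    unfolding a_def b_def u_def by simp
qed

text \<open>The coefficient of \<open>Pic\<close> is minus the logarithmic derivative of
  \<open>wc\<close>, so the derivative of \<open>wc * Pic\<close> is free of
  \<open>Pic\<close>.\<close>

lemma Pic_has_derivative:
  assumes "norm z < 1"
  shows "(Pic has_field_derivative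
     z * (3 + z\<^sup>2) / (1 - z ^ 4) * Pic z - of_real (pi / 4) * z * hF 1 (z\<^sup>2) / (1 - z\<^sup>2)) (at z)"
proof -
  note z2 = norm_power2_less_1[OF assms]
  define S where "S = csqrt (1 + z\<^sup>2)"
  have S: "S \<noteq> 0" using one_plus_nonzero[OF z2] by (simp add: S_def)
  note w = wc_nonzero[OF assms]
  define b W c where "b = hF 1 (z\<^sup>2)" and "W = Wc (z\<^sup>2)" and "c = z * (3 + z\<^sup>2) / (1 - z ^ 4)"
  have "(Pic has_field_derivative
     (2 * z * (- (of_real pi / 8) * b / S) * wc z - W * (- (c * wc z))) / (wc z * wc z)) (at z)"
    unfolding Pic_def[abs_def] b_def S_def W_def c_def
    by (rule DERIV_divide[OF hF_sq_derivs(3)[OF assms] wc_has_derivative[OF assms] w])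
  also have "(2 * z * (- (of_real pi / 8) * b / S) * wc z - W * (- (c * wc z))) / (wc z * wc z)
    = c * (W / wc z) + 2 * z * (- (of_real pi / 8) * b / (S * wc z))"
    using w S by (simp add: field_simps)
  also have "S * wc z = 1 - z\<^sup>2" using S by (simp add: wc_def S_def)
  also have "2 * z * (- (of_real pi / 8) * b / s) = - (of_real (pi / 4) * z * b / s)" for s
    by (cases "s = 0") (simp_all add: field_simps)
  also have "W / wc z = Pic z" by (simp add: Pic_def W_def)
  finally show ?thesis unfolding b_def c_def by (simp only: diff_conv_add_uminus)
qed

lemma Ic_holomorphic: "Ic p q r holomorphic_on ball 0 1"
  unfolding Ic_def[abs_def]
  by (intro holomorphic_intros holomorphic_on_ball_derivI[OF Kc_has_derivative]
      holomorphic_on_ball_derivI[OF Ec_has_derivative] holomorphic_on_ball_derivI[OF Pic_has_derivative])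

lemma Ic_of_real:
  assumes "\<bar>x\<bar> < 1"
  shows "Ic p q r (of_real x) = of_real (elliptic_comb p q r x)"
proof -
  have x2: "\<bar>x\<^sup>2\<bar> < 1" using ksq_less_1[OF assms] by simp
  have h: "hF n ((complex_of_real x)\<^sup>2) = of_real (hF n (x\<^sup>2))" for n
    using hF_of_real[OF x2, of n, where 'a = complex] by simp
  have K: "Kc (of_real x) = of_real (ellipticK x)"
    unfolding Kc_def h ellipticK_series[OF assms] by simp
  have E: "Ec (of_real x) = of_real (ellipticE x)"
    unfolding Ec_def h ellipticE_series[OF assms] by simp
  have "csqrt (1 + (of_real x)\<^sup>2) = of_real (sqrt (1 + x\<^sup>2))"
    using csqrt_one_plus_of_real[of "x\<^sup>2"] zero_le_power2[of x] by simp
  moreover have "Wc ((of_real x)\<^sup>2) = of_real (Wfun (x\<^sup>2))" using Wc_of_real[OF x2] by simp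
  ultimately have "Pic (of_real x) = of_real (Wfun (x\<^sup>2)) / ((1 - (of_real x)\<^sup>2) / of_real (sqrt (1 + x\<^sup>2)))"
    unfolding Pic_def wc_def by (simp only:)
  also have "\<dots> = of_real (ellipticPi (mu x) x)"
    unfolding ellipticPi_mu[OF assms] by (simp add: mult.commute)
  finally have P: "Pic (of_real x) = of_real (ellipticPi (mu x) x)" .
  show ?thesis by (simp add: Ic_def elliptic_comb_def K E P poly_cpoly_of_real)
qed

text \<open>
  Up to the factor \<open>wc / (z (1 - z ^ 4) r\<^sup>2)\<close>, the derivative of \<open>wc * I / r\<close> is \<open>Pp K + Qp E\<close>; see
  \<open>elimination_identity\<close>.
\<close>

definition Pp :: "real poly \<Rightarrow> real poly \<Rightarrow> real poly \<Rightarrow> real poly" where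
  "Pp p q r = - ([:0, 0, 3, 0, 1:] * p * r) + [:0, 1, 0, 0, 0, -1:] * (pderiv p * r - p * pderiv r)
     - [:1, 0, 0, 0, -1:] * (p + q) * r - [:1, 0, 1:] * r * r"

definition Qp :: "real poly \<Rightarrow> real poly \<Rightarrow> real poly \<Rightarrow> real poly" where
  "Qp p q r = - ([:0, 0, 3, 0, 1:] * q * r) + [:0, 1, 0, 0, 0, -1:] * (pderiv q * r - q * pderiv r)
     + [:1, 0, 1:] * p * r + [:1, 0, 0, 0, -1:] * q * r + [:1, 0, 1:] * r * r"

lemma cpoly_uminus: "cpoly (- p) = - cpoly p"
  by (intro poly_eqI) (simp add: coeff_map_poly)

lemma elimination_identity:
  fixes z :: complex and p q r :: "real poly"
  assumes "norm z < 1"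
  defines "R \<equiv> poly (cpoly r) z" and "R' \<equiv> poly (cpoly (pderiv r)) z"
  shows "z * ((1 - z ^ 4) * (R * deriv (Ic p q r) z - R' * Ic p q r z) - z * (3 + z\<^sup>2) * R * Ic p q r z)
    = of_real (pi / 2) * Gc (Pp p q r + Qp p q r) (Qp p q r) z"
proof -
  note z2 = norm_power2_less_1[OF assms(1)]
  define a b c where "a = hF 0 (z\<^sup>2)" and "b = hF 1 (z\<^sup>2)" and "c = Pic z"
  define P Q P' Q' where "P = poly (cpoly p) z" and "Q = poly (cpoly q) z"
    and "P' = poly (cpoly (pderiv p)) z" and "Q' = poly (cpoly (pderiv q)) z"
  define h :: complex where "h = of_real (pi / 4)"
  have h: "of_real (pi / 2) = 2 * h" by (simp add: h_def)
  define n where "n = 1 + z\<^sup>2"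
  define s where "s = 1 - z\<^sup>2"
  have m: "1 - z ^ 4 = n * s" by (simp add: n_def s_def algebra_simps power2_eq_square eval_nat_numeral)
  have s0: "s \<noteq> 0" unfolding s_def by (rule one_minus_nonzero[OF z2])
  have n0: "n \<noteq> 0" unfolding n_def by (rule one_plus_nonzero[OF z2])
  have dp: "(poly (cpoly f) has_field_derivative poly (cpoly (pderiv f)) z) (at z)" for f
    unfolding cpoly_pderiv by (rule poly_DERIV)
  have "(Ic p q r has_field_derivative
     (P' * Kc z + of_real (pi / 2) * (z * (a - b / 2) / s) * P) + (Q' * Ec z + of_real (pi / 2) * (- (z * b / 2)) * Q)
      + (R' * c + (z * (3 + z\<^sup>2) / (1 - z ^ 4) * c - of_real (pi / 4) * z * b / s) * R)) (at z)"
    unfolding Ic_def[abs_def] a_def b_def c_def P_def Q_def P'_def Q'_def R_def R'_def s_def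
    by (intro DERIV_add DERIV_mult dp Kc_has_derivative Ec_has_derivative Pic_has_derivative assms(1))
  hence "deriv (Ic p q r) z = (P' * Kc z + of_real (pi / 2) * (z * (a - b / 2) / s) * P) + (Q' * Ec z + of_real (pi / 2) * (- (z * b / 2)) * Q)
      + (R' * c + (z * (3 + z\<^sup>2) / (1 - z ^ 4) * c - of_real (pi / 4) * z * b / s) * R)"
    by (rule DERIV_imp_deriv)
  also have "\<dots> = 2 * h * (P' * a + z * (a - b / 2) / s * P + Q' * (a - z\<^sup>2 * b / 2) - z * b / 2 * Q)
      + R' * c + (z * (3 + z\<^sup>2) / (n * s) * c - h * z * b / s) * R"
    unfolding m Kc_def Ec_def h a_def[symmetric] b_def[symmetric] h_def[symmetric] by (simp add: algebra_simps)
  finally have d0: "deriv (Ic p q r) z = 2 * h * (P' * a + z * (a - b / 2) / s * P + Q' * (a - z\<^sup>2 * b / 2) - z * b / 2 * Q)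
      + R' * c + (z * (3 + z\<^sup>2) / (n * s) * c - h * z * b / s) * R" .
  have d: "n * s * deriv (Ic p q r) z = h * (2 * n * s * P' * a + n * z * (2 * a - b) * P + n * s * Q' * (2 * a - z\<^sup>2 * b) - n * s * z * b * Q)
      + n * s * R' * c + (z * (3 + z\<^sup>2) * c - h * n * z * b) * R"
  proof -
    define e A B C where "e = b / 2" and "A = z * (a - e) / s" and "B = z * (3 + z\<^sup>2) / (n * s)" and "C = h * z * b / s"
    have e: "b = 2 * e" and A: "s * A = z * (a - e)" and B: "n * s * B = z * (3 + z\<^sup>2)" and C: "s * C = h * z * b"
      using s0 n0 by (simp_all add: e_def A_def B_def C_def)
    have "deriv (Ic p q r) z = 2 * h * (P' * a + A * P + Q' * (a - z\<^sup>2 * e) - z * e * Q) + R' * c + (B * c - C) * R"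
      unfolding d0 A_def B_def C_def by (simp add: e_def)
    thus ?thesis using e A B C by algebra
  qed
  have I: "Ic p q r z = h * (2 * P * a + Q * (2 * a - z\<^sup>2 * b)) + R * c"
    unfolding Ic_def Kc_def Ec_def h a_def b_def c_def P_def Q_def R_def by (simp add: algebra_simps)
  define w where "w = 3 + z\<^sup>2"
  have c1: "poly (cpoly [:1, 0, 1:]) z = n" "poly (cpoly [:0, 0, 3, 0, 1:]) z = z\<^sup>2 * w"
    by (simp_all add: cpoly_pCons n_def w_def power2_eq_square algebra_simps)
  have c2: "poly (cpoly [:1, 0, 0, 0, -1:]) z = n * s" "poly (cpoly [:0, 1, 0, 0, 0, -1:]) z = z * (n * s)"
    unfolding m[symmetric] by (simp_all add: cpoly_pCons eval_nat_numeral algebra_simps)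
  have q1: "poly (cpoly (Pp p q r)) z = - (z\<^sup>2 * w) * P * R + z * (n * s) * (P' * R - P * R') - (n * s) * (P + Q) * R - n * R * R"
    by (simp only: Pp_def P_def Q_def P'_def Q'_def R_def R'_def c1 c2 cpoly_add cpoly_diff cpoly_mult
        cpoly_uminus poly_add poly_diff poly_mult poly_minus mult_minus_left)
  have q2: "poly (cpoly (Qp p q r)) z = - (z\<^sup>2 * w) * Q * R + z * (n * s) * (Q' * R - Q * R') + n * P * R + (n * s) * Q * R + n * R * R"
    by (simp only: Qp_def P_def Q_def P'_def Q'_def R_def R'_def c1 c2 cpoly_add cpoly_diff cpoly_mult
        cpoly_uminus poly_add poly_diff poly_mult poly_minus mult_minus_left)
  \<comment> \<open>The coefficients of \<open>n * s * deriv I\<close> along \<open>h * a\<close>,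
    \<open>h * b\<close> and \<open>c\<close>. As the Pi coefficient of I is R, the difference
    \<open>R * (n * s * deriv I) - \<gamma> * I\<close> has no Pi term.\<close>
  define \<alpha> \<beta> \<gamma> where "\<alpha> = 2 * n * s * P' + 2 * n * z * P + 2 * n * s * Q'"
    and "\<beta> = - (n * z * P) - n * s * z\<^sup>2 * Q' - n * s * z * Q - n * z * R"
    and "\<gamma> = n * s * R' + z * w * R"
  have d': "n * s * deriv (Ic p q r) z = h * (a * \<alpha> + b * \<beta>) + c * \<gamma>"
    unfolding d \<alpha>_def \<beta>_def \<gamma>_def w_def by (simp add: algebra_simps)
  have I': "Ic p q r z = h * (a * (2 * P + 2 * Q) - b * (z\<^sup>2 * Q)) + c * R"
    unfolding I by (simp add: algebra_simps)
  have sz: "z\<^sup>2 = 1 - s" by (simp add: s_def)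
  have "z * (R * \<alpha> - \<gamma> * (2 * P + 2 * Q)) = - 2 * (z\<^sup>2 * w) * R * (P + Q)
      + 2 * z * (n * s) * ((P' + Q') * R - (P + Q) * R') + 2 * n * P * R * z\<^sup>2"
    unfolding \<alpha>_def \<gamma>_def power2_eq_square by (simp add: algebra_simps)
  \<comment> \<open>Writing \<open>z^2\<close> as \<open>1 - s\<close> splits this term into one
    part that comes from \<open>Qp\<close> and one that comes from \<open>Pp\<close>.\<close>
  also have "2 * n * P * R * z\<^sup>2 = 2 * n * P * R - 2 * n * s * P * R"
    unfolding sz by (simp add: algebra_simps)
  finally have A: "z * (R * \<alpha> - \<gamma> * (2 * P + 2 * Q)) = 2 * (poly (cpoly (Pp p q r)) z + poly (cpoly (Qp p q r)) z)"
    unfolding q1 q2 by (simp add: algebra_simps)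
  have B: "z * (R * \<beta> + \<gamma> * (z\<^sup>2 * Q)) = - (z\<^sup>2 * poly (cpoly (Qp p q r)) z)"
    unfolding q2 \<beta>_def \<gamma>_def power2_eq_square by (simp add: algebra_simps)
  have "z * ((1 - z ^ 4) * (R * deriv (Ic p q r) z - R' * Ic p q r z) - z * (3 + z\<^sup>2) * R * Ic p q r z)
    = z * (R * (n * s * deriv (Ic p q r) z) - \<gamma> * Ic p q r z)"
    unfolding m \<gamma>_def w_def by (simp add: algebra_simps)
  also have "\<dots> = h * (z * (R * \<alpha> - \<gamma> * (2 * P + 2 * Q)) * a + z * (R * \<beta> + \<gamma> * (z\<^sup>2 * Q)) * b)"
    unfolding d' I' by (simp add: algebra_simps)
  also have "\<dots> = h * ((2 * (poly (cpoly (Pp p q r)) z + poly (cpoly (Qp p q r)) z)) * a - z\<^sup>2 * poly (cpoly (Qp p q r)) z * b)"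
    unfolding A B by simp
  also have "\<dots> = of_real (pi / 2) * Gc (Pp p q r + Qp p q r) (Qp p q r) z"
    unfolding Gc_def h a_def b_def cpoly_add by (simp add: algebra_simps)
  finally show ?thesis .
qed

section \<open>The upper bound\<close>

lemma poly_real_zeros:
  assumes "p \<noteq> 0"
  shows "real_zeros_le (poly (cpoly p)) (degree p)"
proof (rule rouche_zero_count[where g = "\<lambda>_ _. 0" and H = "\<lambda>_ _. 1" and T = "\<lambda>_. cpoly p"])
  show "\<exists>w\<in>ball 0 1. poly (cpoly p) w \<noteq> 0"
  proof (rule ccontr)
    assume "\<not> ?thesis"
    hence "ball 0 1 \<subseteq> {w. poly (cpoly p) w = 0}" by auto
    hence "finite (ball (0::complex) 1)" using poly_roots_finite[of "cpoly p"] assms finite_subset by fastforce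
    thus False using uncountable_ball[of 1 "0::complex"] countable_finite by auto
  qed
  show "(\<Sum>z | norm z < 1 \<and> poly (cpoly p) z = 0. order z (cpoly p)) \<le> degree p"
    using sum_order_disc_le_degree[of "cpoly p"] assms by simp
  show "uniform_limit (sphere 0 r) (\<lambda>n x. 0) (\<lambda>_. 0) sequentially" for r :: real
    by (rule uniform_limit_const)
qed (use assms in \<open>auto intro!: holomorphic_intros\<close>)

lemma ord_ge_poly: "ord_ge (poly (cpoly r)) (of_real x) (order x r)"
proof -
  obtain s where s: "r = [:- x, 1:] ^ order x r * s"
    using order_1[of x r] by (auto simp: dvd_def)
  have pw: "cpoly ([:- x, 1:] ^ k) = [:- of_real x, 1:] ^ k" for k
    by (induction k) (simp_all only: power_0 power_Suc cpoly_mult, simp_all add: cpoly_pCons)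
  have "poly (cpoly r) w = (w - of_real x) ^ order x r * poly (cpoly s) w" for w
    by (subst s) (simp add: cpoly_mult pw poly_power)
  thus ?thesis by (intro ord_geI[of 1 "poly (cpoly s)"]) (auto intro!: holomorphic_intros)
qed

text \<open>A Wronskian loses only one of the n + k orders, so zeros of r raise the order of
  \<open>Fc\<close> too and pay for part of the gaps lost beside them. The hypothesis on n + k keeps
  the subtraction exact.\<close>

lemma ord_ge_wronskian:
  assumes f: "ord_ge f z n" and g: "ord_ge g z k" and nk: "n + k \<ge> 1" and z: "z \<in> ball 0 1"
    and hol: "A holomorphic_on ball 0 1" "B holomorphic_on ball 0 1"
    and F: "\<And>w. w \<in> ball 0 1 \<Longrightarrow> F w = A w * (g w * deriv f w - deriv g w * f w) + B w * g w * f w"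
  shows "ord_ge F z (n + k - 1)"
proof -
  obtain h r where h: "0 < r" "h holomorphic_on ball z r" "\<And>w. w \<in> ball z r \<Longrightarrow> f w = (w - z) ^ n * h w"
    using f unfolding ord_ge_def by blast
  obtain s t where s: "0 < t" "s holomorphic_on ball z t" "\<And>w. w \<in> ball z t \<Longrightarrow> g w = (w - z) ^ k * s w"
    using g unfolding ord_ge_def by blast
  obtain e where e: "e > 0" "ball z e \<subseteq> ball 0 1" using ball_in_disc[OF z] .
  define \<rho> where "\<rho> = min e (min r t)"
  have \<rho>: "\<rho> > 0" "ball z \<rho> \<subseteq> ball z r" "ball z \<rho> \<subseteq> ball z t" "ball z \<rho> \<subseteq> ball 0 1"
    using h s e by (auto simp: \<rho>_def)
  have dd: "deriv F w = of_nat m * (w - z) ^ (m - 1) * q w + (w - z) ^ m * deriv q w"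
    if "w \<in> ball z \<rho>" "q holomorphic_on ball z \<rho>" "\<And>w. w \<in> ball z \<rho> \<Longrightarrow> F w = (w - z) ^ m * q w" for F q m w
  proof -
    have "(q has_field_derivative deriv q w) (at w)"
      using that by (intro holomorphic_derivI[OF that(2) open_ball])
    moreover have "((\<lambda>w. (w - z) ^ m) has_field_derivative of_nat m * (w - z) ^ (m - 1)) (at w)"
      by (auto intro!: derivative_eq_intros)
    ultimately have "((\<lambda>w. (w - z) ^ m * q w) has_field_derivative
        of_nat m * (w - z) ^ (m - 1) * q w + deriv q w * (w - z) ^ m) (at w)"
      by (rule DERIV_mult[rotated])
    hence "(F has_field_derivative of_nat m * (w - z) ^ (m - 1) * q w + deriv q w * (w - z) ^ m) (at w)"
      by (rule has_field_derivative_transform_within_open[OF _ open_ball that(1)]) (use that(3) in simp)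
    thus ?thesis by (simp add: DERIV_imp_deriv mult.commute)
  qed
  have hh: "h holomorphic_on ball z \<rho>" "s holomorphic_on ball z \<rho>"
    using holomorphic_on_subset[OF h(2) \<rho>(2)] holomorphic_on_subset[OF s(2) \<rho>(3)] .
  define E where "E = n + k - 1"
  define H where "H = (\<lambda>w. A w * ((of_nat n - of_nat k) * h w * s w + (w - z) * (s w * deriv h w - deriv s w * h w))
      + (w - z) * B w * s w * h w)"
  show ?thesis
  proof (rule ord_geI[OF \<rho>(1)])
    show "H holomorphic_on ball z \<rho>"
      unfolding H_def
      by (intro holomorphic_intros hh holomorphic_deriv open_ball
          holomorphic_on_subset[OF hol(1) \<rho>(4)] holomorphic_on_subset[OF hol(2) \<rho>(4)])
    fix w assume w: "w \<in> ball z \<rho>"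
    define x where "x = w - z"
    have f1: "f w = x ^ n * h w" "g w = x ^ k * s w" using h(3) s(3) w \<rho> by (auto simp: x_def)
    have f2: "deriv f w = of_nat n * x ^ (n - 1) * h w + x ^ n * deriv h w"
      unfolding x_def by (rule dd[OF w hh(1)]) (use h(3) \<rho>(2) in blast)
    have f3: "deriv g w = of_nat k * x ^ (k - 1) * s w + x ^ k * deriv s w"
      unfolding x_def by (rule dd[OF w hh(2)]) (use s(3) \<rho>(3) in blast)
    \<comment> \<open>If n or k is 0, the exponent is truncated, but then the factor
      \<open>of_nat n\<close> or \<open>of_nat k\<close> is 0.\<close>
    have p1: "x ^ k * (of_nat n * x ^ (n - 1)) = of_nat n * x ^ E" "of_nat k * x ^ (k - 1) * x ^ n = of_nat k * x ^ E"
      unfolding E_def by (cases n; cases k; simp add: power_add mult_ac)+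
    have p2: "x ^ k * x ^ n = x * x ^ E"
    proof -
      have "k + n = Suc E" using nk by (simp add: E_def)
      thus ?thesis unfolding power_add[symmetric] by (simp only: power_Suc)
    qed
    have "g w * deriv f w - deriv g w * f w = (x ^ k * (of_nat n * x ^ (n - 1))) * (s w * h w)
        - (of_nat k * x ^ (k - 1) * x ^ n) * (s w * h w) + (x ^ k * x ^ n) * (s w * deriv h w - deriv s w * h w)"
      unfolding f1 f2 f3 by (simp add: algebra_simps)
    also have "\<dots> = x ^ E * ((of_nat n - of_nat k) * h w * s w + x * (s w * deriv h w - deriv s w * h w))"
      unfolding p1 p2 by (simp add: algebra_simps)
    finally have W: "g w * deriv f w - deriv g w * f w = \<dots>" .
    have "g w * f w = (x ^ k * x ^ n) * (s w * h w)" unfolding f1 by (simp add: mult_ac)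
    hence G: "g w * f w = x ^ E * (x * s w * h w)" unfolding p2 by (simp add: mult_ac)
    have "w \<in> ball 0 1" using w \<rho> by blast
    from F[OF this] have "F w = A w * (g w * deriv f w - deriv g w * f w) + B w * (g w * f w)" by simp
    also have "\<dots> = x ^ E * H w" unfolding W G H_def x_def[symmetric] by (simp add: algebra_simps)
    finally show "F w = (w - z) ^ (n + k - 1) * H w" by (simp add: x_def E_def)
  qed
qed

text \<open>M + l + 4 comes from the quintic times a Wronskian of degree at most M + l - 1 and from
  the quartics times products with r; 2l + 2 comes from the term with \<open>r * r\<close>, the
  trace of the derivative of the Pi integral.\<close>

lemma degree_Pp_Qp:
  assumes "degree p \<le> M" "degree q \<le> M" "degree r \<le> l"
  defines "d \<equiv> max (M + l + 4) (2 * l + 2)"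
  shows "degree (Pp p q r) \<le> d" "degree (Qp p q r) \<le> d"
proof -
  have mm: "degree (a * b) \<le> x + y" if "degree a \<le> x" "degree b \<le> y" for a b :: "real poly" and x y
    using degree_mult_le[of a b] that by linarith
  have c: "degree [:0, 0, 3, 0, 1 :: real:] \<le> 4" "degree [:1, 0, 0, 0, -1 :: real:] \<le> 4"
     "degree [:1, 0, 1 :: real:] \<le> 2" and c2: "degree [:1, 0, 1 :: real:] \<le> 4" by simp_all
  have dr: "degree ([:0, 1, 0, 0, 0, -1:] * (pderiv f * r - f * pderiv r)) \<le> M + l + 4" if f: "degree f \<le> M" for f
  proof (cases "pderiv f * r - f * pderiv r = 0")
    case False
    have "degree (pderiv f * r - f * pderiv r) \<le> M + l - 1"
    proof (rule degree_diff_le)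
      show "degree (pderiv f * r) \<le> M + l - 1"
      proof (cases "degree f = 0")
        case True
        hence "pderiv f = 0" by (simp add: pderiv_eq_0_iff)
        thus ?thesis by simp
      next
        case False
        thus ?thesis using mm[of "pderiv f" "degree f - 1" r l] f assms(3) by (simp add: degree_pderiv)
      qed
      show "degree (f * pderiv r) \<le> M + l - 1"
      proof (cases "degree r = 0")
        case True
        hence "pderiv r = 0" by (simp add: pderiv_eq_0_iff)
        thus ?thesis by simp
      next
        case False
        thus ?thesis using mm[of f M "pderiv r" "degree r - 1"] f assms(3) by (simp add: degree_pderiv)
      qed
    qed
    \<comment> \<open>Excludes truncation in M + l - 1: for constant polynomials the Wronskian is
      0.\<close>
    moreover have "M + l \<noteq> 0"
    proof
      assume "M + l = 0"
      hence "degree f = 0" "degree r = 0" using f assms(3) by auto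
      hence "pderiv f = 0" "pderiv r = 0" by (simp_all add: pderiv_eq_0_iff)
      thus False using False by simp
    qed
    moreover have "degree [:0, 1, 0, 0, 0, -1 :: real:] \<le> 5" by simp
    ultimately show ?thesis using mm[of "[:0, 1, 0, 0, 0, -1:]" 5 "pderiv f * r - f * pderiv r" "M + l - 1"] by linarith
  qed simp
  have t: "degree (c * f * r) \<le> M + l + 4" if "degree c \<le> 4" "degree f \<le> M" for c f :: "real poly"
    using mm[OF mm[OF that] assms(3)] by linarith
  have rr: "degree ([:1, 0, 1:] * r * r) \<le> 2 * l + 2"
    using mm[OF mm[OF c(3) assms(3)] assms(3)] by linarith
  have pq: "degree (p + q) \<le> M" using assms by (intro degree_add_le)
  show "degree (Pp p q r) \<le> d" unfolding Pp_def d_def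
    using t[OF c(1) assms(1)] dr[OF assms(1)] t[OF c(2) pq] rr
    by (intro degree_diff_le degree_add_le) (simp_all only: degree_minus le_max_iff_disj simp_thms)
  show "degree (Qp p q r) \<le> d" unfolding Qp_def d_def
    using t[OF c(1) assms(2)] dr[OF assms(2)] t[OF c2 assms(1)] t[OF c(2) assms(2)] rr
    by (intro degree_diff_le degree_add_le) (simp_all only: degree_minus le_max_iff_disj simp_thms c2)
qed

section \<open>Rolle's theorem for the weighted quotient\<close>

abbreviation Fc :: "real poly \<Rightarrow> real poly \<Rightarrow> real poly \<Rightarrow> complex \<Rightarrow> complex" where
  "Fc p q r \<equiv> Gc (Pp p q r + Qp p q r) (Qp p q r)"

lemma wc_of_real: "wc (of_real x) = of_real ((1 - x\<^sup>2) / sqrt (1 + x\<^sup>2))"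
  using csqrt_one_plus_of_real[of "x\<^sup>2"] zero_le_power2[of x] by (simp add: wc_def)

lemma one_minus_pow4_nonzero: "norm (z :: complex) < 1 \<Longrightarrow> 1 - z ^ 4 \<noteq> 0"
  by (intro one_minus_nonzero) (simp add: norm_power power_less_one_iff)

lemma quotient_deriv:
  assumes z: "norm z < 1" and R: "poly (cpoly r) z \<noteq> 0"
  shows "((\<lambda>z. wc z * Ic p q r z / poly (cpoly r) z) has_field_derivative
    wc z * ((1 - z ^ 4) * (poly (cpoly r) z * deriv (Ic p q r) z - poly (cpoly (pderiv r)) z * Ic p q r z)
        - z * (3 + z\<^sup>2) * poly (cpoly r) z * Ic p q r z) / ((1 - z ^ 4) * (poly (cpoly r) z)\<^sup>2)) (at z)"
proof -
  have I: "(Ic p q r has_field_derivative deriv (Ic p q r) z) (at z)"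
    using z by (intro holomorphic_derivI[OF Ic_holomorphic open_ball]) auto
  have r: "(poly (cpoly r) has_field_derivative poly (cpoly (pderiv r)) z) (at z)"
    unfolding cpoly_pderiv by (rule poly_DERIV)
  define W c A A' B B' m where "W = wc z" and "c = z * (3 + z\<^sup>2)" and "A = Ic p q r z" and "A' = deriv (Ic p q r) z"
    and "B = poly (cpoly r) z" and "B' = poly (cpoly (pderiv r)) z" and "m = 1 - z ^ 4"
  have m: "m \<noteq> 0" unfolding m_def by (rule one_minus_pow4_nonzero[OF z])
  from DERIV_divide[OF DERIV_mult[OF wc_has_derivative[OF z] I] r R]
  have "((\<lambda>z. wc z * Ic p q r z / poly (cpoly r) z) has_field_derivative
     ((- (c / m * W) * A + A' * W) * B - W * A * B') / (B * B)) (at z)"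
    unfolding W_def c_def A_def A'_def B_def B'_def m_def .
  also have "((- (c / m * W) * A + A' * W) * B - W * A * B') / (B * B)
     = W * (m * (B * A' - B' * A) - c * B * A) / (m * B\<^sup>2)"
  proof -
    define k where "k = c / m"
    have k: "c = m * k" using m by (simp add: k_def)
    have "W * (m * (B * A' - B' * A) - c * B * A) = m * (((- (k * W) * A + A' * W) * B - W * A * B'))"
      unfolding k by (simp add: algebra_simps)
    thus ?thesis unfolding k_def[symmetric] using m by (simp add: power2_eq_square)
  qed
  finally show ?thesis unfolding W_def c_def A_def A'_def B_def B'_def m_def .
qed

text \<open>Rolle's theorem is applied to the real quotient and the derivative formula to its
  complex extension; both give the same number on the axis. Since \<open>wc\<close>,
  \<open>1 - z ^ 4\<close> and r have no zeros on the interval, a vanishing derivative makes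
  \<open>Fc\<close> vanish.\<close>

lemma rolle_step:
  assumes y: "-1 < y" "y < y'" "y' < 1" and nz: "\<And>x. y \<le> x \<Longrightarrow> x \<le> y' \<Longrightarrow> poly r x \<noteq> 0"
    and I0: "Ic p q r (of_real y) = 0" "Ic p q r (of_real y') = 0"
  shows "\<exists>\<xi>. y < \<xi> \<and> \<xi> < y' \<and> Fc p q r (of_real \<xi>) = 0"
proof -
  define D where "D = (\<lambda>z. wc z * ((1 - z ^ 4) * (poly (cpoly r) z * deriv (Ic p q r) z - poly (cpoly (pderiv r)) z * Ic p q r z)
        - z * (3 + z\<^sup>2) * poly (cpoly r) z * Ic p q r z) / ((1 - z ^ 4) * (poly (cpoly r) z)\<^sup>2))"
  define h where "h = (\<lambda>x. (1 - x\<^sup>2) / sqrt (1 + x\<^sup>2) * elliptic_comb p q r x / poly r x)"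
  have der: "(h has_real_derivative Re (D (of_real x))) (at x)" "D (of_real x) = of_real (Re (D (of_real x)))"
    if x: "y \<le> x" "x \<le> y'" for x
  proof -
    have x1: "\<bar>x\<bar> < 1" using x y by auto
    have R: "poly (cpoly r) (complex_of_real x) \<noteq> 0" using nz[OF x] by (simp add: poly_cpoly_of_real)
    have Q: "((\<lambda>z. wc z * Ic p q r z / poly (cpoly r) z) has_field_derivative D (of_real x)) (at (of_real x))"
      unfolding D_def by (rule quotient_deriv[OF _ R]) (use x1 in simp)
    have e: "0 < 1 - \<bar>x\<bar>" "\<And>t. \<bar>t - x\<bar> < 1 - \<bar>x\<bar> \<Longrightarrow>
       wc (of_real t) * Ic p q r (of_real t) / poly (cpoly r) (of_real t) = of_real (h t)"
    proof -
      fix t assume "\<bar>t - x\<bar> < 1 - \<bar>x\<bar>"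
      hence "\<bar>t\<bar> < 1" by linarith
      from Ic_of_real[OF this, of p q r]
      show "wc (of_real t) * Ic p q r (of_real t) / poly (cpoly r) (of_real t) = of_real (h t)"
        unfolding h_def wc_of_real poly_cpoly_of_real by simp
    qed (use x1 in simp)
    show "(h has_real_derivative Re (D (of_real x))) (at x)" "D (of_real x) = of_real (Re (D (of_real x)))"
      by (rule real_axis_deriv[OF Q e]; assumption)+
  qed
  have z: "h y = 0" "h y' = 0"
    using I0 Ic_of_real[of y p q r] Ic_of_real[of y' p q r] y by (simp_all add: h_def)
  have cont: "continuous_on {y..y'} h"
  proof (rule DERIV_continuous_on)
    fix x assume "x \<in> {y..y'}"
    hence "y \<le> x" "x \<le> y'" by simp_all
    from der(1)[OF this] show "(h has_real_derivative Re (D (of_real x))) (at x within {y..y'})"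
      by (rule has_field_derivative_at_within)
  qed
  have diff: "\<And>x. y < x \<Longrightarrow> x < y' \<Longrightarrow> h differentiable at x"
    unfolding real_differentiable_def using der(1)[OF less_imp_le less_imp_le] by blast
  have "h y = h y'" using z by simp
  from Rolle[OF y(2) this cont diff]
  obtain \<xi> where xi: "y < \<xi>" "\<xi> < y'" "(h has_real_derivative 0) (at \<xi>)" by blast
  hence "Re (D (of_real \<xi>)) = 0" using DERIV_unique[OF der(1)[OF less_imp_le less_imp_le]] by blast
  hence D0: "D (of_real \<xi>) = 0" using der(2)[of \<xi>] xi by simp
  have n1: "norm (complex_of_real \<xi>) < 1" using xi y by simp
  have R: "poly (cpoly r) (complex_of_real \<xi>) \<noteq> 0" using nz[of \<xi>] xi by (simp add: poly_cpoly_of_real)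
  have gen: "x = 0" if "w * x / (m * c\<^sup>2) = 0" "w \<noteq> 0" "m \<noteq> 0" "c \<noteq> 0" for w x m c :: complex
    using that by simp
  have "(1 - (of_real \<xi>) ^ 4) * (poly (cpoly r) (of_real \<xi>) * deriv (Ic p q r) (of_real \<xi>) - poly (cpoly (pderiv r)) (of_real \<xi>) * Ic p q r (of_real \<xi>))
        - of_real \<xi> * (3 + (of_real \<xi>)\<^sup>2) * poly (cpoly r) (of_real \<xi>) * Ic p q r (of_real \<xi>) = 0"
    by (rule gen[OF D0[unfolded D_def] wc_nonzero[OF n1] one_minus_pow4_nonzero[OF n1] R])
  hence "of_real (pi / 2) * Fc p q r (of_real \<xi>) = 0"
    unfolding elimination_identity[OF n1, symmetric] by (simp only: mult_zero_right)
  hence "Fc p q r (of_real \<xi>) = 0" by simp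
  thus ?thesis using xi by blast
qed

text \<open>Let A be the zeros of r and Z the union of A with the given zeros of I. The points of Z
  contribute total order \<open>sum (u + a) - card Z\<close> to \<open>Fc\<close>, and each of the
  at least \<open>card Z - 1 - 2 * card A\<close> gaps without an end point in A contributes one
  more zero. The bound 2d + 2 leaves \<open>sum u\<close> at most
  \<open>2d + 3 + 2 * card A - sum a\<close>, and a is at least 1 on A.\<close>

lemma Ic_zeros:
  assumes M: "degree p \<le> M" "degree q \<le> M" "degree r \<le> l" and r: "r \<noteq> 0"
    and Fnz: "\<exists>w\<in>ball 0 1. Fc p q r w \<noteq> 0"
  defines "d \<equiv> max (M + l + 4) (2 * l + 2)"
  shows "real_zeros_le (Ic p q r) (2 * d + l + 3)"
  unfolding real_zeros_le_def
proof (intro allI impI, elim conjE)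
  fix Y :: "real set" and v
  assume Y: "finite Y" "Y \<subseteq> {-1<..<1}" and ov: "\<forall>y\<in>Y. ord_ge (Ic p q r) (complex_of_real y) (v y)"
  have degs: "degree (Pp p q r + Qp p q r) \<le> d" "degree (Qp p q r) \<le> d"
    using degree_Pp_Qp[OF M] unfolding d_def by (auto intro: degree_add_le)
  note Fz = Gc_zeros[OF degs Fnz, unfolded real_zeros_le_def, rule_format]
  define Y' where "Y' = {y \<in> Y. v y > 0}"
  define A where "A = {x. -1 < x \<and> x < 1 \<and> poly r x = 0}"
  define Z where "Z = Y' \<union> A"
  define u where "u = (\<lambda>x. if x \<in> Y' then v x else 0)"
  define a where "a = (\<lambda>x. order x r)"
  have finA: "finite A" unfolding A_def by (rule finite_subset[OF _ poly_roots_finite[OF r]]) auto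
  have cA: "card A \<le> l"
  proof -
    have "card A \<le> card {x. poly r x = 0}"
      by (intro card_mono poly_roots_finite r) (auto simp: A_def)
    thus ?thesis using card_poly_roots_bound[OF r] M(3) by linarith
  qed
  have fin: "finite Z" "finite Y'" using finA Y by (auto simp: Z_def Y'_def)
  have Zin: "-1 < x" "x < 1" if "x \<in> Z" for x
    using that Y by (auto simp: Z_def Y'_def A_def)
  have a1: "a x \<ge> 1" if "x \<in> A" for x
    using that r order_root[of r x] by (auto simp: A_def a_def)
  have ua: "u x + a x \<ge> 1" if "x \<in> Z" for x
    using that a1 by (auto simp: Z_def u_def Y'_def intro: add_increasing)
  have ordF: "ord_ge (Fc p q r) (of_real x) (u x + a x - 1)" if x: "x \<in> Z" for x
  proof (rule ord_ge_wronskian[where f = "Ic p q r" and g = "poly (cpoly r)"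
        and A = "\<lambda>z. of_real (2 / pi) * z * (1 - z ^ 4)" and B = "\<lambda>z. - (of_real (2 / pi) * z\<^sup>2 * (3 + z\<^sup>2))"])
    show "ord_ge (Ic p q r) (complex_of_real x) (u x)"
    proof (cases "x \<in> Y'")
      case True
      thus ?thesis using ov by (simp add: u_def Y'_def)
    next
      case False
      have "complex_of_real x \<in> ball 0 1" using Zin[OF x] by simp
      then obtain s where s: "s > 0" "ball (complex_of_real x) s \<subseteq> ball 0 1"
        using ball_in_disc by blast
      show ?thesis
        by (rule ord_geI[OF s(1), of "Ic p q r"])
           (use False s in \<open>auto simp: u_def intro: holomorphic_on_subset[OF Ic_holomorphic]\<close>)
    qed
    show "ord_ge (poly (cpoly r)) (complex_of_real x) (a x)" unfolding a_def by (rule ord_ge_poly)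
    show "1 \<le> u x + a x" by (rule ua[OF x])
    show "complex_of_real x \<in> ball 0 1" using Zin[OF x] by simp
    fix w :: complex assume "w \<in> ball 0 1"
    hence w: "norm w < 1" by simp
    have pi2: "complex_of_real (2 / pi) * of_real (pi / 2) = 1"
      unfolding of_real_mult[symmetric] by simp
    have "Fc p q r w = complex_of_real (2 / pi) * of_real (pi / 2) * Fc p q r w"
      unfolding pi2 by simp
    also have "\<dots> = complex_of_real (2 / pi) * (of_real (pi / 2) * Fc p q r w)"
      by (simp only: mult.assoc)
    also have "\<dots> = of_real (2 / pi) * w * (1 - w ^ 4) * (poly (cpoly r) w * deriv (Ic p q r) w - deriv (poly (cpoly r)) w * Ic p q r w)
       + - (of_real (2 / pi) * w\<^sup>2 * (3 + w\<^sup>2)) * poly (cpoly r) w * Ic p q r w"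
    proof -
      have dr: "deriv (poly (cpoly r)) w = poly (cpoly (pderiv r)) w"
        unfolding cpoly_pderiv by (rule DERIV_imp_deriv[OF poly_DERIV])
      have alg: "k * (w * (m * X - w * c * R * J)) = k * w * m * X + - (k * w\<^sup>2 * c) * R * J"
        for k m X c R J :: complex
        by (simp add: algebra_simps power2_eq_square)
      show ?thesis unfolding dr elimination_identity[OF w, symmetric] by (rule alg)
    qed
    finally show "Fc p q r w = \<dots>" .
  qed (auto intro!: holomorphic_intros)
  define zs where "zs = sorted_list_of_set Z"
  define s where "s = card Z"
  have len: "length zs = s" by (simp add: zs_def s_def)
  have setzs: "set zs = Z" using fin by (simp add: zs_def)
  have mono: "zs ! i < zs ! j" if "i < j" "j < s" for i j
    using strict_sorted_list_of_set[of Z] sorted_wrt_nth_less[of "(<)" zs i j] that len by (simp add: zs_def)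
  have zin: "zs ! i \<in> Z" if "i < s" for i using that len setzs nth_mem by metis
  have inj: "inj_on (\<lambda>i. zs ! i) {..<s}"
    by (intro linorder_inj_onI') (auto dest: mono)
  have gap: "x \<notin> Z" if "zs ! i < x" "x < zs ! (Suc i)" "Suc i < s" for i x
  proof
    assume "x \<in> Z"
    then obtain j where j: "j < s" "x = zs ! j" using setzs len by (metis in_set_conv_nth)
    have "\<not> j \<le> i" using mono[of j i] that j by (cases "j = i") auto
    moreover have "\<not> j \<ge> Suc i" using mono[of "Suc i" j] that j by (cases "j = Suc i") auto
    ultimately show False by linarith
  qed
  define B1 where "B1 = {i. Suc i < s \<and> zs ! i \<in> A}"
  define B2 where "B2 = {i. Suc i < s \<and> zs ! (Suc i) \<in> A}"
  define Gd where "Gd = {..<s - 1} - (B1 \<union> B2)"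
  have cB1: "card B1 \<le> card A"
    using finA by (intro card_inj_on_le[of "\<lambda>i. zs ! i"]) (auto simp: B1_def intro: inj_on_subset[OF inj])
  have "inj_on (\<lambda>i. zs ! (Suc i)) B2"
    by (rule inj_onI) (use inj in \<open>auto simp: B2_def inj_on_def\<close>)
  hence cB2: "card B2 \<le> card A"
    using finA by (intro card_inj_on_le[of "\<lambda>i. zs ! (Suc i)"]) (auto simp: B2_def)
  have finB: "finite B1" "finite B2" by (auto simp: B1_def B2_def intro: finite_subset[of _ "{..<s}"])
  have "card Gd \<ge> card {..<s - 1} - card (B1 \<union> B2)"
    unfolding Gd_def using finB by (intro diff_card_le_card_Diff) auto
  moreover have "card (B1 \<union> B2) \<le> card A + card A"
    using card_Un_le[of B1 B2] cB1 cB2 by linarith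
  ultimately have cG: "card Gd + 2 * card A + 1 \<ge> card Z" unfolding s_def by simp
  have "\<exists>\<xi>. zs ! i < \<xi> \<and> \<xi> < zs ! (Suc i) \<and> Fc p q r (of_real \<xi>) = 0" if i: "i \<in> Gd" for i
  proof -
    have i': "Suc i < s" "zs ! i \<notin> A" "zs ! (Suc i) \<notin> A" using i by (auto simp: Gd_def B1_def B2_def)
    have zi: "zs ! i \<in> Z" "zs ! (Suc i) \<in> Z" using zin i' by auto
    have lt: "zs ! i < zs ! (Suc i)" using mono i' by simp
    have nA: "x \<notin> A" if "zs ! i \<le> x" "x \<le> zs ! (Suc i)" for x
    proof (cases "x = zs ! i \<or> x = zs ! (Suc i)")
      case False
      hence "zs ! i < x" "x < zs ! (Suc i)" using that by linarith+
      from gap[OF this i'(1)] show ?thesis by (simp add: Z_def)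
    qed (use i' in blast)
    have I0: "Ic p q r (of_real y) = 0" if "y \<in> Z" "y \<notin> A" for y
      using that ov ord_ge_zero[of "v y" "Ic p q r" "of_real y"] by (auto simp: Z_def Y'_def)
    show ?thesis
    proof (rule rolle_step[OF Zin(1)[OF zi(1)] lt Zin(2)[OF zi(2)]])
      show "poly r x \<noteq> 0" if "zs ! i \<le> x" "x \<le> zs ! (Suc i)" for x
      proof -
        have "-1 < x" "x < 1" using that Zin(1)[OF zi(1)] Zin(2)[OF zi(2)] by linarith+
        thus ?thesis using nA[OF that] by (simp add: A_def)
      qed
    qed (use I0 zi i' in blast)+
  qed
  then obtain \<xi> where \<xi>: "\<And>i. i \<in> Gd \<Longrightarrow> zs ! i < \<xi> i \<and> \<xi> i < zs ! (Suc i) \<and> Fc p q r (of_real (\<xi> i)) = 0"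
    by metis
  have Gs: "Suc i < s" if "i \<in> Gd" for i using that by (auto simp: Gd_def)
  have xiZ: "\<xi> i \<notin> Z" "-1 < \<xi> i" "\<xi> i < 1" if "i \<in> Gd" for i
    using \<xi>[OF that] gap[of i "\<xi> i"] Gs[OF that] Zin[OF zin[of i]] Zin[OF zin[of "Suc i"]] by auto
  have "\<xi> i < \<xi> j" if "i < j" "i \<in> Gd" "j \<in> Gd" for i j
  proof -
    have "zs ! (Suc i) \<le> zs ! j" using that mono[of "Suc i" j] Gs[of j] by (cases "Suc i = j") auto
    thus ?thesis using \<xi>[OF that(2)] \<xi>[OF that(3)] by linarith
  qed
  hence inj\<xi>: "inj_on \<xi> Gd" by (intro linorder_inj_onI') (auto simp: order_less_le)
  have finG: "finite Gd" by (simp add: Gd_def)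
  define \<mu> where "\<mu> = (\<lambda>x. if x \<in> Z then u x + a x - 1 else 1)"
  have ord1: "ord_ge (Fc p q r) (of_real x) 1" if "Fc p q r (of_real x) = 0" "-1 < x" "x < 1" for x
  proof (rule ord_ge_if_derivs_vanish[OF Gc_holomorphic open_ball connected_ball])
    show "complex_of_real x \<in> ball 0 1" using that by simp
    show "(deriv ^^ k) (Fc p q r) (of_real x) = 0" if "k < 1" for k
      using that \<open>Fc p q r (of_real x) = 0\<close> by simp
  qed
  have "sum \<mu> (Z \<union> \<xi> ` Gd) \<le> 2 * d + 2"
  proof (rule Fz, intro conjI ballI)
    show "finite (Z \<union> \<xi> ` Gd)" using fin finG by simp
    show "Z \<union> \<xi> ` Gd \<subseteq> {- 1<..<1}" using Zin xiZ by auto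
    fix x assume "x \<in> Z \<union> \<xi> ` Gd"
    thus "ord_ge (Fc p q r) (complex_of_real x) (\<mu> x)"
      using ordF xiZ \<xi> ord1 by (auto simp: \<mu>_def)
  qed
  moreover have "sum \<mu> (Z \<union> \<xi> ` Gd) = sum \<mu> Z + sum \<mu> (\<xi> ` Gd)"
    using fin finG xiZ by (intro sum.union_disjoint) auto
  moreover have "sum \<mu> (\<xi> ` Gd) = card Gd"
    using xiZ card_image[OF inj\<xi>] by (subst sum.cong[of _ "\<xi> ` Gd" _ "\<lambda>_. 1"]) (auto simp: \<mu>_def)
  ultimately have main: "sum \<mu> Z + card Gd \<le> 2 * d + 2" by linarith
  have "sum \<mu> Z + card Z = (\<Sum>x\<in>Z. \<mu> x + 1)" by (simp only: card_eq_sum sum.distrib)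
  also have "\<dots> = (\<Sum>x\<in>Z. u x + a x)" 
  proof (rule sum.cong)
    show "\<mu> x + 1 = u x + a x" if "x \<in> Z" for x
      using ua[OF that] that by (simp add: \<mu>_def)
  qed simp
  also have "\<dots> = sum u Z + sum a Z" by (rule sum.distrib)
  finally have e1: "sum \<mu> Z + card Z = sum u Z + sum a Z" .
  have "card A = (\<Sum>x\<in>A. 1)" by simp
  also have "\<dots> \<le> sum a A" by (intro sum_mono a1)
  also have "\<dots> \<le> sum a Z" using fin by (intro sum_mono2) (auto simp: Z_def)
  finally have e2: "card A \<le> sum a Z" .
  have "sum v Y = sum v Y'" unfolding Y'_def using Y by (intro sum.mono_neutral_right) auto
  also have "\<dots> = sum u Y'" by (rule sum.cong) (auto simp: u_def)
  also have "\<dots> = sum u Z" using fin by (intro sum.mono_neutral_left) (auto simp: Z_def u_def)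
  finally have e3: "sum v Y = sum u Z" .
  show "sum v Y \<le> 2 * d + l + 3" using e1 e2 e3 main cG cA by linarith
qed

lemma wc_holomorphic: "wc holomorphic_on ball 0 1"
  by (rule holomorphic_on_ball_derivI[OF wc_has_derivative])

text \<open>Here \<open>wc * I / r\<close> is constant on a small disc, so
  \<open>wc * I = C * r\<close> on the whole disc by continuation. As C is nonzero and
  \<open>wc\<close> has no zeros, orders of I pass to r.\<close>

lemma Ic_zeros_degenerate:
  assumes r: "r \<noteq> 0" and Inz: "\<exists>w\<in>ball 0 1. Ic p q r w \<noteq> 0"
    and F0: "\<And>w. w \<in> ball 0 1 \<Longrightarrow> Fc p q r w = 0"
  shows "real_zeros_le (Ic p q r) (degree r)"
proof -
  \<comment> \<open>The point 0 is avoided together with the zeros of r, because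
    \<open>elimination_identity\<close> carries a factor z.\<close>
  define B where "B = {w. poly ([:0, 1:] * cpoly r) w = 0}"
  have finB: "finite B" unfolding B_def by (rule poly_roots_finite) (use r in auto)
  have "infinite (ball (0::complex) 1)" using uncountable_ball[of 1 "0::complex"] countable_finite by auto
  hence "ball 0 1 - B \<noteq> {}" using finB by (metis Diff_eq_empty_iff finite_subset)
  then obtain a where a: "a \<in> ball 0 1 - B" by blast
  have "open (ball 0 1 - B)" using finB by (intro open_Diff finite_imp_closed) auto
  then obtain s where s: "s > 0" "ball a s \<subseteq> ball 0 1 - B" using a openE by blast
  have "((\<lambda>z. wc z * Ic p q r z / poly (cpoly r) z) has_field_derivative 0) (at z within ball a s)"
    if z: "z \<in> ball a s" for z
  proof -
    have z1: "norm z < 1" using z s by auto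
    have "z \<notin> B" using z s by blast
    hence "poly ([:0, 1:] * cpoly r) z \<noteq> 0" unfolding B_def by blast
    hence nz: "z \<noteq> 0" "poly (cpoly r) z \<noteq> 0" by auto
    have "(1 - z ^ 4) * (poly (cpoly r) z * deriv (Ic p q r) z - poly (cpoly (pderiv r)) z * Ic p q r z)
        - z * (3 + z\<^sup>2) * poly (cpoly r) z * Ic p q r z = 0"
      using elimination_identity[OF z1, of r p q] F0[of z] z1 nz by simp
    from quotient_deriv[OF z1 nz(2), of p q, unfolded this]
    show ?thesis by (simp add: has_field_derivative_at_within)
  qed
  hence "\<exists>C. \<forall>z\<in>ball a s. wc z * Ic p q r z / poly (cpoly r) z = C"
    by (rule has_field_derivative_zero_constant[OF convex_ball])
  then obtain C where C: "\<And>z. z \<in> ball a s \<Longrightarrow> wc z * Ic p q r z / poly (cpoly r) z = C"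
    by blast
  have "wc z * Ic p q r z = C * poly (cpoly r) z" if z: "z \<in> ball 0 1" for z
  proof (rule analytic_continuation_open[of "ball a s" "ball 0 1" "\<lambda>z. wc z * Ic p q r z" "\<lambda>z. C * poly (cpoly r) z"])
    show "ball a s \<noteq> {}" "ball a s \<subseteq> ball 0 1" using s by auto
    show "(\<lambda>z. wc z * Ic p q r z) holomorphic_on ball 0 1"
      by (intro holomorphic_intros wc_holomorphic Ic_holomorphic)
    show "(\<lambda>z. C * poly (cpoly r) z) holomorphic_on ball 0 1" by (intro holomorphic_intros)
    fix w assume w: "w \<in> ball a s"
    have "w \<notin> B" using w s by blast
    hence "poly ([:0, 1:] * cpoly r) w \<noteq> 0" unfolding B_def by blast
    thus "wc w * Ic p q r w = C * poly (cpoly r) w" using C[OF w] by (simp add: divide_eq_eq)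
  qed (use z in auto)
  note eq = this
  have C0: "C \<noteq> 0"
  proof
    assume "C = 0"
    hence "Ic p q r w = 0" if "w \<in> ball 0 1" for w
      using eq[OF that] wc_nonzero[of w] that by simp
    thus False using Inz by blast
  qed
  show ?thesis unfolding real_zeros_le_def
  proof (intro allI impI, elim conjE)
    fix Y v assume Y: "finite Y" "Y \<subseteq> {-1<..<1}" and o: "\<forall>y\<in>Y. ord_ge (Ic p q r) (complex_of_real y) (v y)"
    have "\<forall>y\<in>Y. ord_ge (poly (cpoly r)) (complex_of_real y) (v y)"
    proof
      fix y assume y: "y \<in> Y"
      show "ord_ge (poly (cpoly r)) (complex_of_real y) (v y)"
      proof (rule ord_ge_mult_disc[of "Ic p q r" _ _ "\<lambda>w. wc w / C"])
        show "ord_ge (Ic p q r) (complex_of_real y) (v y)" using o y by blast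
        have "-1 < y" "y < 1" using Y y by auto
        thus "complex_of_real y \<in> ball 0 1" by simp
        show "(\<lambda>w. wc w / C) holomorphic_on ball 0 1"
          using C0 by (intro holomorphic_intros wc_holomorphic) auto
        show "poly (cpoly r) w = wc w / C * Ic p q r w" if "w \<in> ball 0 1" for w
          using eq[OF that] C0 by simp
      qed
    qed
    thus "sum v Y \<le> degree r" using poly_real_zeros[OF r] Y unfolding real_zeros_le_def by blast
  qed
qed

lemma real_zeros_le_mono: "real_zeros_le f M \<Longrightarrow> M \<le> N \<Longrightarrow> real_zeros_le f N"
  unfolding real_zeros_le_def by (meson order_trans)

text \<open>With M the larger of m and n, \<open>M + l + 4\<close> is at least
  \<open>2 * l + 2\<close> exactly if l is at most M + 2; the two values of the maximum are the two
  cases of \<open>psi\<close>.\<close>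

lemma Ic_zeros_psi:
  assumes "degree p = m" "degree q = n" "degree r = l" "r \<noteq> 0" "\<exists>w\<in>ball 0 1. Ic p q r w \<noteq> 0"
  shows "real_zeros_le (Ic p q r) (psi m n l)"
proof (cases "\<exists>w\<in>ball 0 1. Fc p q r w \<noteq> 0")
  case True
  have "real_zeros_le (Ic p q r) (2 * max (max m n + l + 4) (2 * l + 2) + l + 3)"
    by (rule Ic_zeros[OF _ _ _ assms(4) True]) (use assms in auto)
  thus ?thesis by (rule real_zeros_le_mono) (auto simp: psi_def)
next
  case False
  have "real_zeros_le (Ic p q r) (degree r)"
    by (rule Ic_zeros_degenerate[OF assms(4,5)]) (use False in blast)
  thus ?thesis by (rule real_zeros_le_mono) (auto simp: psi_def assms(3))
qed

section \<open>From complex orders to real multiplicities\<close>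

lemma higher_deriv_of_real:
  assumes "\<bar>x\<bar> < 1"
  shows "(deriv ^^ j) (Ic p q r) (of_real x) = of_real ((deriv ^^ j) (elliptic_comb p q r) x)"
  using assms
proof (induction j arbitrary: x)
  case 0
  thus ?case by (simp add: Ic_of_real)
next
  case (Suc j)
  have hol: "(deriv ^^ j) (Ic p q r) holomorphic_on ball 0 1"
    by (intro holomorphic_higher_deriv Ic_holomorphic open_ball)
  have "complex_of_real x \<in> ball 0 1" using Suc.prems by simp
  from holomorphic_derivI[OF hol open_ball this]
  have D: "((deriv ^^ j) (Ic p q r) has_field_derivative (deriv ^^ Suc j) (Ic p q r) (of_real x)) (at (of_real x))"
    by simp
  have e: "0 < 1 - \<bar>x\<bar>" "\<And>t. \<bar>t - x\<bar> < 1 - \<bar>x\<bar> \<Longrightarrow>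
      (deriv ^^ j) (Ic p q r) (of_real t) = of_real ((deriv ^^ j) (elliptic_comb p q r) t)"
  proof -
    fix t assume "\<bar>t - x\<bar> < 1 - \<bar>x\<bar>"
    hence "\<bar>t\<bar> < 1" by linarith
    thus "(deriv ^^ j) (Ic p q r) (of_real t) = of_real ((deriv ^^ j) (elliptic_comb p q r) t)" by (rule Suc.IH)
  qed (use Suc.prems in simp)
  have d: "deriv ((deriv ^^ j) (elliptic_comb p q r)) x = Re ((deriv ^^ Suc j) (Ic p q r) (of_real x))"
    by (rule DERIV_imp_deriv[OF real_axis_deriv(1)[OF D e]])
  show ?case using real_axis_deriv(2)[OF D e] unfolding d[symmetric] by simp
qed

text \<open>The \<open>max 1\<close> gives every zero a weight of at least one without first knowing
  that some derivative is nonzero, on which the meaning of \<open>LEAST\<close> depends. Finiteness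
  of the zero set can then be read off from the same bound.\<close>

lemma ord_ge_zero_multiplicity:
  assumes "\<bar>x\<bar> < 1" "elliptic_comb p q r x = 0"
  shows "ord_ge (Ic p q r) (of_real x) (max 1 (zero_multiplicity (elliptic_comb p q r) x))"
proof (rule ord_ge_if_derivs_vanish[OF Ic_holomorphic open_ball connected_ball])
  show "complex_of_real x \<in> ball 0 1" using assms by simp
  fix j assume j: "j < max 1 (zero_multiplicity (elliptic_comb p q r) x)"
  have "(deriv ^^ j) (elliptic_comb p q r) x = 0"
  proof (cases "j = 0")
    case False
    hence "j < (LEAST j. (deriv ^^ j) (elliptic_comb p q r) x \<noteq> 0)" using j by (simp add: zero_multiplicity_def)
    thus ?thesis using not_less_Least by blast
  qed (use assms in simp)
  thus "(deriv ^^ j) (Ic p q r) (of_real x) = 0" using higher_deriv_of_real[OF assms(1), of j p q r] by simp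
qed

lemma finite_if_real_zeros_le:
  assumes "real_zeros_le (Ic p q r) N" "S \<subseteq> {x \<in> {-1<..<1}. elliptic_comb p q r x = 0}"
  shows "finite S \<and> (\<Sum>k\<in>S. zero_multiplicity (elliptic_comb p q r) k) \<le> N"
proof -
  define v where "v = (\<lambda>x. max 1 (zero_multiplicity (elliptic_comb p q r) x))"
  have le: "sum v Y \<le> N" if "finite Y" "Y \<subseteq> S" for Y
  proof -
    have "\<forall>y\<in>Y. ord_ge (Ic p q r) (complex_of_real y) (v y)"
    proof
      fix y assume "y \<in> Y"
      hence "y \<in> {x \<in> {-1<..<1}. elliptic_comb p q r x = 0}" using that assms(2) by blast
      thus "ord_ge (Ic p q r) (complex_of_real y) (v y)"
        unfolding v_def by (intro ord_ge_zero_multiplicity) auto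
    qed
    moreover have "Y \<subseteq> {-1<..<1}" using that assms(2) by blast
    ultimately show ?thesis using assms(1) that(1) unfolding real_zeros_le_def by blast
  qed
  have fin: "finite S"
  proof (rule ccontr)
    assume "infinite S"
    then obtain Y where Y: "finite Y" "card Y = Suc N" "Y \<subseteq> S"
      using infinite_arbitrarily_large by blast
    have "card Y \<le> sum v Y" unfolding card_eq_sum by (rule sum_mono) (simp add: v_def)
    thus False using le[OF Y(1,3)] Y(2) by simp
  qed
  have "(\<Sum>k\<in>S. zero_multiplicity (elliptic_comb p q r) k) \<le> sum v S"
    by (rule sum_mono) (simp add: v_def)
  thus ?thesis using fin le[OF fin order_refl] by linarith
qed

lemma isolated_zeros_on_subset: "isolated_zeros_on f S \<subseteq> {x \<in> S. f x = 0}"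
  by (auto simp: isolated_zeros_on_def isolated_in_def)

lemma zeros_upper_bound:
  assumes "degree p = m" "degree q = n" "degree r = l" "r \<noteq> 0"
  shows "finite (isolated_zeros_on (elliptic_comb p q r) {-1<..<1}) \<and>
    (\<Sum>k \<in> isolated_zeros_on (elliptic_comb p q r) {-1<..<1}. zero_multiplicity (elliptic_comb p q r) k) \<le> psi m n l"
proof (cases "\<exists>w\<in>ball 0 1. Ic p q r w \<noteq> 0")
  case True
  show ?thesis
    by (rule finite_if_real_zeros_le[OF Ic_zeros_psi[OF assms True] isolated_zeros_on_subset])
next
  case False
  \<comment> \<open>If I vanishes identically, no zero is isolated and the sum is empty.\<close>
  have "elliptic_comb p q r x = 0" if "x \<in> {-1<..<1}" for x
  proof -
    have x: "\<bar>x\<bar> < 1" using that by auto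
    hence "complex_of_real x \<in> ball 0 1" by simp
    thus ?thesis using False Ic_of_real[OF x, of p q r] by simp
  qed
  hence "{x \<in> {-1<..<1}. elliptic_comb p q r x = 0} = {-1<..<1}" by auto
  moreover have "\<not> x isolated_in {-1<..<1::real}" for x
  proof
    assume "x isolated_in {-1<..<1::real}"
    then obtain T where "open T" "T \<inter> {-1<..<1} = {x}" by (auto simp: isolated_in_def)
    hence "open {x}" using open_Int[of T "{-1<..<1}"] by simp
    thus False using not_open_singleton by blast
  qed
  ultimately have "isolated_zeros_on (elliptic_comb p q r) {-1<..<1} = {}"
    by (simp add: isolated_zeros_on_def)
  thus ?thesis by simp
qed

section \<open>Linear independence\<close>

text \<open>Multiplication by the linear factor keeps the exponent at s, so the indicial computation
  meets no truncated \<open>s - 1\<close>.\<close>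

lemma X_times_pderiv_power:
  "[:- a, 1:] * pderiv ([:- a, 1:] ^ s) = of_nat s * [:- a, 1:] ^ s" for a :: complex
proof (induction s)
  case (Suc s)
  define L where "L = [:- a, 1:]"
  have dL: "pderiv L = 1" by (simp add: L_def pderiv_pCons one_pCons)
  have "L * pderiv (L ^ Suc s) = L * (L * pderiv (L ^ s)) + L * L ^ s"
    by (simp only: power_Suc pderiv_mult dL distrib_left mult_1_right)
  also have "\<dots> = of_nat (Suc s) * L ^ Suc s"
    unfolding Suc[folded L_def] by (simp add: algebra_simps)
  finally show ?case by (simp only: L_def)
qed simp

text \<open>The system \<open>Pp = 0\<close>, \<open>Qp = 0\<close> has a regular singular point at
  \<open>\<i>\<close>. If \<open>L ^ s\<close> divides p and q with s at most v, the terms of lowest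
  order amount to \<open>2 - 4 * (s - v)\<close> times the values of the cofactors at
  \<open>\<i>\<close>. The only root s = v + 1/2 is not an integer, so one more factor
  \<open>L\<close> splits off.\<close>

lemma indicial_divisibility:
  assumes Pp: "Pp p q r = 0" and Qp: "Qp p q r = 0" and r: "r \<noteq> 0"
  defines "L \<equiv> [:- \<i>, 1:]" and "v \<equiv> order \<i> (cpoly r)"
  shows "s \<le> v + 1 \<Longrightarrow> L ^ s dvd cpoly p \<and> L ^ s dvd cpoly q"
proof (induction s)
  case (Suc s)
  then obtain p1 q1 where p1: "cpoly p = L ^ s * p1" and q1: "cpoly q = L ^ s * q1"
    by (auto simp: dvd_def)
  have sv: "s \<le> v" using Suc.prems by simp
  have cr: "cpoly r \<noteq> 0" using r by simp
  obtain r1 where r1: "cpoly r = L ^ v * r1" "\<not> L dvd r1"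
    using order_decomp[OF cr, of \<i>] unfolding L_def v_def by blast
  have r1i: "poly r1 \<i> \<noteq> 0" using r1(2) by (simp add: L_def poly_eq_0_iff_dvd)
  \<comment> \<open>The coefficients \<open>z - z^5\<close>, \<open>1 - z^4\<close> and
    \<open>1 + z^2\<close> all vanish at \<open>\<i>\<close>; their cofactors of \<open>L\<close>
    are collected here.\<close>
  define \<kappa> :: "complex poly" where "\<kappa> = [:0, \<i>, 1, - \<i>, -1:]"
  have X: "cpoly [:0, 1, 0, 0, 0, -1:] = L * \<kappa>"
    by (simp add: L_def \<kappa>_def cpoly_pCons)
  define \<nu> :: "complex poly" where "\<nu> = [:\<i>, 1, - \<i>, -1:]"
  have Y: "cpoly [:1, 0, 0, 0, -1:] = L * \<nu>"
    by (simp add: L_def \<nu>_def cpoly_pCons)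
  have Z: "cpoly [:1, 0, 1:] = L * [:\<i>, 1:]"
    by (simp add: L_def cpoly_pCons)
  have W: "L * (pderiv (L ^ s * f) * (L ^ v * g) - (L ^ s * f) * pderiv (L ^ v * g))
     = L ^ (s + v) * ((of_nat s - of_nat v) * f * g + L * (pderiv f * g - f * pderiv g))" for f g
  proof -
    have e: "L * pderiv (L ^ k * f) = L ^ k * (of_nat k * f + L * pderiv f)" for k f
    proof -
      have "L * pderiv (L ^ k * f) = (L * pderiv (L ^ k)) * f + L * L ^ k * pderiv f"
        by (simp only: pderiv_mult distrib_left mult_ac add.commute)
      thus ?thesis unfolding X_times_pderiv_power[of \<i> k, folded L_def] by (simp only: distrib_left mult_ac)
    qed
    have "L * (pderiv (L ^ s * f) * (L ^ v * g) - (L ^ s * f) * pderiv (L ^ v * g))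
      = (L * pderiv (L ^ s * f)) * (L ^ v * g) - (L ^ s * f) * (L * pderiv (L ^ v * g))"
      by (simp only: right_diff_distrib mult_ac)
    also have "\<dots> = L ^ (s + v) * ((of_nat s - of_nat v) * f * g + L * (pderiv f * g - f * pderiv g))"
      unfolding e power_add by (simp only: ring_distribs mult_ac) simp
    finally show ?thesis .
  qed
  have rr: "cpoly r = L ^ s * (L ^ (v - s) * r1)"
  proof -
    have "L ^ v = L ^ s * L ^ (v - s)" using sv by (metis le_add_diff_inverse power_add)
    thus ?thesis unfolding r1(1) by (simp only: mult.assoc)
  qed
  define t where "t = L ^ (v - s) * r1"
  define c4 c1 where "c4 = cpoly [:0, 0, 3, 0, 1:]" and "c1 = [:\<i>, 1:]"
  define P1 where "P1 = - (c4 * p1 * r1)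
      + \<kappa> * ((of_nat s - of_nat v) * p1 * r1 + L * (pderiv p1 * r1 - p1 * pderiv r1))
      - L * \<nu> * (p1 + q1) * r1 - L * c1 * t * r1"
  define Q1 where "Q1 = - (c4 * q1 * r1)
      + \<kappa> * ((of_nat s - of_nat v) * q1 * r1 + L * (pderiv q1 * r1 - q1 * pderiv r1))
      + L * c1 * p1 * r1 + L * \<nu> * q1 * r1 + L * c1 * t * r1"
  have rt: "cpoly r * cpoly r = L ^ (s + v) * (t * r1)"
    unfolding power_add t_def by (subst rr, subst r1(1)) (simp only: mult_ac)
  have "cpoly (Pp p q r) = L ^ (s + v) * P1"
  proof -
    have "cpoly (Pp p q r) = - (c4 * (L ^ s * p1) * (L ^ v * r1))
      + \<kappa> * (L * (pderiv (L ^ s * p1) * (L ^ v * r1) - (L ^ s * p1) * pderiv (L ^ v * r1)))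
      - L * \<nu> * (L ^ s * p1 + L ^ s * q1) * (L ^ v * r1) - L * c1 * (cpoly r * cpoly r)"
      unfolding Pp_def cpoly_add cpoly_diff cpoly_mult cpoly_uminus cpoly_pderiv X Y Z p1 q1 c4_def[symmetric]
      unfolding r1(1) c1_def[symmetric] by (simp only: mult_ac)
    thus ?thesis unfolding W rt P1_def power_add by (simp only: ring_distribs mult_ac) simp
  qed
  hence "L ^ (s + v) * P1 = 0" unfolding Pp by (simp only: map_poly_0)
  moreover have Lnz: "L ^ (s + v) \<noteq> 0" by (simp add: L_def)
  ultimately have P1: "P1 = 0" by (simp only: mult_eq_0_iff simp_thms)
  have "cpoly (Qp p q r) = L ^ (s + v) * Q1"
  proof -
    have "cpoly (Qp p q r) = - (c4 * (L ^ s * q1) * (L ^ v * r1))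
      + \<kappa> * (L * (pderiv (L ^ s * q1) * (L ^ v * r1) - (L ^ s * q1) * pderiv (L ^ v * r1)))
      + L * c1 * (L ^ s * p1) * (L ^ v * r1) + L * \<nu> * (L ^ s * q1) * (L ^ v * r1) + L * c1 * (cpoly r * cpoly r)"
      unfolding Qp_def cpoly_add cpoly_diff cpoly_mult cpoly_uminus cpoly_pderiv X Y Z p1 q1 c4_def[symmetric]
      unfolding r1(1) c1_def[symmetric] by (simp only: mult_ac)
    thus ?thesis unfolding W rt Q1_def power_add by (simp only: ring_distribs mult_ac) simp
  qed
  hence "L ^ (s + v) * Q1 = 0" unfolding Qp by (simp only: map_poly_0)
  hence Q1: "Q1 = 0" using Lnz by (simp only: mult_eq_0_iff simp_thms)
  have vals: "poly L \<i> = 0" "poly \<kappa> \<i> = - 4" "poly c4 \<i> = - 2"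
    by (simp_all add: L_def \<kappa>_def c4_def cpoly_pCons algebra_simps)
  have ind: "2 - 4 * (of_nat s - of_nat v :: complex) \<noteq> 0"
  proof
    assume "2 - 4 * (of_nat s - of_nat v :: complex) = 0"
    hence "of_int (2 - 4 * (int s - int v)) = (0 :: complex)" by simp
    hence "2 - 4 * (int s - int v) = 0" by (simp only: of_int_eq_0_iff)
    thus False by presburger
  qed
  have "poly P1 \<i> = (2 - 4 * (of_nat s - of_nat v)) * poly p1 \<i> * poly r1 \<i>"
    unfolding P1_def by (simp add: vals algebra_simps del: poly_pCons)
  hence "poly p1 \<i> = 0" using P1 ind r1i by simp
  moreover have "poly Q1 \<i> = (2 - 4 * (of_nat s - of_nat v)) * poly q1 \<i> * poly r1 \<i>"
    unfolding Q1_def by (simp add: vals algebra_simps del: poly_pCons)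
  hence "poly q1 \<i> = 0" using Q1 ind r1i by simp
  ultimately have "L dvd p1" "L dvd q1" by (simp_all add: L_def poly_eq_0_iff_dvd)
  thus ?case unfolding p1 q1 power_Suc2 by (simp add: mult_dvd_mono)
qed simp

text \<open>These u are the values of \<open>k^2\<close> on the imaginary axis. The integrals give
  bounds uniform up to u = -1, on the boundary of the disc of convergence.\<close>

lemma hF_nonpos_bounds:
  fixes u :: real
  assumes u: "-1 < u" "u \<le> 0"
  shows "0 \<le> hF 0 u" "hF 0 u \<le> 1" "0 \<le> hF 1 u" "hF 1 u \<le> 2"
proof -
  have u1: "\<bar>u\<bar> < 1" "u < 1" using u by auto
  have ge1: "1 \<le> sqrt (1 - u * (sin t)\<^sup>2)" for t
    using u mult_nonpos_nonneg[of u "(sin t)\<^sup>2"] by (intro real_sqrt_ge_one) simp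
  have le1: "1 / sqrt (1 - u * (sin t)\<^sup>2) \<le> 1" and ge0: "0 \<le> 1 / sqrt (1 - u * (sin t)\<^sup>2)" for t
    using ge1[of t] by (auto intro: order_trans[of 0 1])
  have c: "continuous_on {0..pi/2} (\<lambda>t. 1 / sqrt (1 - u * (sin t)\<^sup>2))"
    by (intro continuous_intros ballI W_nonzero[OF u1(1)])
  have c': "continuous_on {0..pi/2} (\<lambda>t. (sin t)\<^sup>2 / sqrt (1 - u * (sin t)\<^sup>2))"
    by (intro continuous_intros ballI W_nonzero[OF u1(1)])
  have b: "(sin t)\<^sup>2 / sqrt (1 - u * (sin t)\<^sup>2) \<le> 1" "0 \<le> (sin t)\<^sup>2 / sqrt (1 - u * (sin t)\<^sup>2)" for t
  proof -
    have "(sin t)\<^sup>2 * (1 / sqrt (1 - u * (sin t)\<^sup>2)) \<le> 1 * 1"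
      by (intro mult_mono le1 ge0 sin2_bounds) auto
    thus "(sin t)\<^sup>2 / sqrt (1 - u * (sin t)\<^sup>2) \<le> 1" by (simp only: times_divide_eq_right mult_1_right)
    have "0 \<le> (sin t)\<^sup>2 * (1 / sqrt (1 - u * (sin t)\<^sup>2))"
      by (intro mult_nonneg_nonneg ge0 sin2_bounds)
    thus "0 \<le> (sin t)\<^sup>2 / sqrt (1 - u * (sin t)\<^sup>2)" by (simp only: times_divide_eq_right mult_1_right)
  qed
  have i1: "integral {0..pi/2} (\<lambda>t. 1) = pi / 2" by simp
  note int = integrable_continuous_real[OF c] integrable_continuous_real[OF c']
  have "0 \<le> pi / 2 * hF 0 u" unfolding integral_K_series[OF u1(1), symmetric]
    by (intro integral_nonneg int ge0)
  hence "pi / 2 * 0 \<le> pi / 2 * hF 0 u" by (simp only: mult_zero_right)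
  thus "0 \<le> hF 0 u" by (rule mult_left_le_imp_le) (rule divide_pos_pos[OF pi_gt_zero], simp)
  have "pi / 2 * hF 0 u \<le> pi / 2" 
  proof -
    have "integral {0..pi/2} (\<lambda>t. 1 / sqrt (1 - u * (sin t)\<^sup>2)) \<le> integral {0..pi/2} (\<lambda>t. 1)"
      by (intro integral_le int le1 integrable_const_ivl)
    thus ?thesis by (simp only: integral_K_series[OF u1(1)] i1)
  qed
  hence "pi / 2 * hF 0 u \<le> pi / 2 * 1" by (simp only: mult_1_right)
  thus "hF 0 u \<le> 1" by (rule mult_left_le_imp_le) (rule divide_pos_pos[OF pi_gt_zero], simp)
  have "0 \<le> pi / 4 * hF 1 u" unfolding integral_sin2_series[OF u1(1), symmetric]
    by (intro integral_nonneg int b)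
  hence "pi / 4 * 0 \<le> pi / 4 * hF 1 u" by (simp only: mult_zero_right)
  thus "0 \<le> hF 1 u" by (rule mult_left_le_imp_le) (rule divide_pos_pos[OF pi_gt_zero], simp)
  have "pi / 4 * hF 1 u \<le> pi / 2" 
  proof -
    have "integral {0..pi/2} (\<lambda>t. (sin t)\<^sup>2 / sqrt (1 - u * (sin t)\<^sup>2)) \<le> integral {0..pi/2} (\<lambda>t. 1)"
      by (intro integral_le int b integrable_const_ivl)
    thus ?thesis by (simp only: integral_sin2_series[OF u1(1)] i1)
  qed
  hence "pi / 4 * hF 1 u \<le> pi / 4 * 2" by simp
  thus "hF 1 u \<le> 2" by (rule mult_left_le_imp_le) (rule divide_pos_pos[OF pi_gt_zero], simp)
qed

lemma Wfun_ge:
  assumes "-1 < u" "u \<le> 0"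
  shows "pi / 2 \<le> Wfun u"
proof -
  have "Wfun 0 \<le> Wfun u"
  proof (rule DERIV_nonpos_imp_nonincreasing[OF assms(2)])
    fix x assume x: "u \<le> x" "x \<le> 0"
    hence x1: "\<bar>x\<bar> < 1" and x2: "-1 < x" using assms by auto
    have "0 \<le> hF 1 x" by (rule hF_nonpos_bounds(3)[OF x2 x(2)])
    hence "- (pi / 8) * hF 1 x / sqrt (1 + x) \<le> 0"
      using x2 by (simp add: divide_nonneg_nonneg)
    thus "\<exists>y. (Wfun has_real_derivative y) (at x) \<and> y \<le> 0"
      using Wfun_has_derivative[OF x1] by blast
  qed
  thus ?thesis by (simp add: Wfun_0)
qed

text \<open>
  Independence of the three families. On the imaginary axis \<open>Wfun\<close> is bounded below by
  \<open>pi / 2\<close>, whereas \<open>indicial_divisibility\<close> makes the remaining terms vanish at \<open>\<i>\<close>.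
\<close>

lemma Ic_eq_0_imp:
  assumes I0: "\<And>w. w \<in> ball 0 1 \<Longrightarrow> Ic p q r w = 0"
  shows "p = 0 \<and> q = 0 \<and> r = 0"
proof (cases "r = 0")
  case True
  have "Gc (p + q) q w = 0" if "w \<in> ball 0 1" for w
  proof -
    have "of_real (pi / 2) * Gc (p + q) q w = Ic p q r w"
      unfolding Ic_def Gc_def Kc_def Ec_def True by (simp add: cpoly_add algebra_simps)
    hence "of_real (pi / 2) * Gc (p + q) q w = 0" using I0[OF that] by simp
    thus ?thesis by simp
  qed
  from Gc_eq_0_imp[OF this] show ?thesis using True by simp
next
  case r: False
  have dI: "deriv (Ic p q r) w = 0" if w: "w \<in> ball 0 1" for w
  proof (rule DERIV_imp_deriv)
    show "(Ic p q r has_field_derivative 0) (at w)"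
      by (rule has_field_derivative_transform_within_open[OF DERIV_const[of 0] open_ball w]) (simp add: I0)
  qed
  have "Fc p q r w = 0" if w: "w \<in> ball 0 1" for w
  proof -
    have "norm w < 1" using w by simp
    from elimination_identity[OF this, of r p q] have "of_real (pi / 2) * Fc p q r w = 0"
      using I0[OF w] dI[OF w] by simp
    thus ?thesis by simp
  qed
  from Gc_eq_0_imp[OF this] have Pp: "Pp p q r = 0" and Qp: "Qp p q r = 0" by auto
  define L v where "L = [:- \<i>, 1:]" and "v = order \<i> (cpoly r)"
  have "L ^ (v + 1) dvd cpoly p" "L ^ (v + 1) dvd cpoly q"
    using indicial_divisibility[OF Pp Qp r, of "v + 1"] unfolding L_def v_def by auto
  then obtain p2 q2 where p2: "cpoly p = L ^ (v + 1) * p2" and q2: "cpoly q = L ^ (v + 1) * q2"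
    by (auto simp: dvd_def)
  have "cpoly r \<noteq> 0" using r by simp
  then obtain r1 where r1: "cpoly r = L ^ v * r1" "\<not> L dvd r1"
    using order_decomp[of "cpoly r" \<i>] unfolding L_def v_def by blast
  \<comment> \<open>The majorant combines the blow-up of \<open>wc\<close> at \<open>\<i>\<close>,
    of order 1/2, with the extra factor \<open>L\<close> of p and q; what remains is a square root
    tending to 0.\<close>
  define g where "g = (\<lambda>y::real. 8 * sqrt (1 - y) * (norm (poly p2 (\<i> * of_real y)) + norm (poly q2 (\<i> * of_real y))))"
  have bound: "norm (poly r1 (\<i> * of_real y)) \<le> g y" if y: "0 < y" "y < 1" for y
  proof -
    define z where "z = \<i> * complex_of_real y"
    define u where "u = - (y\<^sup>2)"
    have nz: "norm z = y" using y by (simp add: z_def norm_mult)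
    have z: "z \<in> ball 0 1" using nz y by simp
    have z2: "z\<^sup>2 = of_real u" by (simp add: z_def u_def power_mult_distrib)
    have "y\<^sup>2 < 1" using y by (simp add: abs_square_less_1)
    hence u: "-1 < u" "u \<le> 0" "\<bar>u\<bar> < 1" by (auto simp: u_def)
    define k where "k = sqrt (1 + u)"
    have k: "k > 0" using u by (simp add: k_def)
    have hc: "hF j (z\<^sup>2) = of_real (hF j u)" for j
      unfolding z2 by (rule hF_of_real[OF u(3)])
    note hb = hF_nonpos_bounds[OF u(1,2)]
    have K: "norm (Kc z) \<le> 2"
    proof -
      have "norm (Kc z) = pi / 2 * hF 0 u" unfolding Kc_def hc using hb(1) by (simp add: norm_mult)
      also have "\<dots> \<le> 2 * 1" using hb pi_less_4 by (intro mult_mono) auto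
      finally show ?thesis by simp
    qed
    have E: "norm (Ec z) \<le> 4"
    proof -
      have "Ec z = of_real (pi / 2 * (hF 0 u - u / 2 * hF 1 u))" unfolding Ec_def hc by (simp add: z2)
      hence "norm (Ec z) = pi / 2 * \<bar>hF 0 u - u / 2 * hF 1 u\<bar>"
        by (simp only: norm_of_real abs_mult) simp
      also have "\<bar>hF 0 u - u / 2 * hF 1 u\<bar> \<le> 2"
      proof -
        have "0 \<le> (- u / 2) * hF 1 u" using u hb by (intro mult_nonneg_nonneg) auto
        moreover have "(- u / 2) * hF 1 u \<le> 1 / 2 * 2" using u hb by (intro mult_mono) auto
        ultimately show ?thesis using hb by simp
      qed
      hence "pi / 2 * \<bar>hF 0 u - u / 2 * hF 1 u\<bar> \<le> 2 * 2" using pi_less_4 by (intro mult_mono) auto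
      finally show ?thesis by simp
    qed
    have wz: "wc z = of_real ((1 - u) / k)"
      unfolding wc_def z2 csqrt_one_plus_of_real[OF u(1)] k_def by simp
    have w0: "wc z \<noteq> 0" using z by (intro wc_nonzero) simp
    have Wz: "Wc (z\<^sup>2) = of_real (Wfun u)" unfolding z2 by (rule Wc_of_real[OF u(3)])
    have Wge: "1 \<le> norm (Wc (z\<^sup>2))" unfolding Wz using Wfun_ge[OF u(1,2)] pi_gt3 by simp
    have "poly (cpoly r) z * Wc (z\<^sup>2) = - (wc z * (poly (cpoly p) z * Kc z + poly (cpoly q) z * Ec z))"
      using I0[OF z] w0 unfolding Ic_def Pic_def by (simp add: field_simps add_eq_0_iff)
    hence "norm (poly (cpoly r) z) * norm (Wc (z\<^sup>2)) = norm (wc z) * norm (poly (cpoly p) z * Kc z + poly (cpoly q) z * Ec z)"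
      by (metis norm_minus_cancel norm_mult)
    moreover have "norm (poly (cpoly r) z) * 1 \<le> norm (poly (cpoly r) z) * norm (Wc (z\<^sup>2))"
      using Wge by (intro mult_left_mono) auto
    moreover have "norm (wc z) * norm (poly (cpoly p) z * Kc z + poly (cpoly q) z * Ec z)
      \<le> (2 / k) * (norm (poly (cpoly p) z) * 4 + norm (poly (cpoly q) z) * 4)"
    proof (rule mult_mono)
      show "norm (wc z) \<le> 2 / k" unfolding wz norm_of_real using u k by (simp add: divide_right_mono)
      have "norm (poly (cpoly p) z * Kc z + poly (cpoly q) z * Ec z)
         \<le> norm (poly (cpoly p) z) * norm (Kc z) + norm (poly (cpoly q) z) * norm (Ec z)"
        by (metis norm_mult norm_triangle_ineq)
      also have "\<dots> \<le> norm (poly (cpoly p) z) * 4 + norm (poly (cpoly q) z) * 4"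
        using K E by (intro add_mono mult_left_mono) auto
      finally show "norm (poly (cpoly p) z * Kc z + poly (cpoly q) z * Ec z) \<le> norm (poly (cpoly p) z) * 4 + norm (poly (cpoly q) z) * 4" .
    qed (use k in auto)
    ultimately have main: "norm (poly (cpoly r) z) \<le> 8 / k * (norm (poly (cpoly p) z) + norm (poly (cpoly q) z))"
      by (simp add: algebra_simps)
    define x where "x = 1 - y"
    have x: "x > 0" using y by (simp add: x_def)
    have Lz: "norm (poly L z) = x"
    proof -
      have "poly L z = \<i> * of_real (y - 1)" by (simp add: L_def z_def algebra_simps)
      thus ?thesis using y by (simp only: norm_mult norm_of_real norm_ii) (simp add: x_def)
    qed
    have "x ^ v * norm (poly r1 z) \<le> 8 / k * (x ^ (v + 1) * norm (poly p2 z) + x ^ (v + 1) * norm (poly q2 z))"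
      using main unfolding r1(1) p2 q2 poly_mult poly_power norm_mult norm_power Lz .
    also have "\<dots> = x ^ v * (8 * (x / k) * (norm (poly p2 z) + norm (poly q2 z)))"
    proof -
      have "8 / k * (x ^ (v + 1) * A + x ^ (v + 1) * B) = x ^ v * (8 * (x / k) * (A + B))" for A B
        by (simp add: distrib_left add_divide_distrib mult_ac)
      thus ?thesis .
    qed
    finally have "norm (poly r1 z) \<le> 8 * (x / k) * (norm (poly p2 z) + norm (poly q2 z))"
      by (rule mult_left_le_imp_le) (simp add: x)
    \<comment> \<open>As \<open>1 - y^2 = (1 - y) * (1 + y)\<close>, the root k is at least the root
      of x.\<close>
    also have "x / k \<le> sqrt x"
    proof -
      have "1 + u = x * (1 + y)" by (simp add: u_def x_def algebra_simps power2_eq_square)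
      hence "k = sqrt x * sqrt (1 + y)" by (simp add: k_def real_sqrt_mult)
      moreover have "1 \<le> sqrt (1 + y)" using y by simp
      ultimately have "sqrt x \<le> k" using x by (simp add: mult_le_cancel_left1)
      hence "sqrt x * sqrt x \<le> sqrt x * k" using x by (intro mult_left_mono) auto
      hence "x \<le> sqrt x * k" using x by simp
      thus ?thesis using k by (simp add: divide_le_eq)
    qed
    hence "8 * (x / k) * (norm (poly p2 z) + norm (poly q2 z)) \<le> 8 * sqrt x * (norm (poly p2 z) + norm (poly q2 z))"
      by (intro mult_right_mono) auto
    finally show ?thesis unfolding g_def z_def x_def .
  qed
  have "((\<lambda>y. norm (poly r1 (\<i> * of_real y))) \<longlongrightarrow> norm (poly r1 (\<i> * of_real 1))) (at_left (1::real))"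
    by (intro tendsto_intros)
  moreover have "(g \<longlongrightarrow> 8 * sqrt (1 - 1) * (norm (poly p2 (\<i> * of_real 1)) + norm (poly q2 (\<i> * of_real 1)))) (at_left (1::real))"
    unfolding g_def by (intro tendsto_intros)
  moreover have "\<forall>\<^sub>F y in at_left (1::real). norm (poly r1 (\<i> * of_real y)) \<le> g y"
    by (rule eventually_mono[OF eventually_at_left_real[of 0 "1::real"]]) (use bound in auto)
  ultimately have "norm (poly r1 (\<i> * of_real 1)) \<le> 8 * sqrt (1 - 1) * (norm (poly p2 (\<i> * of_real 1)) + norm (poly q2 (\<i> * of_real 1)))"
    by (intro tendsto_le[of "at_left (1::real)"]) auto
  hence "poly r1 \<i> = 0" by simp
  hence "L dvd r1" by (simp add: L_def poly_eq_0_iff_dvd)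
  thus ?thesis using r1(2) by blast
qed

section \<open>The lower bound\<close>

text \<open>Points are chosen one at a time. The new function minus its interpolant vanishes on
  \<open>Y\<close> but, by independence, not on all of S; a point where it is nonzero enlarges
  \<open>Y\<close>, and multiples of this difference correct the value there without disturbing
  \<open>Y\<close>.\<close>

lemma interpolation_points:
  fixes \<phi> :: "nat \<Rightarrow> real \<Rightarrow> real"
  assumes "\<And>c. (\<And>x. x \<in> S \<Longrightarrow> (\<Sum>i<t. c i * \<phi> i x) = 0) \<Longrightarrow> (\<forall>i<t. c i = 0)"
  shows "\<exists>Y\<subseteq>S. finite Y \<and> card Y = t \<and> (\<forall>h. \<exists>c. \<forall>y\<in>Y. (\<Sum>i<t. c i * \<phi> i y) = h y)"
  using assms
proof (induction t)
  case 0
  show ?case by (intro exI[of _ "{}"]) auto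
next
  case (Suc t)
  have "\<exists>Y\<subseteq>S. finite Y \<and> card Y = t \<and> (\<forall>h. \<exists>c. \<forall>y\<in>Y. (\<Sum>i<t. c i * \<phi> i y) = h y)"
  proof (rule Suc.IH)
    fix c assume c: "\<And>x. x \<in> S \<Longrightarrow> (\<Sum>i<t. c i * \<phi> i x) = 0"
    have "(\<Sum>i<Suc t. (c(t := 0)) i * \<phi> i x) = 0" if "x \<in> S" for x
      using c[OF that] by simp
    from Suc.prems[OF this] show "\<forall>i<t. c i = 0" by (metis fun_upd_apply less_SucI less_irrefl)
  qed
  then obtain Y where Y: "Y \<subseteq> S" "finite Y" "card Y = t"
    and onto: "\<And>h. \<exists>c. \<forall>y\<in>Y. (\<Sum>i<t. c i * \<phi> i y) = h y" by blast
  obtain c where c: "\<And>y. y \<in> Y \<Longrightarrow> (\<Sum>i<t. c i * \<phi> i y) = \<phi> t y"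
    using onto[of "\<phi> t"] by blast
  define e where "e = (\<lambda>i. if i = t then 1 else - c i)"
  have e: "(\<Sum>i<Suc t. e i * \<phi> i x) = \<phi> t x - (\<Sum>i<t. c i * \<phi> i x)" for x
    by (simp add: e_def sum_negf)
  have "\<not> (\<forall>i<Suc t. e i = 0)" by (auto simp: e_def)
  then obtain x where x: "x \<in> S" "(\<Sum>i<Suc t. e i * \<phi> i x) \<noteq> 0" using Suc.prems[of e] by blast
  have eY: "(\<Sum>i<Suc t. e i * \<phi> i y) = 0" if "y \<in> Y" for y using c[OF that] e by simp
  have xY: "x \<notin> Y" using x eY by blast
  have "\<exists>c. \<forall>y\<in>insert x Y. (\<Sum>i<Suc t. c i * \<phi> i y) = h y" for h
  proof -
    obtain b where b: "\<And>y. y \<in> Y \<Longrightarrow> (\<Sum>i<t. b i * \<phi> i y) = h y" using onto[of h] by blast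
    define b' where "b' = b(t := 0)"
    have b': "(\<Sum>i<Suc t. b' i * \<phi> i y) = (\<Sum>i<t. b i * \<phi> i y)" for y by (simp add: b'_def)
    define k where "k = (h x - (\<Sum>i<Suc t. b' i * \<phi> i x)) / (\<Sum>i<Suc t. e i * \<phi> i x)"
    have lin: "(\<Sum>i<Suc t. (b' i + k * e i) * \<phi> i y) = (\<Sum>i<Suc t. b' i * \<phi> i y) + k * (\<Sum>i<Suc t. e i * \<phi> i y)" for y
      by (simp only: distrib_right sum.distrib sum_distrib_left mult.assoc)
    show ?thesis
    proof (intro exI[of _ "\<lambda>i. b' i + k * e i"] ballI)
      fix y assume "y \<in> insert x Y"
      thus "(\<Sum>i<Suc t. (b' i + k * e i) * \<phi> i y) = h y"
        unfolding lin using x(2) eY b b' by (auto simp del: sum.lessThan_Suc simp: k_def)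
    qed
  qed
  moreover have "card (insert x Y) = Suc t" using Y xY by simp
  ultimately show ?case using Y x by (intro exI[of _ "insert x Y"]) (auto simp del: sum.lessThan_Suc)
qed

section \<open>Sign-alternating combinations\<close>

lemma sum_lessThan_add: "(\<Sum>i<a + b. f i) = (\<Sum>i<a. f i) + (\<Sum>i<b. f (a + i :: nat) :: real)"
  by (induction b) (simp_all add: algebra_simps)

definition coeff_poly :: "(nat \<Rightarrow> real) \<Rightarrow> nat \<Rightarrow> real poly" where
  "coeff_poly c n = (\<Sum>i\<le>n. monom (c i) i)"

lemma coeff_coeff_poly: "coeff (coeff_poly c n) i = (if i \<le> n then c i else 0)"
  by (simp add: coeff_poly_def coeff_sum coeff_monom)

lemma degree_coeff_poly: "degree (coeff_poly c n) \<le> n"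
  by (intro degree_le) (simp add: coeff_coeff_poly)

lemma poly_coeff_poly: "poly (coeff_poly c n) x = (\<Sum>i<Suc n. c i * x ^ i)"
  by (simp add: coeff_poly_def poly_sum poly_monom lessThan_Suc_atMost)

lemma elliptic_comb_continuous: "continuous_on {-1<..<1} (elliptic_comb p q r)"
proof -
  have "continuous_on {-1<..<1} (\<lambda>x. Re (Ic p q r (of_real x)))"
    by (intro continuous_intros continuous_on_compose2[OF holomorphic_on_imp_continuous_on[OF Ic_holomorphic]]) auto
  also have "?this \<longleftrightarrow> continuous_on {-1<..<1} (elliptic_comb p q r)"
    by (rule continuous_on_cong) (auto simp: Ic_of_real)
  finally show ?thesis .
qed

lemma elliptic_comb_eq_0_imp:
  assumes "\<And>x. x \<in> {-1<..<1} \<Longrightarrow> elliptic_comb p q r x = 0"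
  shows "p = 0 \<and> q = 0 \<and> r = 0"
proof (rule Ic_eq_0_imp)
  fix w :: complex assume w: "w \<in> ball 0 1"
  show "Ic p q r w = 0"
  proof (rule analytic_continuation[OF Ic_holomorphic open_ball connected_ball _ _ _ _ w, where \<xi> = 0])
    show "complex_of_real ` {-1<..<1} \<subseteq> ball 0 1" by auto
    show "Ic p q r z = 0" if "z \<in> complex_of_real ` {-1<..<1}" for z
      using that assms by (auto simp: Ic_of_real)
    show "0 islimpt complex_of_real ` {-1<..<1}"
      unfolding islimpt_approachable
    proof (intro allI impI)
      fix e :: real assume "e > 0"
      thus "\<exists>x'\<in>complex_of_real ` {-1<..<1}. x' \<noteq> 0 \<and> dist x' 0 < e"
        by (intro bexI[of _ "of_real (min (1/2) (e/2))"]) (auto simp: image_iff)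
    qed
  qed simp
qed

lemma alternating_zeros:
  fixes f :: "real \<Rightarrow> real" and y :: "nat \<Rightarrow> real"
  assumes cont: "continuous_on {a<..<b} f"
    and y: "\<And>i. i \<le> N \<Longrightarrow> a < y i \<and> y i < b" "\<And>i j. i < j \<Longrightarrow> j \<le> N \<Longrightarrow> y i < y j"
    and sgn: "\<And>i. i \<le> N \<Longrightarrow> (-1) ^ i * f (y i) > 0"
    and fin: "finite {x \<in> {a<..<b}. f x = 0}"
  shows "N \<le> card {x \<in> {a<..<b}. f x = 0}"
proof -
  have "\<exists>z. y i < z \<and> z < y (Suc i) \<and> f z = 0" if i: "i < N" for i
  proof (rule ivt_sign)
    show "continuous_on {y i..y (Suc i)} f"
    proof (rule continuous_on_subset[OF cont])
      show "{y i..y (Suc i)} \<subseteq> {a<..<b}" using y(1)[of i] y(1)[of "Suc i"] i by auto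
    qed
    show "y i < y (Suc i)" using y(2) i by simp
    have "((-1) ^ i * f (y i)) * ((-1) ^ Suc i * f (y (Suc i))) > 0"
      using i by (intro mult_pos_pos sgn) auto
    moreover have "(s * A) * (- s * B) = - ((s * s) * (A * B))" for s A B :: real by simp
    moreover have "((-1::real) ^ i) * (-1) ^ i = 1" by (simp flip: power_mult_distrib)
    ultimately show "f (y i) * f (y (Suc i)) < 0"
      by (metis mult_1 neg_0_less_iff_less power_Suc mult_minus1)
  qed
  then obtain z where z: "\<And>i. i < N \<Longrightarrow> y i < z i \<and> z i < y (Suc i) \<and> f (z i) = 0" by metis
  have "z i < z j" if "i < j" "j < N" for i j
  proof -
    have "y (Suc i) \<le> y j" using y(2)[of "Suc i" j] that by (cases "Suc i = j") auto
    thus ?thesis using z[of i] z[of j] that by linarith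
  qed
  hence inj: "inj_on z {..<N}" by (intro linorder_inj_onI') (auto simp: order_less_le)
  have "z ` {..<N} \<subseteq> {x \<in> {a<..<b}. f x = 0}"
  proof
    fix x assume "x \<in> z ` {..<N}"
    then obtain i where i: "i < N" "x = z i" by auto
    thus "x \<in> {x \<in> {a<..<b}. f x = 0}" using z[OF i(1)] y(1)[of i] y(1)[of "Suc i"] by auto
  qed
  from card_mono[OF fin this] show ?thesis by (simp add: card_image[OF inj])
qed

lemma elliptic_alternation:
  "\<exists>p q r y. degree p \<le> m \<and> degree q \<le> n \<and> degree r \<le> l \<and>
     (\<forall>i\<le>m + n + l + 2. -1 < y i \<and> y i < 1 \<and> elliptic_comb p q r (y i) = (-1) ^ i) \<and>
     (\<forall>i j. i < j \<longrightarrow> j \<le> m + n + l + 2 \<longrightarrow> y i < (y j :: real))"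
proof -
  define N where "N = Suc m + Suc n + Suc l"
  define \<phi> :: "nat \<Rightarrow> real \<Rightarrow> real" where
    "\<phi> = (\<lambda>i x. if i < Suc m then x ^ i * ellipticK x
       else if i < Suc m + Suc n then x ^ (i - Suc m) * ellipticE x
       else x ^ (i - (Suc m + Suc n)) * ellipticPi (mu x) x)"
  define P Q R where "P = (\<lambda>c. coeff_poly c m)" and "Q = (\<lambda>c. coeff_poly (\<lambda>i. c (Suc m + i)) n)"
    and "R = (\<lambda>c. coeff_poly (\<lambda>i. c (Suc m + Suc n + i)) l)"
  have comb: "(\<Sum>i<N. c i * \<phi> i x) = elliptic_comb (P c) (Q c) (R c) x" for c x
  proof -
    have "(\<Sum>i<N. c i * \<phi> i x) = (\<Sum>i<Suc m. c i * \<phi> i x) + (\<Sum>i<Suc n. c (Suc m + i) * \<phi> (Suc m + i) x)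
       + (\<Sum>i<Suc l. c (Suc m + Suc n + i) * \<phi> (Suc m + Suc n + i) x)"
      unfolding N_def sum_lessThan_add ..
    also have "(\<Sum>i<Suc m. c i * \<phi> i x) = poly (P c) x * ellipticK x"
      unfolding P_def poly_coeff_poly sum_distrib_right by (rule sum.cong) (auto simp: \<phi>_def)
    also have "(\<Sum>i<Suc n. c (Suc m + i) * \<phi> (Suc m + i) x) = poly (Q c) x * ellipticE x"
      unfolding Q_def poly_coeff_poly sum_distrib_right by (rule sum.cong) (auto simp: \<phi>_def)
    also have "(\<Sum>i<Suc l. c (Suc m + Suc n + i) * \<phi> (Suc m + Suc n + i) x) = poly (R c) x * ellipticPi (mu x) x"
      unfolding R_def poly_coeff_poly sum_distrib_right by (rule sum.cong) (auto simp: \<phi>_def)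
    finally show ?thesis by (simp add: elliptic_comb_def)
  qed
  have "\<exists>Y\<subseteq>{-1<..<1}. finite Y \<and> card Y = N \<and> (\<forall>h. \<exists>c. \<forall>y\<in>Y. (\<Sum>i<N. c i * \<phi> i y) = h y)"
  proof (rule interpolation_points)
    fix c assume "\<And>x. x \<in> {-1<..<1} \<Longrightarrow> (\<Sum>i<N. c i * \<phi> i x) = 0"
    hence "P c = 0 \<and> Q c = 0 \<and> R c = 0" unfolding comb by (rule elliptic_comb_eq_0_imp)
    hence z: "coeff (P c) i = 0" "coeff (Q c) i = 0" "coeff (R c) i = 0" for i by auto
    show "\<forall>i<N. c i = 0"
    proof (intro allI impI)
      fix i assume i: "i < N"
      consider "i \<le> m" | j where "i = Suc m + j" "j \<le> n" | j where "i = Suc m + Suc n + j" "j \<le> l"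
      proof (cases "i \<le> m")
        case False
        note F = this
        show ?thesis
        proof (cases "i \<le> Suc m + n")
          case True
          thus ?thesis using F that(2)[of "i - Suc m"] by auto
        next
          case False
          thus ?thesis using F i that(3)[of "i - (Suc m + Suc n)"] by (auto simp: N_def)
        qed
      qed (use that(1) in auto)
      thus "c i = 0"
      proof cases
        case 1 thus ?thesis using z(1)[of i] by (simp add: P_def coeff_coeff_poly)
      next
        case (2 j) thus ?thesis using z(2)[of j] by (simp add: Q_def coeff_coeff_poly)
      next
        case (3 j) thus ?thesis using z(3)[of j] by (simp add: R_def coeff_coeff_poly)
      qed
    qed
  qed
  then obtain Y where Y: "Y \<subseteq> {-1<..<1}" "finite Y" "card Y = N"
    and onto: "\<And>h. \<exists>c. \<forall>y\<in>Y. elliptic_comb (P c) (Q c) (R c) y = h y" unfolding comb by blast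
  define ys where "ys = sorted_list_of_set Y"
  have len: "length ys = N" and set: "set ys = Y" using Y by (auto simp: ys_def)
  have mono: "ys ! i < ys ! j" if "i < j" "j < N" for i j
    using strict_sorted_list_of_set[of Y] sorted_wrt_nth_less[of "(<)" ys i j] that len by (simp add: ys_def)
  have mem: "ys ! i \<in> Y" if "i < N" for i using that len set nth_mem by metis
  have inj: "inj_on ((!) ys) {..<N}" by (intro linorder_inj_onI') (auto dest: mono)
  \<comment> \<open>The sign prescribed at y is given by the position of y in the sorted
    list.\<close>
  obtain c where c: "\<And>y. y \<in> Y \<Longrightarrow> elliptic_comb (P c) (Q c) (R c) y = (-1) ^ (the_inv_into {..<N} ((!) ys) y)"
    using onto[of "\<lambda>y. (-1) ^ (the_inv_into {..<N} ((!) ys) y)"] by blast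
  have val: "elliptic_comb (P c) (Q c) (R c) (ys ! i) = (-1) ^ i" if "i < N" for i
    using c[OF mem[OF that]] the_inv_into_f_f[OF inj, of i] that by simp
  have N: "i < N \<longleftrightarrow> i \<le> m + n + l + 2" for i by (auto simp: N_def)
  show ?thesis
  proof (intro exI conjI allI impI)
    show "degree (P c) \<le> m" "degree (Q c) \<le> n" "degree (R c) \<le> l"
      unfolding P_def Q_def R_def by (rule degree_coeff_poly)+
    fix i assume "i \<le> m + n + l + 2"
    hence i: "i < N" using N by simp
    show "-1 < ys ! i" "ys ! i < 1" using mem[OF i] Y(1) by auto
    show "elliptic_comb (P c) (Q c) (R c) (ys ! i) = (-1) ^ i" by (rule val[OF i])
  next
    fix i j assume "i < j" "j \<le> m + n + l + 2"
    thus "ys ! i < ys ! j" using mono N by blast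
  qed
qed

lemma zeros_lower_bound:
  "\<exists>p q r :: real poly.
     degree p = m \<and> degree q = n \<and> degree r = l \<and> p \<noteq> 0 \<and> q \<noteq> 0 \<and> r \<noteq> 0 \<and>
     (\<exists>k \<in> {-1<..<1}. elliptic_comb p q r k \<noteq> 0) \<and>
     m + n + l + 2 \<le> card (isolated_zeros_on (elliptic_comb p q r) {-1<..<1})"
proof -
  define N where "N = m + n + l + 2"
  obtain p0 q0 r0 and y :: "nat \<Rightarrow> real" where
    deg: "degree p0 \<le> m" "degree q0 \<le> n" "degree r0 \<le> l"
    and y: "\<And>i. i \<le> N \<Longrightarrow> -1 < y i \<and> y i < 1"
    and val: "\<And>i. i \<le> N \<Longrightarrow> elliptic_comb p0 q0 r0 (y i) = (-1) ^ i"
    and mono: "\<And>i j. i < j \<Longrightarrow> j \<le> N \<Longrightarrow> y i < y j"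
    using elliptic_alternation[of m n l] unfolding N_def by blast
  define g where "g = elliptic_comb (monom 1 m) (monom 1 n) (monom 1 l)"
  \<comment> \<open>A strict bound for g at the nodes, so that a perturbation with e below
    \<open>1 / G\<close> cannot reverse the values of modulus 1 there.\<close>
  define G where "G = Max ((\<lambda>i. \<bar>g (y i)\<bar>) ` {..N}) + 1"
  have G: "\<bar>g (y i)\<bar> < G" if "i \<le> N" for i
  proof -
    have "\<bar>g (y i)\<bar> \<le> Max ((\<lambda>i. \<bar>g (y i)\<bar>) ` {..N})" using that by (intro Max_ge) auto
    thus ?thesis by (simp add: G_def)
  qed
  have G0: "G > 0" using G[of 0] by (meson abs_ge_zero le0 le_less_trans)
  \<comment> \<open>The perturbation must not cancel a leading coefficient, which excludes at most
    three values of e.\<close>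
  have "infinite ({0<..<1 / G} - {- coeff p0 m, - coeff q0 n, - coeff r0 l})"
    using G0 by (intro Diff_infinite_finite) auto
  from infinite_imp_nonempty[OF this] obtain e where
    "e \<in> {0<..<1 / G} - {- coeff p0 m, - coeff q0 n, - coeff r0 l}" by blast
  hence e: "0 < e" "e < 1 / G" and lead: "coeff p0 m + e \<noteq> 0" "coeff q0 n + e \<noteq> 0" "coeff r0 l + e \<noteq> 0"
    by auto
  define p q r where "p = p0 + smult e (monom 1 m)" and "q = q0 + smult e (monom 1 n)"
    and "r = r0 + smult e (monom 1 l)"
  have dg: "degree (f + smult e (monom 1 k)) = k \<and> f + smult e (monom 1 k) \<noteq> 0"
    if "degree f \<le> k" "coeff f k + e \<noteq> 0" for f :: "real poly" and k
  proof -
    have c: "coeff (f + smult e (monom 1 k)) k \<noteq> 0" using that(2) by simp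
    have "degree (f + smult e (monom 1 k)) \<le> k"
      using that(1) by (intro degree_add_le order_trans[OF degree_smult_le] degree_monom_le)
    moreover have "k \<le> degree (f + smult e (monom 1 k))" by (rule le_degree[OF c])
    moreover have "f + smult e (monom 1 k) \<noteq> 0" using c by (metis coeff_0)
    ultimately show ?thesis by (simp only: le_antisym simp_thms)
  qed
  have pqr: "degree p = m" "p \<noteq> 0" "degree q = n" "q \<noteq> 0" "degree r = l" "r \<noteq> 0"
    unfolding p_def q_def r_def using dg[OF deg(1) lead(1)] dg[OF deg(2) lead(2)] dg[OF deg(3) lead(3)] by auto
  define f where "f = elliptic_comb p q r"
  have f: "f x = elliptic_comb p0 q0 r0 x + e * g x" for x
    by (simp add: f_def g_def elliptic_comb_def p_def q_def r_def algebra_simps)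
  have sgn: "(-1) ^ i * f (y i) > 0" if i: "i \<le> N" for i
  proof -
    have "\<bar>e * g (y i)\<bar> \<le> e * G" using G[OF i] e by (simp add: abs_mult)
    also have "\<dots> < 1" using e G0 by (simp add: less_divide_eq)
    finally have "\<bar>(-1) ^ i * (e * g (y i))\<bar> < 1" by (simp add: abs_mult)
    hence "(-1) ^ i * (e * g (y i)) > -1" by linarith
    moreover have "(-1) ^ i * f (y i) = 1 + (-1) ^ i * (e * g (y i))"
      unfolding f val[OF i] by (simp add: distrib_left flip: power_mult_distrib)
    ultimately show ?thesis by linarith
  qed
  have f0: "f (y 0) \<noteq> 0" using sgn[of 0] by auto
  have y0: "y 0 \<in> {-1<..<1}" using y[of 0] by auto
  have y1: "\<bar>y 0\<bar> < 1" using y[of 0] by auto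
  have "complex_of_real (y 0) \<in> ball 0 1" using y1 by simp
  moreover have "Ic p q r (of_real (y 0)) \<noteq> 0"
    using f0 Ic_of_real[OF y1, of p q r] by (simp add: f_def)
  ultimately have "\<exists>w\<in>ball 0 1. Ic p q r w \<noteq> 0" by blast
  \<comment> \<open>The upper bound makes the zero set finite, and hence every zero
    isolated.\<close>
  from finite_if_real_zeros_le[OF Ic_zeros_psi[OF pqr(1,3,5,6) this] order_refl]
  have fin: "finite {x \<in> {-1<..<1}. f x = 0}" by (simp only: f_def)
  have "N \<le> card {x \<in> {-1<..<1}. f x = 0}"
    by (rule alternating_zeros[OF _ y mono sgn fin]) (simp_all add: f_def elliptic_comb_continuous)
  also have "{x \<in> {-1<..<1}. f x = 0} = isolated_zeros_on f {-1<..<1}"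
  proof
    show "{x \<in> {-1<..<1}. f x = 0} \<subseteq> isolated_zeros_on f {-1<..<1}"
    proof
      fix x assume x: "x \<in> {x \<in> {-1<..<1}. f x = 0}"
      have "open (- ({x \<in> {-1<..<1}. f x = 0} - {x}))"
        using fin by (intro open_Compl finite_imp_closed) auto
      moreover have "- ({x \<in> {-1<..<1}. f x = 0} - {x}) \<inter> {x \<in> {-1<..<1}. f x = 0} = {x}"
        using x by blast
      ultimately show "x \<in> isolated_zeros_on f {-1<..<1}"
        unfolding isolated_zeros_on_def isolated_in_def using x by blast
    qed
  qed (rule isolated_zeros_on_subset)
  finally show ?thesis using pqr f0 y0 unfolding f_def N_def by blast
qed

theorem theorem1p4:
  fixes m n l :: nat
  shows "(\<forall>p q r :: real poly.
            degree p = m \<and> degree q = n \<and> degree r = l \<and> r \<noteq> 0 \<longrightarrow>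
              finite (isolated_zeros_on (elliptic_comb p q r) {-1<..<1}) \<and>
              (\<Sum>k \<in> isolated_zeros_on (elliptic_comb p q r) {-1<..<1}.
                 zero_multiplicity (elliptic_comb p q r) k) \<le> psi m n l) \<and>
         (\<exists>p q r :: real poly.
            degree p = m \<and> degree q = n \<and> degree r = l \<and> p \<noteq> 0 \<and> q \<noteq> 0 \<and> r \<noteq> 0 \<and>
            (\<exists>k \<in> {-1<..<1}. elliptic_comb p q r k \<noteq> 0) \<and>
            m + n + l + 2 \<le> card (isolated_zeros_on (elliptic_comb p q r) {-1<..<1}))"
  by (rule conjI[OF _ zeros_lower_bound]) (use zeros_upper_bound in blast)

end
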